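(* Let $\lambda \in \bigl(0, \frac{\ell}{2(\tau + (2\ell-1)L)}\bigr)$ and an integer $T\ge 1$ be fixed, and let $\{X^k\}_{k=0}^{T}$ be the iterates generated by the algorithm RSSM (described in the context) with the following stepsizes. (a) If $\gamma_k = \frac{\Delta}{\sqrt{\ell(T+1)}}$ for $k=0,1,\ldots,T$, where $\Delta \in (0, \frac{1}{L}]$ is any constant, then $$\min_{0 \leq k \leq T} \mathbb{E}[\Theta_{\lambda f}^{\mathfrak C}(X^k)^2] \leq \frac{f_\lambda^{\mathfrak C}(X^{0}) - \min\limits_{X \in \mathrm{St}(n,p)} f_\lambda^{\mathfrak C}(X) + \frac{9L^2\Delta^2}{2\lambda \ell} + \frac{2L^3\Delta^3}{\lambda\sqrt{\ell(T+1)}} + \frac{L^4\Delta^4}{2\lambda \ell(T+1)}}{\frac{\lambda}{\ell}\left(\frac{\ell}{2\lambda}- (\tau+(2\ell-3) L)\right) \cdot \frac{\Delta}{\sqrt{\ell}} \sqrt{T+1}}.$$ (b) If $\gamma_k = \frac{\Delta_k}{\sqrt{\ell(k+1)}}$ with $\Delta_k \in [\Delta_{\min}, \frac{1}{L}]$ for $k=0,1,\ldots,T$, where $\Delta_{\min} > 0$ is any constant, then $$\min_{0 \leq k \leq T} \mathbb{E}[\Theta_{\lambda f}^{\mathfrak C}(X^k)^2] \leq \frac{f_\lambda^{\mathfrak C}(X^{0}) - \min\limits_{X \in \mathrm{St}(n,p)} f_\lambda^{\mathfrak C}(X) + \frac{9(1 + \log T) + 6\sqrt{\ell} + 2}{2\lambda\ell}}{\frac{\lambda}{\ell}\left(\frac{\ell}{2\lambda}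 - (\tau+(2\ell-3) L)\right) \cdot \frac{\Delta_{\min}}{\sqrt{\ell}} \sqrt{T+1}}.$$
   Context: Let $n\ge p\ge 1$ be integers, $\mathrm{St}(n,p)=\{X\in\mathbb{R}^{n\times p}: X^\top X=I\}$, $[p]=\{1,\dots,p\}$. Matrix spaces carry the Frobenius inner product $\langle\xi,\eta\rangle=\mathrm{tr}(\xi^\top\eta)$ and norm $\|\cdot\|$. Let $f:\mathbb{R}^{n\times p}\to\mathbb{R}$ be $\tau$-weakly convex (i.e. $f(\cdot)+\frac{\tau}{2}\|\cdot\|^2$ is convex) and $L$-Lipschitz continuous on some bounded convex neighborhood $\Omega$ of $\mathrm{St}(n,p)$, where $\tau\ge 0$ and $L>0$. $\partial f$ is the Clarke subdifferential. Column blocks. Let $\mathfrak C=\{C_1,\dots,C_\ell\}$ be a partition of $[p]$ with $\ell\ge 2$; $\binom{[\ell]}{2}$ is the set of unordered pairs of distinct elements of $\{1,\dots,\ell\}$. For $C\subseteq[p]$, $X_C$ is the submatrix of $X$ formed by the columns with indices in $C$; $I_C$ is the corresponding submatrix of the $p\times p$ identity, so $X_C=XI_C$. For $\{i,j\}\in\binom{[\ell]}{2}$ put $C_{ij}=C_i\cup C_j$, $p_{ij}=|C_{ij}|$, $X_{ij}=X_{C_{ij}}$, $I_{ij}=I_{C_{ij}}$, $X_{-ij}=X_{[p]\setminus C_{ij}}$ and, for $X \in \mathrm{St}(n,p)$, $\mathcal M_{X_{-ij}}=\{Y\in\mathrm{St}(n,p_{ij}): X_{-ij}^\top Y=0\}$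 (a smooth submanifold), with tangent space $T_{X_{ij}}\mathcal M_{X_{-ij}}=\{\xi\in\mathbb{R}^{n\times p_{ij}}:\xi^\top X_{ij}+X_{ij}^\top\xi=0,\ X_{-ij}^\top\xi=0\}$. $\mathcal P_S$ denotes the nearest-point projection onto a set $S$ in the Frobenius norm. Algorithm RSSM. Input: $X^0\in\mathrm{St}(n,p)$ (deterministic), the partition $\mathfrak C$, deterministic stepsizes $\gamma_k\in(0,\frac1L)$. At iteration $k$: a subgradient $\widetilde\nabla f(X^k)\in\partial f(X^k)$ is selected (before the random draw of iteration $k$); a pair $\{i,j\}$ is drawn uniformly from $\binom{[\ell]}{2}$, independently of the past; set $G=\mathcal P_{T_{X^k_{ij}}\mathcal M_{X^k_{-ij}}}(\widetilde\nabla f(X^k)I_{ij})$; and update $X^{k+1}_{ij}=\mathcal P_{\mathcal M_{X^k_{-ij}}}(X^k_{ij}-\gamma_k G)=\mathcal P_{\mathrm{St}(n,p_{ij})}(X^k_{ij}-\gamma_kG)$ (these projections are unique and equal), $X^{k+1}_{-ij}=X^k_{-ij}$. Averaging operator. For $X\in\mathrm{St}(n,p)$, $\mathcal A_X:\mathbb{R}^{n\times p}\to\mathbb{R}^{n\times p}$ is the linear operator $\mathcal A_X(\xi)=\binom{\ell}{2}^{-1}\sum_{\{i,j\}\in\binom{[\ell]}{2}}(I-X_{-ij}X_{-ij}^\top)\xi_{ij}I_{ij}^\top$, with $\xi_{ij}=\xi I_{ij}$. It is self-adjoint and positive definite; $\|\xi\|_{\mathcal A_X^{-1}}=\sqrt{\langle\mathcal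 A_X^{-1}(\xi),\xi\rangle}$. Adaptive Moreau envelope, proximal map and stationarity measure, for $X\in\mathrm{St}(n,p)$: $f_\lambda^{\mathfrak C}(X)=\min_{Y\in\mathrm{St}(n,p)}\{f(Y)+\frac1{2\lambda}\|Y-X\|_{\mathcal A_X^{-1}}^2\}$, $P_{\lambda f}^{\mathfrak C}(X)=\mathrm{argmin}_{Y\in\mathrm{St}(n,p)}\{f(Y)+\frac1{2\lambda}\|Y-X\|_{\mathcal A_X^{-1}}^2\}$ (single-valued for $\lambda$ in the range considered), $\Theta_{\lambda f}^{\mathfrak C}(X)=\frac1\lambda\|P_{\lambda f}^{\mathfrak C}(X)-X\|_{\mathcal A_X^{-1}}$. *)

theory Defs
  imports "HOL-Probability.Probability" "HOL-Library.Ramsey"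
begin

text \<open>
  An n-by-p matrix is an element of \<open>real^'p^'n\<close>, with n = \<open>CARD('n)\<close> and p = \<open>CARD('p)\<close>. The library
  inner product and norm on this type are the Frobenius ones.
\<close>

lemma frobenius_inner:
  fixes X Y :: "real^'p^'n"
  shows "inner X Y = trace (transpose X ** Y)"
  unfolding trace_def inner_vec_def matrix_matrix_mult_def transpose_def
  by (simp, subst sum.swap, simp)

section \<open>Weak convexity and the Clarke subdifferential\<close>

definition weakly_convex_on :: "real \<Rightarrow> 'a::real_normed_vector set \<Rightarrow> ('a \<Rightarrow> real) \<Rightarrow> bool" where
  "weakly_convex_on \<tau> S f \<longleftrightarrow> convex_on S (\<lambda>x. f x + \<tau> / 2 * (norm x)\<^sup>2)"

definition clarke_dderiv :: "('a::real_normed_vector \<Rightarrow> real) \<Rightarrow> 'a \<Rightarrow> 'a \<Rightarrow> ereal" where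
  "clarke_dderiv f x v =
     Limsup (nhds x \<times>\<^sub>F at_right 0) (\<lambda>(y, t::real). ereal ((f (y + t *\<^sub>R v) - f y) / t))"

definition clarke_subdiff :: "('a::real_inner \<Rightarrow> real) \<Rightarrow> 'a \<Rightarrow> 'a set" where
  "clarke_subdiff f x = {g. \<forall>v. ereal (inner g v) \<le> clarke_dderiv f x v}"

section \<open>Stiefel manifold and column blocks\<close>

definition stiefel :: "(real^'p^'n) set" where
  "stiefel = {X. transpose X ** X = mat 1}"

text \<open>
  The number of columns of a submatrix depends on the index set, hence cannot be a type. The space
  of matrices with n rows and columns indexed by \<open>C \<subseteq> UNIV\<close> is therefore represented isometrically by
  the matrices in \<open>real^'p^'n\<close> whose columns outside C vanish (\<open>block_space C\<close>). In this representation
  \<open>colsel C\<close> plays two roles: it is the selector \<open>I\<^sub>C\<close>, so that \<open>X ** colsel C\<close> is the submatrix \<open>X\<^sub>C\<close>,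
  and it is the identity matrix of order \<open>card C\<close>.
\<close>

definition colsel :: "'p set \<Rightarrow> real^'p^'p" where
  "colsel C = (\<chi> i j. if i = j \<and> j \<in> C then 1 else 0)"

lemma submatrix_nth:
  fixes X :: "real^'p^'n"
  shows "(X ** colsel C) $ i $ j = (if j \<in> C then X $ i $ j else 0)"
  by (auto simp: matrix_matrix_mult_def colsel_def if_distrib cong: if_cong)

definition block_space :: "'p set \<Rightarrow> (real^'p^'n) set" where
  "block_space C = {Y. \<forall>i. \<forall>j. j \<notin> C \<longrightarrow> Y $ i $ j = 0}"

definition block_stiefel :: "'p set \<Rightarrow> (real^'p^'n) set" where
  "block_stiefel C = {Y \<in> block_space C. transpose Y ** Y = colsel C}"

text \<open>For an index set C (a union of two blocks), \<open>X ** colsel C\<close> and \<open>X ** colsel (- C)\<close> are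
  \<open>X\<^sub>i\<^sub>j\<close> and \<open>X\<^sub>-\<^sub>i\<^sub>j\<close>.\<close>

definition block_manifold :: "real^'p^'n \<Rightarrow> 'p set \<Rightarrow> (real^'p^'n) set" where
  "block_manifold X C = {Y \<in> block_stiefel C. transpose (X ** colsel (- C)) ** Y = 0}"

definition block_tangent :: "real^'p^'n \<Rightarrow> 'p set \<Rightarrow> (real^'p^'n) set" where
  "block_tangent X C =
     {\<xi> \<in> block_space C.
        transpose \<xi> ** (X ** colsel C) + transpose (X ** colsel C) ** \<xi> = 0 \<and>
        transpose (X ** colsel (- C)) ** \<xi> = 0}"

definition column_partition :: "(nat \<Rightarrow> 'p set) \<Rightarrow> nat \<Rightarrow> bool" where
  "column_partition \<CC> l \<longleftrightarrow> 2 \<le> l \<and> inj_on \<CC> {1..l} \<and> partition_on UNIV (\<CC> ` {1..l})"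

text \<open>An unordered pair of distinct elements of \<open>{1..l}\<close> is a two-element subset e.\<close>

definition pair_cols :: "(nat \<Rightarrow> 'p set) \<Rightarrow> nat set \<Rightarrow> 'p set" where
  "pair_cols \<CC> e = (\<Union>i\<in>e. \<CC> i)"

section \<open>Averaging operator, adaptive Moreau envelope, stationarity measure\<close>

definition avg_op :: "(nat \<Rightarrow> 'p set) \<Rightarrow> nat \<Rightarrow> real^'p^'n \<Rightarrow> real^'p^'n \<Rightarrow> real^'p^'n" where
  "avg_op \<CC> l X \<xi> =
     (1 / real (l choose 2)) *\<^sub>R
       (\<Sum>e\<in>nsets {1..l} 2.
          let C = pair_cols \<CC> e
          in (mat 1 - (X ** colsel (- C)) ** transpose (X ** colsel (- C)))
               ** (\<xi> ** colsel C) ** transpose (colsel C))"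

definition avg_inv_norm :: "(nat \<Rightarrow> 'p set) \<Rightarrow> nat \<Rightarrow> real^'p^'n \<Rightarrow> real^'p^'n \<Rightarrow> real" where
  "avg_inv_norm \<CC> l X \<xi> = sqrt (inner (inv (avg_op \<CC> l X) \<xi>) \<xi>)"

definition prox_objective ::
  "(real^'p^'n \<Rightarrow> real) \<Rightarrow> (nat \<Rightarrow> 'p set) \<Rightarrow> nat \<Rightarrow> real \<Rightarrow> real^'p^'n \<Rightarrow> real^'p^'n \<Rightarrow> real" where
  "prox_objective f \<CC> l lam X Y = f Y + 1 / (2 * lam) * (avg_inv_norm \<CC> l X (Y - X))\<^sup>2"

text \<open>The infimum is attained, because \<open>stiefel\<close> is compact and f is continuous on it.\<close>

definition moreau_env ::
  "(real^'p^'n \<Rightarrow> real) \<Rightarrow> (nat \<Rightarrow> 'p set) \<Rightarrow> nat \<Rightarrow> real \<Rightarrow> real^'p^'n \<Rightarrow> real" where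
  "moreau_env f \<CC> l lam X = (INF Y\<in>stiefel. prox_objective f \<CC> l lam X Y)"

definition prox_map ::
  "(real^'p^'n \<Rightarrow> real) \<Rightarrow> (nat \<Rightarrow> 'p set) \<Rightarrow> nat \<Rightarrow> real \<Rightarrow> real^'p^'n \<Rightarrow> real^'p^'n" where
  "prox_map f \<CC> l lam X = arg_min_on (prox_objective f \<CC> l lam X) stiefel"

definition stat_measure ::
  "(real^'p^'n \<Rightarrow> real) \<Rightarrow> (nat \<Rightarrow> 'p set) \<Rightarrow> nat \<Rightarrow> real \<Rightarrow> real^'p^'n \<Rightarrow> real" where
  "stat_measure f \<CC> l lam X = 1 / lam * avg_inv_norm \<CC> l X (prox_map f \<CC> l lam X - X)"

section \<open>The algorithm\<close>

text \<open>
  T iterations on a probability space M, producing \<open>X 0, \<dots>, X T\<close>. The sigma-algebra \<open>F k\<close> is the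
  information available just before the draw of iteration k; it contains the iterate \<open>X k\<close> and the
  selected subgradient \<open>g k\<close>, and the pair \<open>e k\<close> is independent of it. The selection of subgradients
  may itself be randomised.
\<close>

locale rssm = prob_space M + filtration "space M" F
  for M :: "'w measure" and F :: "nat \<Rightarrow> 'w measure" +
  fixes f :: "real^'p^'n \<Rightarrow> real" and L :: real
    and \<CC> :: "nat \<Rightarrow> 'p set" and l :: nat
    and \<gamma> :: "nat \<Rightarrow> real" and T :: nat and X0 :: "real^'p^'n"
    and X :: "nat \<Rightarrow> 'w \<Rightarrow> real^'p^'n"
    and g :: "nat \<Rightarrow> 'w \<Rightarrow> real^'p^'n"
    and e :: "nat \<Rightarrow> 'w \<Rightarrow> nat set"
  assumes sets_F: "\<And>k. sets (F k) \<subseteq> sets M"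
    and X0_stiefel: "X0 \<in> stiefel"
    and stepsize: "\<And>k. k < T \<Longrightarrow> 0 < \<gamma> k \<and> \<gamma> k < 1 / L"
    and X_measurable: "\<And>k. k \<le> T \<Longrightarrow> X k \<in> borel_measurable (F k)"
    and g_measurable: "\<And>k. k < T \<Longrightarrow> g k \<in> borel_measurable (F k)"
    and e_measurable: "\<And>k. k < T \<Longrightarrow> e k \<in> measurable (F (Suc k)) (count_space (nsets {1..l} 2))"
    and e_uniform: "\<And>k. k < T \<Longrightarrow>
      distr M (count_space (nsets {1..l} 2)) (e k) = uniform_count_measure (nsets {1..l} 2)"
    and e_indep: "\<And>k. k < T \<Longrightarrow>
      indep_set (sets (F k))
        (sets (vimage_algebra (space M) (e k) (count_space (nsets {1..l} 2))))"
    and X_init: "\<And>\<omega>. \<omega> \<in> space M \<Longrightarrow> X 0 \<omega> = X0"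
    and subgrad: "\<And>k \<omega>. k < T \<Longrightarrow> \<omega> \<in> space M \<Longrightarrow> g k \<omega> \<in> clarke_subdiff f (X k \<omega>)"
    and step_ij: "\<And>k \<omega> C G. k < T \<Longrightarrow> \<omega> \<in> space M \<Longrightarrow> C = pair_cols \<CC> (e k \<omega>) \<Longrightarrow>
      G = closest_point (block_tangent (X k \<omega>) C) (g k \<omega> ** colsel C) \<Longrightarrow>
      X (Suc k) \<omega> ** colsel C =
        closest_point (block_manifold (X k \<omega>) C) (X k \<omega> ** colsel C - \<gamma> k *\<^sub>R G)"
    and step_rest: "\<And>k \<omega> C. k < T \<Longrightarrow> \<omega> \<in> space M \<Longrightarrow> C = pair_cols \<CC> (e k \<omega>) \<Longrightarrow>
      X (Suc k) \<omega> ** colsel (- C) = X k \<omega> ** colsel (- C)"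

end

theory Submission
  imports Defs
begin

text \<open>
  The inverse of the averaging operator is explicit: on a column of block i it is
  \<open>l/2 (I + (l - 2) Q)\<close>, where Q is the orthogonal projection onto the columns of X outside block i.
  Hence, for Y in the Stiefel manifold, the squared adapted norm of \<open>d = Y - X\<close> is
  \<open>l/2 W\<close> with \<open>W = |d|\<^sup>2 + (l - 2) V\<close>, where V is the sum of the squared inner products of columns of X
  and Y in different blocks. Let Y be the proximal point of X. Since X and Y are both orthonormal, the symmetric
  part of \<open>X\<^sup>T d\<close> is \<open>- d\<^sup>T d / 2\<close>; so the normal component of the subgradient contributes only terms quadratic
  in d, and the average over the block pairs of the first-order change of W is \<open>4 \<gamma> / l\<close> times the
  inner product of the subgradient and d, up to \<open>2 (2 l - 3) \<gamma> L W / l\<close>. The error of the metric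
  projection is of second order, because a Cayley transform gives a point of the manifold within
  \<open>|B|\<^sup>2 / \<surd>2\<close> of the tangent step B. Weak convexity turns the inner product into a decrease of the
  envelope proportional to the squared stationarity measure, with an error \<open>9 L\<^sup>2 \<gamma>\<^sup>2 / (2 \<lambda>)\<close>, and the sum telescopes.
  For \<lambda> in the given range, proximal points are unique, hence depend continuously on X, and the stationarity measure
  is measurable.
\<close>

section \<open>Columns, and the Cayley transform\<close>

text \<open>The metric of the envelope moves with the iterate. The old proximal point Y is kept as
  competitor for the new iterate Z, so only W has to be followed while X changes both as base point
  and as metric. This is possible because columns of an orthonormal matrix in different blocks are
  orthogonal: in V, before and after the step, d = Y - X may be replaced by Y. The weight l - 2 of V
  matches the sampling: two columns of different blocks are drawn together l - 1 times less often
  than two of the same block, and the weight 1 + (l - 2) undoes this. It also multiplies the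
  second-order errors in V; there it is absorbed by (\<gamma> L)^2 l \<le> 1, which both step-size
  rules ensure, and by W \<le> (2 / (2 l - 1))^2, which the range of \<lambda> gives for every point
  whose objective does not exceed that of X. The 9 in the error is 7 + 2: 7 \<gamma>^2 covers the
  squared step and the errors above, 2 \<gamma>^2 comes from the square of the skew part of X^T g in
  V; averaging contributes 2 / l and the envelope l / (4 \<lambda>).\<close>

lemma inner_columns:
  fixes X Y :: "real^'p^'n"
  shows "inner X Y = (\<Sum>a\<in>UNIV. inner (column a X) (column a Y))"
  unfolding inner_vec_def column_def by (simp, rule sum.swap)

lemma norm_columns:
  fixes X :: "real^'p^'n"
  shows "(norm X)\<^sup>2 = (\<Sum>a\<in>UNIV. (norm (column a X))\<^sup>2)"
  by (simp add: power2_norm_eq_inner inner_columns)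

lemma columns_eq_iff:
  fixes X Y :: "real^'p^'n"
  shows "X = Y \<longleftrightarrow> (\<forall>a. column a X = column a Y)"
  by (auto simp: vec_eq_iff column_def)

lemma linear_column: "linear (column a :: real^'p::finite^'n::finite \<Rightarrow> real^'n)"
  by (auto simp: linear_iff column_def vec_eq_iff)

lemmas column_linear_simps [simp] =
  linear_add[OF linear_column] linear_diff[OF linear_column] linear_cmul[OF linear_column]
  linear_0[OF linear_column] linear_neg[OF linear_column] linear_sum[OF linear_column]

lemma continuous_on_column [continuous_intros]:
  fixes h :: "'a::topological_space \<Rightarrow> real^'p^'n"
  assumes "continuous_on S h"
  shows "continuous_on S (\<lambda>x. column a (h x))"
proof (rule continuous_on_compose2[OF _ assms subset_UNIV])
  show "continuous_on UNIV (column a :: real^'p^'n \<Rightarrow> real^'n)"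
    using linear_column by (intro linear_continuous_on linear_conv_bounded_linear[THEN iffD1])
qed

lemma transpose_mult_nth:
  fixes X Y :: "real^'p^'n"
  shows "(transpose X ** Y) $ a $ b = inner (column a X) (column b Y)"
  by (simp add: matrix_matrix_mult_def transpose_def column_def inner_vec_def)

lemma column_colsel [simp]:
  fixes X :: "real^'p^'n"
  shows "column b (X ** colsel C) = (if b \<in> C then column b X else 0)"
  by (simp add: vec_eq_iff column_def submatrix_nth)

definition of_columns :: "('p::finite \<Rightarrow> real^'n::finite) \<Rightarrow> real^'p^'n" where
  "of_columns w = (\<chi> i b. w b $ i)"

lemma column_of_columns [simp]: "column a (of_columns w) = w a"
  by (simp add: of_columns_def column_def vec_eq_iff)

lemma stiefel_columns:
  fixes X :: "real^'p^'n"
  shows "X \<in> stiefel \<longleftrightarrow> (\<forall>a b. inner (column a X) (column b X) = (if a = b then 1 else 0))"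
  by (simp add: stiefel_def vec_eq_iff transpose_mult_nth mat_def)

lemma block_space_columns:
  fixes Y :: "real^'p^'n"
  shows "Y \<in> block_space C \<longleftrightarrow> (\<forall>a. a \<notin> C \<longrightarrow> column a Y = 0)"
  by (auto simp: block_space_def vec_eq_iff column_def)

lemma matrix_eq_nth: "M = N \<longleftrightarrow> (\<forall>a b. M $ a $ b = N $ a $ b)"
  by (simp add: vec_eq_iff)

lemma block_manifold_columns:
  fixes Y :: "real^'p^'n"
  shows "Y \<in> block_manifold X C \<longleftrightarrow>
    (\<forall>a. a \<notin> C \<longrightarrow> column a Y = 0) \<and>
    (\<forall>a\<in>C. \<forall>b\<in>C. inner (column a Y) (column b Y) = (if a = b then 1 else 0)) \<and>
    (\<forall>a b. a \<notin> C \<longrightarrow> inner (column a X) (column b Y) = 0)"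
proof -
  have colsel_nth: "colsel C $ a $ b = (if a = b \<and> b \<in> C then 1 else 0)" for a b
    by (simp add: colsel_def)
  show ?thesis
    unfolding block_manifold_def block_stiefel_def mem_Collect_eq block_space_columns matrix_eq_nth
      transpose_mult_nth colsel_nth column_colsel
    by (auto split: if_splits) (metis inner_zero_left inner_zero_right)
qed

lemma block_tangent_columns:
  fixes \<xi> :: "real^'p^'n"
  shows "\<xi> \<in> block_tangent X C \<longleftrightarrow>
    (\<forall>a. a \<notin> C \<longrightarrow> column a \<xi> = 0) \<and>
    (\<forall>a\<in>C. \<forall>b\<in>C. inner (column a \<xi>) (column b X) + inner (column a X) (column b \<xi>) = 0) \<and>
    (\<forall>a b. a \<notin> C \<longrightarrow> inner (column a X) (column b \<xi>) = 0)"
  unfolding block_tangent_def mem_Collect_eq block_space_columns matrix_eq_nth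
    plus_vec_def vec_lambda_beta transpose_mult_nth column_colsel
  by (auto split: if_splits)

section \<open>Expansions along an orthonormal family\<close>

lemma inner_sum_orthonormal:
  fixes x :: "'a::finite \<Rightarrow> 'v::real_inner"
  assumes "\<And>a b. inner (x a) (x b) = (if a = b then 1 else 0)"
  shows "inner (\<Sum>b\<in>UNIV. c b *\<^sub>R x b) (x a) = c a"
proof -
  have "inner (\<Sum>b\<in>UNIV. c b *\<^sub>R x b) (x a) = (\<Sum>b\<in>UNIV. if b = a then c b else 0)"
    unfolding inner_sum_left by (intro sum.cong refl) (simp add: assms)
  then show ?thesis by simp
qed

lemma norm_sum_orthonormal:
  fixes x :: "'a::finite \<Rightarrow> 'v::real_inner"
  assumes "\<And>a b. inner (x a) (x b) = (if a = b then 1 else 0)"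
  shows "(norm (\<Sum>b\<in>UNIV. c b *\<^sub>R x b))\<^sup>2 = (\<Sum>b\<in>UNIV. (c b)\<^sup>2)"
  unfolding power2_norm_eq_inner
  by (subst inner_sum_right) (simp add: inner_sum_orthonormal[OF assms] power2_eq_square)

lemma norm_residual_orthonormal:
  fixes x :: "'a::finite \<Rightarrow> 'v::real_inner"
  assumes "\<And>a b. inner (x a) (x b) = (if a = b then 1 else 0)"
  shows "(norm (v - (\<Sum>b\<in>UNIV. inner (x b) v *\<^sub>R x b)))\<^sup>2 = (norm v)\<^sup>2 - (\<Sum>b\<in>UNIV. (inner (x b) v)\<^sup>2)"
proof -
  let ?P = "\<Sum>b\<in>UNIV. inner (x b) v *\<^sub>R x b"
  have "inner v ?P = (\<Sum>b\<in>UNIV. (inner (x b) v)\<^sup>2)"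
    by (simp add: inner_sum_right power2_eq_square inner_commute)
  moreover have "(norm ?P)\<^sup>2 = (\<Sum>b\<in>UNIV. (inner (x b) v)\<^sup>2)"
    by (rule norm_sum_orthonormal[OF assms])
  ultimately show ?thesis
    by (simp add: power2_norm_eq_inner inner_diff inner_commute)
qed

lemma bessel:
  fixes x :: "'a::finite \<Rightarrow> 'v::real_inner"
  assumes "\<And>a b. inner (x a) (x b) = (if a = b then 1 else 0)"
  shows "(\<Sum>b\<in>UNIV. (inner (x b) v)\<^sup>2) \<le> (norm v)\<^sup>2"
  using norm_residual_orthonormal[OF assms, of v] zero_le_power2[of "norm (v - (\<Sum>b\<in>UNIV. inner (x b) v *\<^sub>R x b))"]
  by linarith

lemma norm_sum_scaleR_le:
  fixes R :: "'a \<Rightarrow> 'v::real_normed_vector"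
  assumes "finite S"
  shows "(norm (\<Sum>b\<in>S. c b *\<^sub>R R b))\<^sup>2 \<le> (\<Sum>b\<in>S. (c b)\<^sup>2) * (\<Sum>b\<in>S. (norm (R b))\<^sup>2)"
proof -
  have "norm (\<Sum>b\<in>S. c b *\<^sub>R R b) \<le> (\<Sum>b\<in>S. \<bar>c b\<bar> * norm (R b))"
    by (rule order_trans[OF norm_sum]) simp
  then have "(norm (\<Sum>b\<in>S. c b *\<^sub>R R b))\<^sup>2 \<le> (\<Sum>b\<in>S. \<bar>c b\<bar> * norm (R b))\<^sup>2"
    by (intro power_mono) auto
  also have "\<dots> \<le> (\<Sum>b\<in>S. \<bar>c b\<bar>\<^sup>2) * (\<Sum>b\<in>S. (norm (R b))\<^sup>2)"
    by (rule Cauchy_Schwarz_ineq_sum)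
  finally show ?thesis by simp
qed

text \<open>The Cayley transform \<open>w = (I - A/2)\<^sup>-\<^sup>1 (I + A/2) x\<close> of the skew map A with \<open>A x\<^sub>a = - B\<^sub>a\<close>.\<close>

lemma cayley_retraction:
  fixes x B :: "'a::finite \<Rightarrow> 'v::euclidean_space"
  assumes ortho: "\<And>a b. inner (x a) (x b) = (if a = b then 1 else 0)"
    and B0: "\<And>a. a \<notin> C \<Longrightarrow> B a = 0"
    and skew: "\<And>a b. inner (x a) (B b) + inner (B a) (x b) = 0"
  shows "\<exists>w. (\<forall>a b. inner (w a) (w b) = (if a = b then 1 else 0)) \<and> (\<forall>a. a \<notin> C \<longrightarrow> w a = x a) \<and>
    (\<Sum>a\<in>UNIV. (norm (w a - x a + B a))\<^sup>2) \<le> 1/2 * (\<Sum>a\<in>UNIV. (norm (B a))\<^sup>2)\<^sup>2"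
proof -
  define R where "R b = B b - (\<Sum>a\<in>UNIV. inner (x a) (B b) *\<^sub>R x a)" for b
  \<comment> \<open>R replaces B in the second sum: with B in both, the part of B in the span of x
    would be counted twice. On that part the first sum is already skew, and the R parts of the two
    sums are transposes of each other.\<close>
  define A where "A v = (\<Sum>b\<in>UNIV. inner v (B b) *\<^sub>R x b) - (\<Sum>b\<in>UNIV. inner v (x b) *\<^sub>R R b)" for v
  define \<beta> where "\<beta> = (\<Sum>a\<in>UNIV. (norm (B a))\<^sup>2)"
  have skew': "inner (x a) (B b) = - inner (x b) (B a)" for a b
    using skew[of a b] by (simp add: inner_commute)
  have linA: "linear A"
    unfolding A_def
    by (rule linearI) (simp_all add: inner_add_left scaleR_add_left sum.distrib scaleR_sum_right algebra_simps)
  have Auv: "inner (A u) v = (\<Sum>b\<in>UNIV. inner u (B b) * inner (x b) v) - (\<Sum>b\<in>UNIV. inner u (x b) * inner (B b) v)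
     + (\<Sum>b\<in>UNIV. \<Sum>a\<in>UNIV. inner (x a) (B b) * (inner u (x b) * inner (x a) v))" for u v
    by (simp add: A_def R_def inner_diff_left inner_sum_left right_diff_distrib sum_subtractf sum_distrib_left mult_ac)
  have skA: "inner (A u) v = - inner u (A v)" for u v
  proof -
    \<comment> \<open>The coefficients \<open>inner (x a) (B b)\<close> change sign when a and b are
      swapped, hence so does the double sum when u and v are swapped.\<close>
    have "(\<Sum>b\<in>UNIV. \<Sum>a\<in>UNIV. inner (x a) (B b) * (inner u (x b) * inner (x a) v))
       = - (\<Sum>b\<in>UNIV. \<Sum>a\<in>UNIV. inner (x a) (B b) * (inner v (x b) * inner (x a) u))"
      apply (subst sum.swap)
      apply (simp only: sum_negf[symmetric])
      apply (intro sum.cong refl)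
      apply (subst skew')
      apply (simp add: inner_commute)
      done
    then show ?thesis
      unfolding inner_commute[of u "A v"] Auv by (simp add: inner_commute mult.commute mult.left_commute)
  qed
  have Av0: "inner (A v) v = 0" for v
    using skA[of v v] by (simp add: inner_commute)
  have Ax: "A (x a) = - B a" for a
  proof -
    have 1: "(\<Sum>b\<in>UNIV. inner (x a) (x b) *\<^sub>R R b) = (\<Sum>b\<in>UNIV. if b = a then R b else 0)"
      by (intro sum.cong refl) (auto simp: ortho)
    have 2: "(\<Sum>b\<in>UNIV. inner (x a) (B b) *\<^sub>R x b) = - (\<Sum>b\<in>UNIV. inner (x b) (B a) *\<^sub>R x b)"
      unfolding sum_negf[symmetric] by (intro sum.cong refl) (simp add: skew'[of a])
    show ?thesis
      unfolding A_def 1 2 by (simp add: R_def)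
  qed
  have Rx: "inner (R b) (x a) = 0" for a b
    unfolding R_def inner_diff_left inner_sum_orthonormal[OF ortho] by (simp add: inner_commute)
  have normR: "(norm (R b))\<^sup>2 \<le> (norm (B b))\<^sup>2" for b
    unfolding R_def using norm_residual_orthonormal[OF ortho, of "B b"] by (simp add: sum_nonneg)
  have normA: "(norm (A v))\<^sup>2 \<le> 2 * \<beta> * (norm v)\<^sup>2" for v
  proof -
    let ?P = "\<Sum>b\<in>UNIV. inner v (B b) *\<^sub>R x b" and ?Q = "\<Sum>b\<in>UNIV. inner v (x b) *\<^sub>R R b"
    \<comment> \<open>The first sum lies in the span of x and the second is orthogonal to it. So the
      squares add, and the factor is 2 instead of the 4 of the triangle inequality; the final
      constant is 1 / sqrt 2 instead of 1.\<close>
    have "inner ?P ?Q = 0"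
      by (simp add: inner_sum_left inner_sum_right Rx inner_commute[of "x _" "R _"])
    then have "(norm (A v))\<^sup>2 = (norm ?P)\<^sup>2 + (norm ?Q)\<^sup>2"
      by (simp add: A_def power2_norm_eq_inner inner_diff inner_commute)
    moreover have "(norm ?P)\<^sup>2 \<le> \<beta> * (norm v)\<^sup>2"
    proof -
      have "(norm ?P)\<^sup>2 = (\<Sum>b\<in>UNIV. (inner v (B b))\<^sup>2)" by (rule norm_sum_orthonormal[OF ortho])
      also have "\<dots> \<le> (\<Sum>b\<in>UNIV. (norm (B b))\<^sup>2 * (norm v)\<^sup>2)"
        by (intro sum_mono) (metis Cauchy_Schwarz_ineq inner_commute power2_norm_eq_inner)
      finally show ?thesis by (simp add: \<beta>_def sum_distrib_right)
    qed
    moreover have "(norm ?Q)\<^sup>2 \<le> \<beta> * (norm v)\<^sup>2"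
    proof -
      have "(norm ?Q)\<^sup>2 \<le> (\<Sum>b\<in>UNIV. (inner v (x b))\<^sup>2) * (\<Sum>b\<in>UNIV. (norm (R b))\<^sup>2)"
        by (rule norm_sum_scaleR_le) simp
      also have "\<dots> \<le> (norm v)\<^sup>2 * \<beta>"
        unfolding \<beta>_def using bessel[OF ortho, of v]
        by (intro mult_mono sum_mono normR) (auto simp: inner_commute sum_nonneg)
      finally show ?thesis by (simp add: mult.commute)
    qed
    ultimately show ?thesis by simp
  qed
  define H where "H v = v - (1/2) *\<^sub>R A v" for v
  have linH: "linear H"
    unfolding H_def by (rule linearI) (simp_all add: linear_add[OF linA] linear_cmul[OF linA] algebra_simps)
  \<comment> \<open>A v is orthogonal to v, so H can only lengthen vectors. This gives both the
    invertibility of H and the bound of w - x by B.\<close>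
  have normH: "(norm v)\<^sup>2 \<le> (norm (H v))\<^sup>2" for v
  proof -
    have "(norm (H v))\<^sup>2 = (norm v)\<^sup>2 + (norm ((1/2) *\<^sub>R A v))\<^sup>2"
      using Av0[of v] unfolding power2_norm_eq_inner by (simp add: H_def inner_diff inner_commute)
    then show ?thesis by simp
  qed
  have "inj H"
    unfolding linear_injective_0[OF linH] using normH by (metis norm_eq_zero norm_zero power2_less_eq_zero_iff zero_power2)
  then have surjH: "surj H" by (rule linear_inj_imp_surj[OF linH])
  define w where "w a = inv H (x a + (1/2) *\<^sub>R A (x a))" for a
  have Hw: "H (w a) = x a + (1/2) *\<^sub>R A (x a)" for a
    unfolding w_def by (rule surj_f_inv_f[OF surjH])
  have wx: "w a - x a = (1/2) *\<^sub>R A (w a + x a)" for a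
    using Hw[of a] by (simp add: H_def linear_add[OF linA] algebra_simps)
  show ?thesis
  proof (intro exI[of _ w] conjI allI impI)
    fix a b
    \<comment> \<open>By \<open>wx\<close> each difference is half of A applied to the corresponding
      sum, and the skewness of A makes the two terms cancel.\<close>
    have "2 *\<^sub>R (inner (w a) (w b) - inner (x a) (x b)) =
       inner (w a - x a) (w b + x b) + inner (w a + x a) (w b - x b)"
      by (simp add: inner_diff inner_add)
    also have "\<dots> = 0"
      unfolding wx using skA[of "w a + x a" "w b + x b"] by simp
    finally show "inner (w a) (w b) = (if a = b then 1 else 0)"
      by (simp add: ortho)
  next
    fix a assume "a \<notin> C"
    then have "A (x a) = 0" using Ax B0 by simp
    then have "H (w a) = H (x a)" unfolding Hw by (simp add: H_def)
    with \<open>inj H\<close> show "w a = x a" by (simp add: inj_eq)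
  next
    \<comment> \<open>H maps w a - x a to - B a. Hence the deviation from the tangent step is half
      of A applied to w a - x a, a vector no longer than B a, and the constant is 1/4 times 2
      \<beta>.\<close>
    have "(norm (w a - x a + B a))\<^sup>2 \<le> 1/2 * \<beta> * (norm (B a))\<^sup>2" for a
    proof -
      have "H (w a - x a) = - ((1/2) *\<^sub>R B a + (1/2) *\<^sub>R B a)"
        unfolding linear_diff[OF linH] Hw by (simp add: H_def Ax)
      then have HD: "H (w a - x a) = - B a"
        by (simp only: scaleR_half_double scaleR_add_right[symmetric])
      then have 1: "w a - x a + B a = (1/2) *\<^sub>R A (w a - x a)"
        by (simp add: H_def algebra_simps)
      have 2: "(norm (w a - x a))\<^sup>2 \<le> (norm (B a))\<^sup>2"
        using normH[of "w a - x a"] HD by simp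
      have "(norm (w a - x a + B a))\<^sup>2 = 1/4 * (norm (A (w a - x a)))\<^sup>2"
        unfolding 1 by (simp add: power_divide)
      also have "\<dots> \<le> 1/4 * (2 * \<beta> * (norm (w a - x a))\<^sup>2)"
        by (intro mult_left_mono normA) simp
      also have "\<dots> \<le> 1/4 * (2 * \<beta> * (norm (B a))\<^sup>2)"
        using 2 by (intro mult_left_mono) (auto simp: \<beta>_def sum_nonneg)
      finally show ?thesis by simp
    qed
    then have "(\<Sum>a\<in>UNIV. (norm (w a - x a + B a))\<^sup>2) \<le> (\<Sum>a\<in>UNIV. 1/2 * \<beta> * (norm (B a))\<^sup>2)"
      by (intro sum_mono)
    also have "\<dots> = 1/2 * \<beta>\<^sup>2"
      by (subst sum_distrib_left[symmetric]) (simp add: \<beta>_def power2_eq_square)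
    finally show "(\<Sum>a\<in>UNIV. (norm (w a - x a + B a))\<^sup>2) \<le> 1/2 * (\<Sum>a\<in>UNIV. (norm (B a))\<^sup>2)\<^sup>2"
      unfolding \<beta>_def .
  qed
qed

section \<open>The averaging operator of a column partition\<close>

locale column_blocks =
  fixes \<CC> :: "nat \<Rightarrow> 'p::finite set" and l :: nat
  assumes partition: "column_partition \<CC> l"
begin

definition blk :: "'p \<Rightarrow> nat" where
  "blk a = (THE i. i \<in> {1..l} \<and> a \<in> \<CC> i)"

lemma l_ge_2: "2 \<le> l"
  using partition by (simp add: column_partition_def)

lemma ex1_block: "\<exists>!i. i \<in> {1..l} \<and> a \<in> \<CC> i"
proof -
  have inj: "inj_on \<CC> {1..l}" and part: "partition_on UNIV (\<CC> ` {1..l})"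
    using partition by (auto simp: column_partition_def)
  have "a \<in> \<Union> (\<CC> ` {1..l})" using part by (simp add: partition_on_def)
  then obtain i where i: "i \<in> {1..l}" "a \<in> \<CC> i" by auto
  moreover have "j = i" if j: "j \<in> {1..l}" "a \<in> \<CC> j" for j
  proof (rule ccontr)
    assume "j \<noteq> i"
    then have "\<CC> j \<noteq> \<CC> i" using inj i j by (auto dest: inj_onD)
    then have "\<CC> j \<inter> \<CC> i = {}"
      using part i j unfolding partition_on_def disjoint_def by blast
    then show False using i j by blast
  qed
  ultimately show ?thesis by blast
qed

lemma blk_in: "blk a \<in> {1..l}" and mem_blk: "a \<in> \<CC> (blk a)"
  using theI'[OF ex1_block[of a]] by (auto simp: blk_def)

lemma mem_block_iff: "i \<in> {1..l} \<Longrightarrow> a \<in> \<CC> i \<longleftrightarrow> i = blk a"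
  using ex1_block[of a] blk_in[of a] mem_blk[of a] by blast

section \<open>Counting the pairs that contain given blocks\<close>

definition pairs :: "nat set set" where
  "pairs = nsets {1..l} 2"

lemma finite_pairs [simp]: "finite pairs"
  by (simp add: pairs_def finite_imp_finite_nsets)

lemma card_pairs: "card pairs = l choose 2"
  by (simp add: pairs_def card_nsets)

lemma real_choose_2: "real (l choose 2) = real l * (real l - 1) / 2"
proof -
  have "even (l * (l - 1))" by (cases "even l") auto
  then have "real (l * (l - 1) div 2) = real (l * (l - 1)) / 2"
    using real_of_nat_div by fastforce
  then show ?thesis
    using l_ge_2 by (simp add: choose_two of_nat_diff)
qed

lemma real_choose_2_pos: "real (l choose 2) > 0"
  using l_ge_2 by (simp add: zero_less_binomial)

lemma mem_pair_cols: "e \<in> pairs \<Longrightarrow> a \<in> pair_cols \<CC> e \<longleftrightarrow> blk a \<in> e"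
  using mem_block_iff by (fastforce simp: pair_cols_def pairs_def nsets_def intro: mem_blk)

lemma card_pairs_containing:
  assumes "i \<in> {1..l}"
  shows "card {e \<in> pairs. i \<in> e} = l - 1"
proof -
  have "{e \<in> pairs. i \<in> e} = (\<lambda>j. {i, j}) ` ({1..l} - {i})"
    using assms by (auto simp: pairs_def nsets_2_eq image_iff)
  moreover have "inj_on (\<lambda>j. {i, j}) ({1..l} - {i})"
    by (auto simp: inj_on_def doubleton_eq_iff)
  ultimately show ?thesis
    using assms by (simp add: card_image)
qed

lemma sum_pairs_mem: "(\<Sum>e\<in>pairs. of_bool (blk a \<in> e)) = real l - 1"
proof -
  have "(\<Sum>e\<in>pairs. of_bool (blk a \<in> e)) = real (card {e \<in> pairs. blk a \<in> e})"
    by (simp add: Collect_conj_eq Int_commute)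
  then show ?thesis
    using card_pairs_containing[OF blk_in] l_ge_2 by (simp add: of_nat_diff)
qed

lemma sum_pairs_mem_both:
  assumes "blk a \<noteq> blk b"
  shows "(\<Sum>e\<in>pairs. of_bool (blk a \<in> e \<and> blk b \<in> e)) = (1::real)"
proof -
  have "{e \<in> pairs. blk a \<in> e \<and> blk b \<in> e} = {{blk a, blk b}}"
    using assms blk_in[of a] blk_in[of b] unfolding pairs_def nsets_2_eq by fastforce
  then have "card (pairs \<inter> {e. blk a \<in> e \<and> blk b \<in> e}) = 1"
    by (simp add: Collect_conj_eq[symmetric] Int_def)
  then show ?thesis
    by simp
qed

lemma avg_mem: "(\<Sum>e\<in>pairs. of_bool (blk a \<in> e)) / real (l choose 2) = 2 / real l"
  using l_ge_2 by (simp add: sum_pairs_mem real_choose_2 divide_simps)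

text \<open>Columns of different blocks are selected together only by the one pair formed by their
  blocks, columns of the same block by l - 1 pairs. The ratio l - 1 = 1 + (l - 2) is the origin of
  the weight of \<open>cross\<close> in \<open>avg_form\<close>.\<close>

lemma avg_mem_both:
  "(\<Sum>e\<in>pairs. of_bool (blk a \<in> e \<and> blk b \<in> e)) / real (l choose 2)
     = (if blk a = blk b then 2 / real l else 2 / (real l * (real l - 1)))"
proof (cases "blk a = blk b")
  case True
  then show ?thesis using avg_mem[of a] by simp
next
  case False
  then show ?thesis by (simp add: sum_pairs_mem_both[OF False] real_choose_2 del: sum_of_bool_eq)
qed

lemma avg_sum_cols:
  fixes \<phi> :: "'p \<Rightarrow> real"
  shows "(\<Sum>e\<in>pairs. \<Sum>a\<in>UNIV. of_bool (blk a \<in> e) * \<phi> a) / real (l choose 2)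
    = 2 / real l * (\<Sum>a\<in>UNIV. \<phi> a)"
proof -
  have "(\<Sum>e\<in>pairs. \<Sum>a\<in>UNIV. of_bool (blk a \<in> e) * \<phi> a) / real (l choose 2)
     = (\<Sum>a\<in>UNIV. (\<Sum>e\<in>pairs. of_bool (blk a \<in> e)) / real (l choose 2) * \<phi> a)"
    by (subst sum.swap) (simp add: sum_divide_distrib sum_distrib_right)
  then show ?thesis
    unfolding avg_mem by (simp add: sum_distrib_left)
qed

lemma avg_sum_cols_both:
  fixes \<phi> :: "'p \<Rightarrow> 'p \<Rightarrow> real"
  shows "(\<Sum>e\<in>pairs. \<Sum>a\<in>UNIV. \<Sum>b\<in>UNIV. of_bool (blk a \<in> e \<and> blk b \<in> e) * \<phi> a b) / real (l choose 2)
    = (\<Sum>a\<in>UNIV. \<Sum>b\<in>UNIV. (if blk a = blk b then 2 / real l else 2 / (real l * (real l - 1))) * \<phi> a b)"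
proof -
  have "(\<Sum>e\<in>pairs. \<Sum>a\<in>UNIV. \<Sum>b\<in>UNIV. of_bool (blk a \<in> e \<and> blk b \<in> e) * \<phi> a b) / real (l choose 2)
     = (\<Sum>a\<in>UNIV. \<Sum>b\<in>UNIV. (\<Sum>e\<in>pairs. of_bool (blk a \<in> e \<and> blk b \<in> e)) / real (l choose 2) * \<phi> a b)"
    unfolding sum_divide_distrib sum_distrib_right
    by (subst sum.swap, intro sum.cong refl, subst sum.swap) simp
  then show ?thesis
    unfolding avg_mem_both .
qed

section \<open>The averaging operator on columns and its inverse\<close>

definition other_proj :: "real^'p^'n \<Rightarrow> 'p \<Rightarrow> real^'n \<Rightarrow> real^'n" where
  "other_proj X b v = (\<Sum>a\<in>UNIV. (of_bool (blk a \<noteq> blk b) * inner (column a X) v) *\<^sub>R column a X)"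

lemma linear_other_proj: "linear (other_proj X b)"
  unfolding other_proj_def
  by (rule linearI) (simp_all add: inner_add_right scaleR_add_left sum.distrib scaleR_sum_right algebra_simps)

lemma inner_column_other_proj:
  assumes "X \<in> stiefel"
  shows "inner (column a X) (other_proj X b v) = of_bool (blk a \<noteq> blk b) * inner (column a X) v"
proof -
  have "inner (column a X) (other_proj X b v)
     = (\<Sum>c\<in>UNIV. if c = a then of_bool (blk a \<noteq> blk b) * inner (column a X) v else 0)"
    unfolding other_proj_def inner_sum_right
    using assms[unfolded stiefel_columns] by (intro sum.cong refl) auto
  then show ?thesis by simp
qed

lemma other_proj_idem:
  assumes "X \<in> stiefel"
  shows "other_proj X b (other_proj X b v) = other_proj X b v"
  unfolding other_proj_def[of X b "other_proj X b v"] inner_column_other_proj[OF assms]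
  unfolding other_proj_def by (intro sum.cong refl) (simp add: of_bool_def)

text \<open>Column b is touched by the l - 1 pairs containing its block. A column of X in another
  block lies outside the selected columns for all of these except the pair formed by the two blocks,
  so it is projected out l - 2 times; columns of the own block are never projected out.\<close>

lemma column_avg_op:
  fixes X \<xi> :: "real^'p^'n"
  shows "column b (avg_op \<CC> l X \<xi>) = (1 / real (l choose 2)) *\<^sub>R
     ((real l - 1) *\<^sub>R column b \<xi> - (real l - 2) *\<^sub>R other_proj X b (column b \<xi>))"
proof -
  have mult: "column j (A ** B) = A *v column j B" for j and A :: "real^'k^'m" and B :: "real^'q^'k"
    by (simp add: vec_eq_iff column_def matrix_matrix_mult_def matrix_vector_mult_def)
  have tr: "transpose (colsel C) = colsel C" for C :: "'p set"
    by (auto simp: vec_eq_iff transpose_def colsel_def)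
  have MMt: "(M ** transpose M) *v v = (\<Sum>a\<in>UNIV. inner (column a M) v *\<^sub>R column a M)"
    for M :: "real^'p^'n" and v
  proof -
    have "(M ** transpose M) *v v = M *v (transpose M *v v)"
      by (simp only: matrix_vector_mul_assoc)
    also have "\<dots> = (\<Sum>a\<in>UNIV. (transpose M *v v) $ a *s column a M)"
      by (rule matrix_mult_sum)
    also have "\<dots> = (\<Sum>a\<in>UNIV. inner (column a M) v *\<^sub>R column a M)"
      by (intro sum.cong refl)
        (simp add: vec_eq_iff matrix_vector_mult_def transpose_def column_def inner_vec_def vector_scalar_mult_def)
    finally show ?thesis .
  qed
  let ?v = "column b \<xi>"
  \<comment> \<open>The indicator of b being selected and a not is written as a difference of
    membership indicators, so that the sum over e needs only the two counts already known.\<close>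
  define t where "t e = of_bool (blk b \<in> e) *\<^sub>R ?v
      - (\<Sum>a\<in>UNIV. ((of_bool (blk b \<in> e) - of_bool (blk a \<in> e \<and> blk b \<in> e)) * inner (column a X) ?v) *\<^sub>R column a X)"
    for e
  have term_e: "column b ((mat 1 - (X ** colsel (- C)) ** transpose (X ** colsel (- C)))
               ** (\<xi> ** colsel C) ** transpose (colsel C)) = t e"
    if e: "e \<in> pairs" and C: "C = pair_cols \<CC> e" for e C
  proof -
    have *: "column b ((mat 1 - (X ** colsel (- C)) ** transpose (X ** colsel (- C)))
               ** (\<xi> ** colsel C) ** transpose (colsel C))
       = (if b \<in> C then ?v - (\<Sum>a\<in>UNIV. inner (if a \<notin> C then column a X else 0) ?v *\<^sub>R (if a \<notin> C then column a X else 0)) else 0)"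
      unfolding tr column_colsel mult[of b _ "\<xi> ** colsel C"]
      by (simp add: matrix_vector_mult_diff_rdistrib MMt)
    show ?thesis
      unfolding * t_def using mem_pair_cols[OF e, folded C]
      by (auto intro!: sum.cong)
  qed
  have "column b (avg_op \<CC> l X \<xi>) = (1 / real (l choose 2)) *\<^sub>R (\<Sum>e\<in>pairs. t e)"
    unfolding avg_op_def Let_def pairs_def[symmetric] by (simp add: term_e del: column_colsel)
  also have "(\<Sum>e\<in>pairs. t e) = (\<Sum>e\<in>pairs. of_bool (blk b \<in> e)) *\<^sub>R ?v
      - (\<Sum>a\<in>UNIV. (((\<Sum>e\<in>pairs. of_bool (blk b \<in> e)) - (\<Sum>e\<in>pairs. of_bool (blk a \<in> e \<and> blk b \<in> e)))
            * inner (column a X) ?v) *\<^sub>R column a X)"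
  proof -
    have "(\<Sum>e\<in>pairs. ((of_bool (blk b \<in> e) - of_bool (blk a \<in> e \<and> blk b \<in> e)) * inner (column a X) ?v) *\<^sub>R column a X)
      = (((\<Sum>e\<in>pairs. of_bool (blk b \<in> e)) - (\<Sum>e\<in>pairs. of_bool (blk a \<in> e \<and> blk b \<in> e)))
            * inner (column a X) ?v) *\<^sub>R column a X" for a
      by (simp only: sum_distrib_right scaleR_sum_left sum_subtractf[symmetric])
    then show ?thesis
      unfolding t_def sum_subtractf sum.swap[of _ UNIV pairs] by (simp only: scaleR_sum_left)
  qed
  also have "(\<Sum>a\<in>UNIV. (((\<Sum>e\<in>pairs. of_bool (blk b \<in> e)) - (\<Sum>e\<in>pairs. of_bool (blk a \<in> e \<and> blk b \<in> e)))
            * inner (column a X) ?v) *\<^sub>R column a X) = (real l - 2) *\<^sub>R other_proj X b ?v"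
    unfolding other_proj_def scaleR_sum_right
  proof (intro sum.cong refl)
    fix a
    show "(((\<Sum>e\<in>pairs. of_bool (blk b \<in> e)) - (\<Sum>e\<in>pairs. of_bool (blk a \<in> e \<and> blk b \<in> e)))
            * inner (column a X) ?v) *\<^sub>R column a X
       = (real l - 2) *\<^sub>R (of_bool (blk a \<noteq> blk b) * inner (column a X) ?v) *\<^sub>R column a X"
      by (cases "blk a = blk b") (simp_all add: sum_pairs_mem_both sum_pairs_mem del: sum_of_bool_eq)
  qed
  finally show ?thesis by (simp add: sum_pairs_mem)
qed

text \<open>This is V when \<xi> = Y - X: columns of X in different blocks are orthogonal, so
  subtracting X does not change the inner products that are summed.\<close>

definition cross :: "real^'p^'n \<Rightarrow> real^'p^'n \<Rightarrow> real" where
  "cross X \<xi> = (\<Sum>a\<in>UNIV. \<Sum>b\<in>UNIV. of_bool (blk a \<noteq> blk b) * (inner (column a X) (column b \<xi>))\<^sup>2)"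

lemma cross_nonneg: "0 \<le> cross X \<xi>"
  unfolding cross_def by (intro sum_nonneg) simp

definition avg_inv :: "real^'p^'n \<Rightarrow> real^'p^'n \<Rightarrow> real^'p^'n" where
  "avg_inv X \<xi> = of_columns (\<lambda>b. (real l / 2) *\<^sub>R (column b \<xi> + (real l - 2) *\<^sub>R other_proj X b (column b \<xi>)))"

lemma column_avg_inv:
  "column b (avg_inv X \<xi>) = (real l / 2) *\<^sub>R (column b \<xi> + (real l - 2) *\<^sub>R other_proj X b (column b \<xi>))"
  by (simp add: avg_inv_def)

text \<open>Column by column, the operator is multiplication by 2 / l on the kernel of Q and by 2 /
  (l (l - 1)) on its range; the reciprocals are the eigenvalues of l / 2 (I + (l - 2) Q).
  Orthonormality of X enters as idempotence of Q.\<close>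

lemma inv_avg_op:
  assumes X: "X \<in> stiefel"
  shows "inv (avg_op \<CC> l X) = avg_inv X"
proof (rule inv_equality)
  have l: "real l - 1 \<noteq> 0" "real l \<noteq> 0" using l_ge_2 by auto
  show "avg_op \<CC> l X (avg_inv X \<xi>) = \<xi>" for \<xi>
    unfolding columns_eq_iff
  proof
    fix b
    define v where "v = column b \<xi>"
    define q where "q = other_proj X b v"
    have qq: "other_proj X b q = q" by (simp add: q_def other_proj_idem[OF X])
    have "other_proj X b (column b (avg_inv X \<xi>)) = (real l / 2) *\<^sub>R (q + (real l - 2) *\<^sub>R q)"
      unfolding column_avg_inv
      by (simp only: v_def[symmetric] linear_add[OF linear_other_proj] linear_cmul[OF linear_other_proj]
          q_def[symmetric] qq)
    then have "column b (avg_op \<CC> l X (avg_inv X \<xi>)) = (1 / real (l choose 2)) *\<^sub>R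
      ((real l - 1) *\<^sub>R (real l / 2) *\<^sub>R (v + (real l - 2) *\<^sub>R q)
        - (real l - 2) *\<^sub>R (real l / 2) *\<^sub>R (q + (real l - 2) *\<^sub>R q))"
      unfolding column_avg_op by (simp only: column_avg_inv v_def[symmetric] q_def[symmetric])
    also have "\<dots> = (1 / real (l choose 2)) *\<^sub>R (real l / 2) *\<^sub>R
      ((real l - 1) *\<^sub>R (v + (real l - 2) *\<^sub>R q) - (real l - 2) *\<^sub>R (q + (real l - 2) *\<^sub>R q))"
      by (simp only: scaleR_right_diff_distrib scaleR_left_commute)
    also have "(real l - 1) *\<^sub>R (v + (real l - 2) *\<^sub>R q) - (real l - 2) *\<^sub>R (q + (real l - 2) *\<^sub>R q) = (real l - 1) *\<^sub>R v"
      by (simp add: algebra_simps flip: scaleR_left_distrib)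
    finally show "column b (avg_op \<CC> l X (avg_inv X \<xi>)) = column b \<xi>"
      using l by (simp add: real_choose_2 v_def)
  qed
  show "avg_inv X (avg_op \<CC> l X \<xi>) = \<xi>" for \<xi>
    unfolding columns_eq_iff
  proof
    fix b
    define v where "v = column b \<xi>"
    define q where "q = other_proj X b v"
    have qq: "other_proj X b q = q" by (simp add: q_def other_proj_idem[OF X])
    have "other_proj X b (column b (avg_op \<CC> l X \<xi>))
      = (1 / real (l choose 2)) *\<^sub>R ((real l - 1) *\<^sub>R q - (real l - 2) *\<^sub>R q)"
      unfolding column_avg_op
      by (simp only: v_def[symmetric] linear_diff[OF linear_other_proj] linear_cmul[OF linear_other_proj]
          q_def[symmetric] qq)
    also have "(real l - 1) *\<^sub>R q - (real l - 2) *\<^sub>R q = q"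
      by (simp flip: scaleR_left_diff_distrib)
    finally have "column b (avg_inv X (avg_op \<CC> l X \<xi>)) =
      (real l / 2) *\<^sub>R ((1 / real (l choose 2)) *\<^sub>R ((real l - 1) *\<^sub>R v - (real l - 2) *\<^sub>R q)
        + (real l - 2) *\<^sub>R (1 / real (l choose 2)) *\<^sub>R q)"
      unfolding column_avg_inv by (simp only: column_avg_op v_def[symmetric] q_def[symmetric])
    also have "\<dots> = (real l / 2 * (1 / real (l choose 2)) * (real l - 1)) *\<^sub>R v"
      by (simp add: scaleR_right_diff_distrib scaleR_add_right)
    finally show "column b (avg_inv X (avg_op \<CC> l X \<xi>)) = column b \<xi>"
      using l by (simp add: real_choose_2 v_def)
  qed
qed

definition avg_form :: "real^'p^'n \<Rightarrow> real^'p^'n \<Rightarrow> real" where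
  "avg_form X \<xi> = (norm \<xi>)\<^sup>2 + (real l - 2) * cross X \<xi>"

lemma norm_le_avg_form: "(norm \<xi>)\<^sup>2 \<le> avg_form X \<xi>"
  using l_ge_2 cross_nonneg[of X \<xi>] by (simp add: avg_form_def)

lemma avg_form_nonneg: "0 \<le> avg_form X \<xi>"
  using norm_le_avg_form[of \<xi> X] zero_le_power2 order_trans by blast

lemma inner_avg_inv:
  shows "inner (avg_inv X \<xi>) \<xi> = real l / 2 * avg_form X \<xi>"
proof -
  have "inner (other_proj X b v) v = (\<Sum>a\<in>UNIV. of_bool (blk a \<noteq> blk b) * (inner (column a X) v)\<^sup>2)" for b v
    by (simp add: other_proj_def inner_sum_left power2_eq_square mult.assoc)
  then have "inner (avg_inv X \<xi>) \<xi> = real l / 2 * ((norm \<xi>)\<^sup>2 + (real l - 2) *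
      (\<Sum>b\<in>UNIV. \<Sum>a\<in>UNIV. of_bool (blk a \<noteq> blk b) * (inner (column a X) (column b \<xi>))\<^sup>2))"
    by (simp add: inner_columns column_avg_inv inner_add_left norm_columns power2_norm_eq_inner
        sum_distrib_left sum.distrib distrib_left)
  also have "(\<Sum>b\<in>UNIV. \<Sum>a\<in>UNIV. of_bool (blk a \<noteq> blk b) * (inner (column a X) (column b \<xi>))\<^sup>2) = cross X \<xi>"
    unfolding cross_def by (rule sum.swap)
  finally show ?thesis by (simp add: avg_form_def)
qed

lemma avg_inv_norm_sq:
  assumes "X \<in> stiefel"
  shows "(avg_inv_norm \<CC> l X \<xi>)\<^sup>2 = real l / 2 * avg_form X \<xi>"
  using avg_form_nonneg[of X \<xi>]
  by (simp add: avg_inv_norm_def inv_avg_op[OF assms] inner_avg_inv)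

end

section \<open>Tangent projection and block update\<close>

lemma stiefel_inner: "X \<in> stiefel \<Longrightarrow> inner (column a X) (column b X) = (if a = b then 1 else 0)"
  by (simp add: stiefel_columns)

text \<open>The manifold is in general not convex; closedness is what makes
  \<open>closest_point\<close> a point of it at least distance.\<close>

lemma closed_block_manifold: "closed (block_manifold X C :: (real^'p^'n) set)"
proof -
  have "block_manifold X C = {Y.
    (\<forall>a. a \<notin> C \<longrightarrow> column a Y = 0) \<and>
    (\<forall>a b. a \<in> C \<longrightarrow> b \<in> C \<longrightarrow> inner (column a Y) (column b Y) = (if a = b then 1 else 0)) \<and>
    (\<forall>a b. a \<notin> C \<longrightarrow> inner (column a X) (column b Y) = 0)}"
    by (auto simp: block_manifold_columns)
  also have "closed \<dots>"
    by (intro closed_Collect_conj closed_Collect_all closed_Collect_imp open_Collect_const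
        closed_Collect_eq continuous_intros)
  finally show ?thesis .
qed

lemma subspace_block_tangent: "subspace (block_tangent X C :: (real^'p^'n) set)"
  unfolding subspace_def
proof (intro conjI ballI allI)
  show "0 \<in> block_tangent X C"
    by (simp add: block_tangent_columns)
next
  fix u v :: "real^'p^'n" assume "u \<in> block_tangent X C" "v \<in> block_tangent X C"
  then show "u + v \<in> block_tangent X C"
    by (simp add: block_tangent_columns inner_add_left inner_add_right) (smt (verit))
next
  fix c and u :: "real^'p^'n" assume "u \<in> block_tangent X C"
  then show "c *\<^sub>R u \<in> block_tangent X C"
    by (simp add: block_tangent_columns flip: distrib_left)
qed

definition tangent_proj :: "real^'p^'n \<Rightarrow> 'p set \<Rightarrow> real^'p^'n \<Rightarrow> real^'p^'n" where
  "tangent_proj X C g = closest_point (block_tangent X C) (g ** colsel C)"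

lemma sum_sym_skew:
  fixes S K :: "'a::finite \<Rightarrow> 'a \<Rightarrow> real"
  assumes "\<And>a b. S a b = S b a" "\<And>a b. K a b = - K b a"
  shows "(\<Sum>a\<in>UNIV. \<Sum>b\<in>UNIV. S a b * K a b) = 0"
proof -
  have "(\<Sum>a\<in>UNIV. \<Sum>b\<in>UNIV. S a b * K a b) = (\<Sum>b\<in>UNIV. \<Sum>a\<in>UNIV. S a b * K a b)"
    by (rule sum.swap)
  also have "\<dots> = (\<Sum>b\<in>UNIV. \<Sum>a\<in>UNIV. - (S b a * K b a))"
    by (intro sum.cong refl) (metis assms mult_minus_right)
  finally show ?thesis by (simp add: sum_negf)
qed

text \<open>The coefficients \<open>c\<close> describe the normal component. For a outside
  \<open>C\<close> the tangent condition is orthogonality, so the full inner product is removed; for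
  a in \<open>C\<close> it is skew-symmetry, so the symmetric part is removed. What is removed is
  orthogonal to every tangent vector because symmetric and skew matrices are orthogonal.\<close>

lemma tangent_proj:
  fixes X g :: "real^'p^'n" and C :: "'p set"
  assumes X: "X \<in> stiefel"
  defines "c \<equiv> \<lambda>a b. if a \<in> C then (inner (column a X) (column b g) + inner (column b X) (column a g)) / 2
       else inner (column a X) (column b g)"
  shows tangent_proj_mem: "tangent_proj X C g \<in> block_tangent X C"
    and column_tangent_proj: "column b (tangent_proj X C g) =
      (if b \<in> C then column b g - (\<Sum>a\<in>UNIV. c a b *\<^sub>R column a X) else 0)"
    and norm_tangent_proj: "norm (tangent_proj X C g) \<le> norm (g ** colsel C)"
proof -
  define G :: "real^'p^'n" where "G = of_columns (\<lambda>b. (if b \<in> C then column b g - (\<Sum>a\<in>UNIV. c a b *\<^sub>R column a X) else 0))"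
  have G: "column b G = (if b \<in> C then column b g - (\<Sum>a\<in>UNIV. c a b *\<^sub>R column a X) else 0)" for b
    by (simp add: G_def)
  have xG: "inner (column a X) (column b G) = (if b \<in> C then inner (column a X) (column b g) - c a b else 0)" for a b
    by (simp add: G inner_diff_right inner_commute[of "column a X" "sum _ _"] inner_sum_orthonormal[OF stiefel_inner[OF X]])
  have GT: "G \<in> block_tangent X C"
    unfolding block_tangent_columns
  proof (intro conjI ballI allI impI)
    fix a b assume "a \<in> C" "b \<in> C"
    then show "inner (column a G) (column b X) + inner (column a X) (column b G) = 0"
      unfolding inner_commute[of "column a G"] xG by (simp add: c_def field_simps)
  next
    fix a b assume "a \<notin> C"
    then show "inner (column a X) (column b G) = 0"
      unfolding xG by (simp add: c_def)
  qed (simp add: G)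
  have orth: "inner (g ** colsel C - G) \<xi> = 0" if \<xi>: "\<xi> \<in> block_tangent X C" for \<xi>
  proof -
    have 1: "inner (\<Sum>a\<in>UNIV. c a b *\<^sub>R column a X) (column b \<xi>)
        = (\<Sum>a\<in>UNIV. (inner (column a X) (column b g) + inner (column b X) (column a g)) / 2
            * (if a \<in> C \<and> b \<in> C then inner (column a X) (column b \<xi>) else 0))" for b
      unfolding inner_sum_left using \<xi>
      by (intro sum.cong refl) (auto simp: block_tangent_columns c_def)
    have "inner (g ** colsel C - G) \<xi> = (\<Sum>b\<in>UNIV. inner (\<Sum>a\<in>UNIV. c a b *\<^sub>R column a X) (column b \<xi>))"
      unfolding inner_columns using \<xi>
      by (intro sum.cong refl) (simp add: G block_tangent_columns)
    also have "\<dots> = 0"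
      unfolding 1
    proof (rule sum_sym_skew)
      fix a b
      have "a \<in> C \<Longrightarrow> b \<in> C \<Longrightarrow> inner (column a X) (column b \<xi>) = - inner (column b X) (column a \<xi>)"
        using \<xi> unfolding block_tangent_columns by (smt (verit) inner_commute)
      then show "(if b \<in> C \<and> a \<in> C then inner (column b X) (column a \<xi>) else 0)
        = - (if a \<in> C \<and> b \<in> C then inner (column a X) (column b \<xi>) else 0)"
        by auto
    qed (simp add: add.commute)
    finally show ?thesis .
  qed
  \<comment> \<open>One Pythagorean identity gives both the minimality of G and, with \<xi> = 0, the
    bound of its norm.\<close>
  have pyth: "(norm (g ** colsel C - \<xi>))\<^sup>2 = (norm (g ** colsel C - G))\<^sup>2 + (norm (G - \<xi>))\<^sup>2"
    if "\<xi> \<in> block_tangent X C" for \<xi>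
  proof -
    have "inner (g ** colsel C - G) (G - \<xi>) = 0"
      using that GT subspace_diff[OF subspace_block_tangent] by (intro orth) auto
    then show ?thesis
      using dot_norm[of "g ** colsel C - G" "G - \<xi>"] by simp
  qed
  have "G = tangent_proj X C g"
    unfolding tangent_proj_def
  proof (rule closest_point_unique)
    show "\<forall>z\<in>block_tangent X C. dist (g ** colsel C) G \<le> dist (g ** colsel C) z"
      unfolding dist_norm using pyth by (auto intro!: power2_le_imp_le[OF _ norm_ge_zero])
  qed (auto simp: GT subspace_imp_convex[OF subspace_block_tangent] closed_subspace[OF subspace_block_tangent])
  then show "tangent_proj X C g \<in> block_tangent X C"
    "column b (tangent_proj X C g) = (if b \<in> C then column b g - (\<Sum>a\<in>UNIV. c a b *\<^sub>R column a X) else 0)"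
    using GT G by simp_all
  have "(norm G)\<^sup>2 \<le> (norm (g ** colsel C))\<^sup>2"
    using pyth[OF subspace_0[OF subspace_block_tangent]] by simp
  then show "norm (tangent_proj X C g) \<le> norm (g ** colsel C)"
    unfolding \<open>G = tangent_proj X C g\<close>[symmetric] by (rule power2_le_imp_le) simp
qed

lemma inner_tangent_proj:
  fixes X g :: "real^'p^'n"
  assumes X: "X \<in> stiefel"
  shows "inner (column a X) (column b (tangent_proj X C g)) =
    (if a \<in> C \<and> b \<in> C then (inner (column a X) (column b g) - inner (column b X) (column a g)) / 2 else 0)"
  by (simp add: column_tangent_proj[OF X] inner_diff_right inner_commute[of "column a X" "sum _ _"]
      inner_sum_orthonormal[OF stiefel_inner[OF X]] field_simps)

text \<open>A relation, so that the same estimates apply to the iterates of the algorithm and to the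
  imagined step after the last one. B is the tangent step, already scaled by the step size.\<close>

definition block_update :: "real^'p^'n \<Rightarrow> 'p set \<Rightarrow> real^'p^'n \<Rightarrow> real^'p^'n \<Rightarrow> bool" where
  "block_update X C B Z \<longleftrightarrow>
     Z ** colsel C = closest_point (block_manifold X C) (X ** colsel C - B) \<and>
     Z ** colsel (- C) = X ** colsel (- C)"

lemma block_manifold_self: "X \<in> stiefel \<Longrightarrow> X ** colsel C \<in> block_manifold X C"
  by (auto simp: block_manifold_columns stiefel_inner)

lemma ex_block_update:
  fixes X B :: "real^'p^'n"
  assumes "X \<in> stiefel"
  obtains Z where "block_update X C B Z"
proof -
  let ?P = "closest_point (block_manifold X C) (X ** colsel C - B)"
  have P: "?P \<in> block_manifold X C"
    using block_manifold_self[OF assms] by (intro closest_point_in_set closed_block_manifold) auto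
  define Z :: "real^'p^'n" where "Z = of_columns (\<lambda>a. (if a \<in> C then column a ?P else column a X))"
  have "column a Z = (if a \<in> C then column a ?P else column a X)" for a
    by (simp add: Z_def)
  then have "block_update X C B Z"
    using P by (auto simp: block_update_def columns_eq_iff block_manifold_columns)
  then show thesis ..
qed

text \<open>For the residual, the Cayley point is a competitor in the nearest-point problem: it
  moves only columns in \<open>C\<close> and keeps all columns orthonormal, so its columns in
  \<open>C\<close> form a point of the block manifold.\<close>

lemma block_update:
  fixes X B :: "real^'p^'n"
  assumes X: "X \<in> stiefel" and B: "B \<in> block_tangent X C" and Z: "block_update X C B Z"
  shows block_update_stiefel: "Z \<in> stiefel"
    and block_update_residual: "norm (Z - X + B) \<le> 3/4 * (norm B)\<^sup>2"
    and block_update_column: "a \<notin> C \<Longrightarrow> column a Z = column a X"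
proof -
  let ?M = "block_manifold X C" and ?V = "X ** colsel C - B"
  let ?P = "closest_point ?M ?V"
  have ne: "?M \<noteq> {}" using block_manifold_self[OF X] by auto
  have PM: "?P \<in> ?M" by (rule closest_point_in_set[OF closed_block_manifold ne])
  have colZ: "column a Z = (if a \<in> C then column a ?P else column a X)" for a
  proof (cases "a \<in> C")
    case True
    have "column a (Z ** colsel C) = column a ?P" using Z by (simp add: block_update_def)
    then show ?thesis using True by simp
  next
    case False
    have "column a (Z ** colsel (- C)) = column a (X ** colsel (- C))" using Z by (simp only: block_update_def)
    then show ?thesis using False by simp
  qed
  then show "a \<notin> C \<Longrightarrow> column a Z = column a X" for a by simp
  have PX: "inner (column a X) (column b ?P) = 0" if "a \<notin> C" for a b
    using PM that by (simp add: block_manifold_columns)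
  show "Z \<in> stiefel"
    unfolding stiefel_columns
  proof (intro allI)
    fix a b
    show "inner (column a Z) (column b Z) = (if a = b then 1 else 0)"
      using PM PX[of a b] PX[of b a] stiefel_inner[OF X, of a b]
      by (auto simp: colZ block_manifold_columns inner_commute)
  qed
  have B0: "a \<notin> C \<Longrightarrow> column a B = 0" for a using B by (simp add: block_tangent_columns)
  have skew: "inner (column a X) (column b B) + inner (column a B) (column b X) = 0" for a b
    using B unfolding block_tangent_columns
    by (cases "a \<in> C"; cases "b \<in> C") (auto simp: inner_commute add.commute)
  obtain w where w: "\<And>a b. inner (w a) (w b) = (if a = b then 1 else 0)"
      "\<And>a. a \<notin> C \<Longrightarrow> w a = column a X"
      "(\<Sum>a\<in>UNIV. (norm (w a - column a X + column a B))\<^sup>2) \<le> 1/2 * (\<Sum>a\<in>UNIV. (norm (column a B))\<^sup>2)\<^sup>2"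
    using cayley_retraction[OF stiefel_inner[OF X] B0 skew] by blast
  define W :: "real^'p^'n" where "W = of_columns (\<lambda>a. (if a \<in> C then w a else 0))"
  have W: "column a W = (if a \<in> C then w a else 0)" for a
    by (simp add: W_def)
  have "inner (column a X) (w b) = 0" if "a \<notin> C" "b \<in> C" for a b
    using w(1)[of a b] w(2)[OF that(1)] that by auto
  then have WM: "W \<in> ?M"
    by (auto simp: block_manifold_columns W w)
  have "norm (?P - ?V) \<le> norm (W - ?V)"
    using closest_point_le[OF closed_block_manifold WM, of ?V] by (simp add: dist_norm norm_minus_commute)
  moreover have "?P - ?V = Z - X + B"
    using PM by (auto simp: columns_eq_iff colZ B0 block_manifold_columns)
  ultimately have "norm (Z - X + B) \<le> norm (W - ?V)" by simp
  then have "(norm (Z - X + B))\<^sup>2 \<le> (norm (W - ?V))\<^sup>2" by (intro power_mono) auto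
  also have "\<dots> = (\<Sum>a\<in>UNIV. (norm (w a - column a X + column a B))\<^sup>2)"
    unfolding norm_columns by (intro sum.cong refl) (auto simp: W w B0 diff_diff_eq2 diff_add_eq)
  also have "\<dots> \<le> 1/2 * (norm B)^4"
    using w(3) by (simp add: norm_columns[symmetric])
  \<comment> \<open>Replaces the constant 1 / sqrt 2 by the rational 3 / 4.\<close>
  also have "\<dots> \<le> 9/16 * (norm B)^4"
    by simp
  also have "\<dots> = (3/4 * (norm B)\<^sup>2)\<^sup>2"
    by (simp add: power_mult_distrib power_divide)
  finally show "norm (Z - X + B) \<le> 3/4 * (norm B)\<^sup>2"
    by (rule power2_le_imp_le) simp
qed

section \<open>Frobenius bounds for products of matrices\<close>

lemma sum_sq_inner_le:
  fixes U V :: "real^'p^'n"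
  shows "(\<Sum>a\<in>UNIV. \<Sum>b\<in>UNIV. (inner (column a U) (column b V))\<^sup>2) \<le> (norm U)\<^sup>2 * (norm V)\<^sup>2"
proof -
  have "(\<Sum>a\<in>UNIV. \<Sum>b\<in>UNIV. (inner (column a U) (column b V))\<^sup>2)
     \<le> (\<Sum>a\<in>UNIV. \<Sum>b\<in>UNIV. (norm (column a U))\<^sup>2 * (norm (column b V))\<^sup>2)"
    by (intro sum_mono) (metis Cauchy_Schwarz_ineq power2_norm_eq_inner)
  also have "\<dots> = (norm U)\<^sup>2 * (norm V)\<^sup>2"
    by (simp add: norm_columns sum_product)
  finally show ?thesis .
qed

text \<open>Bessel's inequality for the columns of Y saves the factor |Y|^2 = p of the general
  bound; this keeps the constants independent of p.\<close>

lemma sum_sq_inner_stiefel_le: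
  fixes U Y :: "real^'p^'n"
  assumes "Y \<in> stiefel"
  shows "(\<Sum>a\<in>UNIV. \<Sum>b\<in>UNIV. (inner (column a U) (column b Y))\<^sup>2) \<le> (norm U)\<^sup>2"
proof -
  have "(\<Sum>b\<in>UNIV. (inner (column a U) (column b Y))\<^sup>2) \<le> (norm (column a U))\<^sup>2" for a
    using bessel[OF stiefel_inner[OF assms], of "column a U"] by (simp add: inner_commute)
  then show ?thesis by (simp add: norm_columns sum_mono)
qed

lemma Cauchy_Schwarz_double_sum:
  fixes p q :: "'a::finite \<Rightarrow> 'a \<Rightarrow> real"
  shows "\<bar>\<Sum>a\<in>UNIV. \<Sum>b\<in>UNIV. p a b * q a b\<bar>
    \<le> sqrt (\<Sum>a\<in>UNIV. \<Sum>b\<in>UNIV. (p a b)\<^sup>2) * sqrt (\<Sum>a\<in>UNIV. \<Sum>b\<in>UNIV. (q a b)\<^sup>2)"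
proof -
  have "(\<Sum>z\<in>UNIV \<times> UNIV. p (fst z) (snd z) * q (fst z) (snd z))\<^sup>2
     \<le> (\<Sum>z\<in>UNIV \<times> UNIV. (p (fst z) (snd z))\<^sup>2) * (\<Sum>z\<in>UNIV \<times> UNIV. (q (fst z) (snd z))\<^sup>2)"
    by (rule Cauchy_Schwarz_ineq_sum)
  then have "(\<Sum>a\<in>UNIV. \<Sum>b\<in>UNIV. p a b * q a b)\<^sup>2
     \<le> (\<Sum>a\<in>UNIV. \<Sum>b\<in>UNIV. (p a b)\<^sup>2) * (\<Sum>a\<in>UNIV. \<Sum>b\<in>UNIV. (q a b)\<^sup>2)"
    by (simp add: sum.cartesian_product case_prod_unfold)
  from real_sqrt_le_mono[OF this] show ?thesis
    by (simp add: real_sqrt_mult)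
qed

section \<open>Change of the adapted form in one step, for each block pair and on average\<close>

context column_blocks
begin

text \<open>\<open>step_bound\<close> dominates the change of \<open>avg_form\<close> caused by an update of the block pair e. It is split into
  a sum over the columns and a sum over the pairs of columns of e, because only then do the averages over e
  reduce to counting. The terms linear in \<open>\<gamma>\<close> that are kept exactly are those whose average is the inner product
  of g and d; the remaining linear terms are quadratic in d, and \<open>7 \<gamma>\<^sup>2\<close> absorbs the error of the retraction.\<close>

definition col_bound :: "real \<Rightarrow> real \<Rightarrow> real^'p^'n \<Rightarrow> real^'p^'n \<Rightarrow> real^'p^'n \<Rightarrow> 'p \<Rightarrow> real" where
  "col_bound L \<gamma> X d g b =
     2 * \<gamma> * (inner (column b g) (column b d)
        - (\<Sum>a\<in>UNIV. inner (column a X) (column b g) * inner (column a X) (column b d)))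
     + \<gamma> * (real l - 2) * ((norm (column b g))\<^sup>2 * (norm d)\<^sup>2 / L
        + L * (\<Sum>c\<in>UNIV. of_bool (blk b \<noteq> blk c) * (inner (column b X) (column c d))\<^sup>2))
     + 7 * \<gamma>\<^sup>2 * (norm (column b g))\<^sup>2"

definition skew_part :: "real^'p^'n \<Rightarrow> real^'p^'n \<Rightarrow> 'p \<Rightarrow> 'p \<Rightarrow> real" where
  "skew_part X g a b = (inner (column a X) (column b g) - inner (column b X) (column a g)) / 2"

definition pair_bound :: "real \<Rightarrow> real^'p^'n \<Rightarrow> real^'p^'n \<Rightarrow> real^'p^'n \<Rightarrow> 'p \<Rightarrow> 'p \<Rightarrow> real" where
  "pair_bound \<gamma> X d g a b =
     2 * \<gamma> * skew_part X g a b * inner (column a X) (column b d) * (1 + (real l - 2) * of_bool (blk a \<noteq> blk b))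
     + of_bool (blk a \<noteq> blk b) * (real l - 2) * (2 * \<gamma>\<^sup>2 * (skew_part X g a b)\<^sup>2)"

definition step_bound :: "real \<Rightarrow> real \<Rightarrow> real^'p^'n \<Rightarrow> real^'p^'n \<Rightarrow> real^'p^'n \<Rightarrow> nat set \<Rightarrow> real" where
  "step_bound L \<gamma> X d g e =
     (\<Sum>b\<in>UNIV. of_bool (blk b \<in> e) * col_bound L \<gamma> X d g b)
     + (\<Sum>a\<in>UNIV. \<Sum>b\<in>UNIV. of_bool (blk a \<in> e \<and> blk b \<in> e) * pair_bound \<gamma> X d g a b)"

text \<open>The definition of \<open>step_bound\<close> is the form that can be averaged over e;
  this is the form that the perturbation estimate produces. Two facts translate between them: the
  inner products of columns of G and X are the negated entries of the skew part, restricted to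
  columns in \<open>C\<close>; and the symmetric part of X^T g is X^T g minus its skew part.\<close>

lemma step_bound_eq:
  assumes X: "X \<in> stiefel" and e: "e \<in> pairs" and C: "C = pair_cols \<CC> e" and G: "G = tangent_proj X C g"
  shows "step_bound L \<gamma> X d g e = 2 * \<gamma> * inner G d
    - 2 * \<gamma> * (real l - 2) * (\<Sum>a\<in>UNIV. \<Sum>b\<in>UNIV. of_bool (blk a \<noteq> blk b) * inner (column a X) (column b d) * inner (column a G) (column b X))
    + \<gamma> * (real l - 2) * ((norm (g ** colsel C))\<^sup>2 * (norm d)\<^sup>2 / L
        + L * (\<Sum>a\<in>UNIV. \<Sum>b\<in>UNIV. (of_bool (a \<in> C) * of_bool (blk a \<noteq> blk b) * inner (column a X) (column b d))\<^sup>2))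
    + 2 * \<gamma>\<^sup>2 * (real l - 2) * (\<Sum>a\<in>UNIV. \<Sum>b\<in>UNIV. of_bool (blk a \<noteq> blk b) * (inner (column a G) (column b X))\<^sup>2)
    + 7 * \<gamma>\<^sup>2 * (norm (g ** colsel C))\<^sup>2"
proof -
  let ?s = "\<lambda>a b. inner (column a X) (column b d)" and ?m = "\<lambda>a b. of_bool (blk a \<noteq> blk b) :: real"
  let ?c = "\<lambda>a. of_bool (blk a \<in> e) :: real" and ?c2 = "\<lambda>a b. of_bool (blk a \<in> e \<and> blk b \<in> e) :: real"
  let ?K = "skew_part X g"
  have mem: "a \<in> C \<longleftrightarrow> blk a \<in> e" for a using mem_pair_cols[OF e] by (simp add: C)
  have GX: "inner (column a G) (column b X) = - ?c2 a b * ?K a b" for a b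
    unfolding inner_commute[of "column a G" "column b X"] unfolding G inner_tangent_proj[OF X]
    by (auto simp: mem skew_part_def field_simps)
  have Gd: "inner G d = (\<Sum>b\<in>UNIV. ?c b * (inner (column b g) (column b d)
        - (\<Sum>a\<in>UNIV. inner (column a X) (column b g) * ?s a b)))
      + (\<Sum>a\<in>UNIV. \<Sum>b\<in>UNIV. ?c2 a b * (?K a b * ?s a b))"
  proof -
    have "inner (column b G) (column b d) = ?c b * (inner (column b g) (column b d)
        - (\<Sum>a\<in>UNIV. inner (column a X) (column b g) * ?s a b)) + (\<Sum>a\<in>UNIV. ?c2 a b * (?K a b * ?s a b))" for b
    proof (cases "b \<in> C")
      case True
      then have "inner (column b G) (column b d) = inner (column b g) (column b d) -
        (\<Sum>a\<in>UNIV. (if a \<in> C then (inner (column a X) (column b g) + inner (column b X) (column a g)) / 2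
           else inner (column a X) (column b g)) * ?s a b)"
        unfolding G column_tangent_proj[OF X] by (simp add: inner_diff_left inner_sum_left)
      also have "\<dots> = inner (column b g) (column b d) - (\<Sum>a\<in>UNIV. inner (column a X) (column b g) * ?s a b - ?c2 a b * (?K a b * ?s a b))"
        using True by (intro arg_cong2[where f = "(-)"] sum.cong refl) (auto simp: mem skew_part_def field_simps)
      finally show ?thesis
        using True by (simp add: sum_subtractf mem)
    next
      case False
      then show ?thesis unfolding G column_tangent_proj[OF X] by (simp add: mem)
    qed
    then show ?thesis
      unfolding inner_columns[of G] by (simp only: sum.distrib sum.swap[of "\<lambda>a b. ?c2 a b * (?K a b * ?s a b)"])
  qed
  have h: "(norm (g ** colsel C))\<^sup>2 = (\<Sum>b\<in>UNIV. ?c b * (norm (column b g))\<^sup>2)"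
    unfolding norm_columns by (intro sum.cong refl) (simp add: mem)
  have v: "(\<Sum>a\<in>UNIV. \<Sum>b\<in>UNIV. (of_bool (a \<in> C) * ?m a b * ?s a b)\<^sup>2) = (\<Sum>a\<in>UNIV. ?c a * (\<Sum>b\<in>UNIV. ?m a b * (?s a b)\<^sup>2))"
    unfolding sum_distrib_left by (intro sum.cong refl) (simp add: mem)
  have T1: "(\<Sum>a\<in>UNIV. \<Sum>b\<in>UNIV. ?m a b * ?s a b * inner (column a G) (column b X))
     = - (\<Sum>a\<in>UNIV. \<Sum>b\<in>UNIV. ?c2 a b * (?m a b * (?K a b * ?s a b)))"
    unfolding GX sum_negf[symmetric] by (intro sum.cong refl) simp
  have \<kappa>: "(\<Sum>a\<in>UNIV. \<Sum>b\<in>UNIV. ?m a b * (inner (column a G) (column b X))\<^sup>2)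
     = (\<Sum>a\<in>UNIV. \<Sum>b\<in>UNIV. ?c2 a b * (?m a b * (?K a b)\<^sup>2))"
    unfolding GX by (intro sum.cong refl) simp
  have col: "(\<Sum>b\<in>UNIV. ?c b * col_bound L \<gamma> X d g b) =
      2 * \<gamma> * (\<Sum>b\<in>UNIV. ?c b * (inner (column b g) (column b d) - (\<Sum>a\<in>UNIV. inner (column a X) (column b g) * ?s a b)))
      + \<gamma> * (real l - 2) * ((\<Sum>b\<in>UNIV. ?c b * (norm (column b g))\<^sup>2) * (norm d)\<^sup>2 / L
        + L * (\<Sum>a\<in>UNIV. ?c a * (\<Sum>b\<in>UNIV. ?m a b * (?s a b)\<^sup>2)))
      + 7 * \<gamma>\<^sup>2 * (\<Sum>b\<in>UNIV. ?c b * (norm (column b g))\<^sup>2)"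
    unfolding sum_distrib_left[of "2 * \<gamma>"] sum_distrib_left[of L] sum_distrib_left[of "7 * \<gamma>\<^sup>2"]
      sum_distrib_right sum_divide_distrib sum.distrib[symmetric] sum_distrib_left[of "\<gamma> * (real l - 2)"]
    by (intro sum.cong refl) (simp add: col_bound_def)
  have pair: "(\<Sum>a\<in>UNIV. \<Sum>b\<in>UNIV. ?c2 a b * pair_bound \<gamma> X d g a b) =
      2 * \<gamma> * (\<Sum>a\<in>UNIV. \<Sum>b\<in>UNIV. ?c2 a b * (?K a b * ?s a b))
      + 2 * \<gamma> * (real l - 2) * (\<Sum>a\<in>UNIV. \<Sum>b\<in>UNIV. ?c2 a b * (?m a b * (?K a b * ?s a b)))
      + 2 * \<gamma>\<^sup>2 * (real l - 2) * (\<Sum>a\<in>UNIV. \<Sum>b\<in>UNIV. ?c2 a b * (?m a b * (?K a b)\<^sup>2))"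
    unfolding sum_distrib_left sum.distrib[symmetric]
    by (intro sum.cong refl) (simp add: pair_bound_def algebra_simps)
  show ?thesis
    unfolding step_bound_def col pair T1 \<kappa> v h Gd by (simp add: algebra_simps)
qed

lemma sum_sq_offdiag_le_cross:
  "(\<Sum>a\<in>UNIV. \<Sum>b\<in>UNIV. (of_bool (a \<in> C) * of_bool (blk a \<noteq> blk b) * inner (column a X) (column b d))\<^sup>2) \<le> cross X d"
  unfolding cross_def by (intro sum_mono) simp

text \<open>The difference (2 l - 1)^2 - 24 (l - 2) is the square of 2 l - 7; over real l, the
  constant 1 / 6 is attained at l = 7 / 2.\<close>

lemma block_rank_bound: "(real l - 2) * (2 / (2 * real l - 1))\<^sup>2 \<le> 1 / 6"
proof -
  have "0 \<le> (2 * real l - 7)\<^sup>2" by simp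
  then have "(real l - 2) * 24 \<le> (2 * real l - 1)\<^sup>2"
    by (simp add: power2_eq_square algebra_simps)
  then show ?thesis
    using l_ge_2 by (simp add: power_divide divide_simps)
qed

text \<open>In units of t^2 with \<open>t = \<gamma> * h\<close>, the pieces \<open>a1\<close> to
  \<open>a5\<close> cost 1, 2.35, 5/8, 2/3 and 9/4, together less than 6.9. The inputs are t^2 \<le>
  1 / l \<le> 1 / 2 and D \<le> 2 / 3; the factor l - 2 is absorbed by
  \<open>block_rank_bound\<close> in \<open>a3\<close> and \<open>a4\<close>, and by t^2 l \<le> 1
  in \<open>a5\<close>.\<close>

lemma step_error_bound:
  fixes \<gamma> h L D \<rho> v T3 :: real
  assumes \<gamma>: "0 \<le> \<gamma>" and h: "0 \<le> h" "h \<le> L" and \<gamma>L: "(\<gamma> * L)\<^sup>2 * real l \<le> 1"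
    and D: "0 \<le> D" "D \<le> 2 / (2 * real l - 1)"
    and \<rho>: "0 \<le> \<rho>" "\<rho> \<le> 3/4 * (\<gamma> * h)\<^sup>2"
    and v: "0 \<le> v" "(real l - 2) * v\<^sup>2 \<le> (2 / (2 * real l - 1))\<^sup>2"
  shows "2 * \<rho> * D + (\<gamma> * h + \<rho>)\<^sup>2 + (real l - 2) * (2 * v * \<rho>)
     + (real l - 2) * (4 * (\<gamma> * h * D)\<^sup>2 + 4 * \<rho>\<^sup>2) \<le> 7 * \<gamma>\<^sup>2 * h\<^sup>2"
proof -
  define t where "t = \<gamma> * h"
  have l: "real l \<ge> 2" using l_ge_2 by simp
  have t0: "0 \<le> t" using \<gamma> h by (simp add: t_def)
  have tL: "t \<le> \<gamma> * L" using \<gamma> h by (simp add: t_def mult_left_mono)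
  then have "t\<^sup>2 \<le> (\<gamma> * L)\<^sup>2" using t0 by (intro power_mono)
  then have tl: "t\<^sup>2 * real l \<le> 1" using \<gamma>L l by (smt (verit) mult_right_mono)
  have "t\<^sup>2 * 2 \<le> t\<^sup>2 * real l" using l by (intro mult_left_mono) auto
  then have t2: "t\<^sup>2 \<le> 1/2" using tl by simp
  \<comment> \<open>A rational bound for 1 / sqrt 2.\<close>
  have t1: "t \<le> 71/100"
    by (rule power2_le_imp_le) (use t2 in \<open>auto simp: power2_eq_square\<close>)
  have D0: "2 / (2 * real l - 1) \<le> 2/3" using l by (simp add: divide_simps)
  have a1: "2 * \<rho> * D \<le> t\<^sup>2"
  proof -
    have "\<rho> * D \<le> (3/4 * t\<^sup>2) * (2/3)"
      using \<rho> D D0 by (intro mult_mono) (auto simp: t_def)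
    then show ?thesis by simp
  qed
  have a2: "(t + \<rho>)\<^sup>2 \<le> 235/100 * t\<^sup>2"
  proof -
    have "3/4 * t * t \<le> 3/4 * t * (71/100)" using t0 t1 by (intro mult_left_mono) auto
    moreover have "\<rho> \<le> 3/4 * t * t" using \<rho> by (simp add: t_def power2_eq_square)
    ultimately have "t + \<rho> \<le> t * (15325/10000)" by simp
    then have "(t + \<rho>)\<^sup>2 \<le> (t * (15325/10000))\<^sup>2"
      using t0 \<rho> by (intro power_mono) auto
    also have "\<dots> \<le> 235/100 * t\<^sup>2"
      by (simp add: power_mult_distrib power2_eq_square)
    finally show ?thesis .
  qed
  have a3: "(real l - 2) * (2 * v * \<rho>) \<le> 5/8 * t\<^sup>2"
  proof -
    have "((real l - 2) * v)\<^sup>2 = (real l - 2) * ((real l - 2) * v\<^sup>2)"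
      by (simp add: power2_eq_square)
    also have "\<dots> \<le> (real l - 2) * (2 / (2 * real l - 1))\<^sup>2"
      using v l by (intro mult_left_mono) auto
    \<comment> \<open>25 / 144 exceeds the 1 / 6 of \<open>block_rank_bound\<close>.\<close>
    also have "\<dots> \<le> (5/12)\<^sup>2"
      using block_rank_bound by (rule order_trans) (simp add: power2_eq_square)
    finally have "(real l - 2) * v \<le> 5/12" by (rule power2_le_imp_le) simp
    then have "((real l - 2) * v) * \<rho> \<le> 5/12 * (3/4 * t\<^sup>2)"
      using \<rho> v l by (intro mult_mono) (auto simp: t_def)
    then show ?thesis by simp
  qed
  have a4: "(real l - 2) * (4 * (t * D)\<^sup>2) \<le> 2/3 * t\<^sup>2"
  proof -
    have "D\<^sup>2 \<le> (2 / (2 * real l - 1))\<^sup>2" using D by (intro power_mono)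
    then have "(real l - 2) * D\<^sup>2 \<le> 1/6"
      using block_rank_bound l by (smt (verit) mult_left_mono)
    then have "t\<^sup>2 * ((real l - 2) * D\<^sup>2) \<le> t\<^sup>2 * (1/6)" by (intro mult_left_mono) auto
    then show ?thesis by (simp add: power_mult_distrib mult_ac)
  qed
  have a5: "(real l - 2) * (4 * \<rho>\<^sup>2) \<le> 9/4 * t\<^sup>2"
  proof -
    have "\<rho>\<^sup>2 \<le> (3/4 * t\<^sup>2)\<^sup>2" using \<rho> by (intro power_mono) (auto simp: t_def)
    then have "(real l - 2) * (4 * \<rho>\<^sup>2) \<le> (real l - 2) * (4 * (3/4 * t\<^sup>2)\<^sup>2)"
      using l by (intro mult_left_mono) auto
    also have "\<dots> = 9/4 * t\<^sup>2 * (t\<^sup>2 * (real l - 2))"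
      by (simp add: power2_eq_square)
    also have "t\<^sup>2 * (real l - 2) \<le> 1"
      using tl zero_le_power2[of t] unfolding right_diff_distrib by linarith
    then have "9/4 * t\<^sup>2 * (t\<^sup>2 * (real l - 2)) \<le> 9/4 * t\<^sup>2 * 1"
      by (intro mult_left_mono) auto
    finally show ?thesis by simp
  qed
  have "(real l - 2) * (4 * (t * D)\<^sup>2 + 4 * \<rho>\<^sup>2) = (real l - 2) * (4 * (t * D)\<^sup>2) + (real l - 2) * (4 * \<rho>\<^sup>2)"
    by (simp add: distrib_left)
  then show ?thesis
    using a1 a2 a3 a4 a5 zero_le_power2[of t] unfolding t_def[symmetric] power_mult_distrib[of \<gamma> h 2, symmetric] mult.assoc[of 7]
    by linarith
qed

text \<open>The columns move by - \<gamma> G plus the retraction residual r. In the Euclidean part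
  and in the cross part, the terms linear in both G and d are kept exactly; \<open>T2\<close>, which
  is quadratic in d, goes through Young's inequality, and whatever contains r is left to
  \<open>step_error_bound\<close>, for which d has to be small.\<close>

lemma avg_form_update_le:
  fixes X Y Z g :: "real^'p^'n"
  assumes X: "X \<in> stiefel" and Y: "Y \<in> stiefel" and e: "e \<in> pairs" and C: "C = pair_cols \<CC> e"
    and \<gamma>: "0 \<le> \<gamma>" and L: "0 < L" and g: "norm g \<le> L" and \<gamma>L: "(\<gamma> * L)\<^sup>2 * real l \<le> 1"
    and Z: "block_update X C (\<gamma> *\<^sub>R tangent_proj X C g) Z"
    and small: "avg_form X (Y - X) \<le> (2 / (2 * real l - 1))\<^sup>2"
  shows "avg_form Z (Y - Z) \<le> avg_form X (Y - X) + step_bound L \<gamma> X (Y - X) g e"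
proof -
  define d where "d = Y - X"
  define G where "G = tangent_proj X C g"
  define r where "r = Z - X + \<gamma> *\<^sub>R G"
  define h where "h = norm (g ** colsel C)"
  define s where "s a b = inner (column a X) (column b d)" for a b
  define m where "m a b = (of_bool (blk a \<noteq> blk b) :: real)" for a b
  define \<delta> where "\<delta> a = column a Z - column a X" for a
  have l: "real l \<ge> 2" using l_ge_2 by simp
  have GT: "G \<in> block_tangent X C" unfolding G_def by (rule tangent_proj_mem[OF X])
  have \<gamma>GT: "\<gamma> *\<^sub>R G \<in> block_tangent X C" using subspace_scale[OF subspace_block_tangent GT] .
  have G0: "column a G = 0" if "a \<notin> C" for a using GT that by (simp add: block_tangent_columns)
  have Z': "block_update X C (\<gamma> *\<^sub>R G) Z" using Z by (simp add: G_def)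
  have ZS: "Z \<in> stiefel" by (rule block_update_stiefel[OF X \<gamma>GT Z'])
  have \<delta>0: "\<delta> a = 0" if "a \<notin> C" for a using block_update_column[OF X \<gamma>GT Z' that] by (simp add: \<delta>_def)
  have r_col: "column a r = \<delta> a + \<gamma> *\<^sub>R column a G" for a by (simp add: r_def \<delta>_def)
  have r0: "column a r = 0" if "a \<notin> C" for a using that by (simp add: r_col \<delta>0 G0)
  have Gh: "norm G \<le> h" unfolding G_def h_def by (rule norm_tangent_proj[OF X])
  have hL: "h \<le> L"
  proof -
    have "h\<^sup>2 \<le> (norm g)\<^sup>2" unfolding h_def norm_columns by (intro sum_mono) simp
    then have "h \<le> norm g" by (rule power2_le_imp_le) simp
    then show ?thesis using g by simp
  qed
  have h0: "0 \<le> h" by (simp add: h_def)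
  have r_le: "norm r \<le> 3/4 * (\<gamma> * h)\<^sup>2"
  proof -
    have "norm r \<le> 3/4 * (norm (\<gamma> *\<^sub>R G))\<^sup>2"
      unfolding r_def by (rule block_update_residual[OF X \<gamma>GT Z'])
    also have "\<dots> \<le> 3/4 * (\<gamma> * h)\<^sup>2"
      using Gh \<gamma> by (intro mult_left_mono power_mono) (auto simp: mult_left_mono)
    finally show ?thesis .
  qed
  have d_le: "norm d \<le> 2 / (2 * real l - 1)"
    using order_trans[OF norm_le_avg_form small] l unfolding d_def by (auto intro: power2_le_imp_le)
  \<comment> \<open>Only columns of X in \<open>C\<close> move. Restricting the cross terms to them
    keeps a membership indicator that later averages to 2 / l.\<close>
  define v where "v = sqrt (\<Sum>a\<in>UNIV. \<Sum>b\<in>UNIV. (of_bool (a \<in> C) * m a b * s a b)\<^sup>2)"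
  have v2: "v\<^sup>2 = (\<Sum>a\<in>UNIV. \<Sum>b\<in>UNIV. (of_bool (a \<in> C) * m a b * s a b)\<^sup>2)"
    unfolding v_def by (intro real_sqrt_pow2 sum_nonneg) simp
  have v0: "0 \<le> v" unfolding v_def by (intro real_sqrt_ge_zero sum_nonneg) simp
  have "v\<^sup>2 \<le> cross X d" unfolding v2 m_def s_def by (rule sum_sq_offdiag_le_cross)
  then have "(real l - 2) * v\<^sup>2 \<le> (real l - 2) * cross X d" using l by (intro mult_left_mono) auto
  also have "\<dots> \<le> (2 / (2 * real l - 1))\<^sup>2"
    using small zero_le_power2[of "norm d"] unfolding avg_form_def d_def[symmetric] by linarith
  finally have v_le: "(real l - 2) * v\<^sup>2 \<le> (2 / (2 * real l - 1))\<^sup>2" .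
  have xy: "inner (column a X) (column b Y) = s a b" if "blk a \<noteq> blk b" for a b
    using that stiefel_inner[OF X, of a b] by (auto simp: s_def d_def inner_diff_right)
  have crossZ: "cross Z (Y - Z) = cross X d + 2 * (\<Sum>a\<in>UNIV. \<Sum>b\<in>UNIV. m a b * s a b * inner (\<delta> a) (column b Y))
      + (\<Sum>a\<in>UNIV. \<Sum>b\<in>UNIV. m a b * (inner (\<delta> a) (column b Y))\<^sup>2)"
  proof -
    have "m a b * (inner (column a Z) (column b (Y - Z)))\<^sup>2
      = m a b * (s a b)\<^sup>2 + 2 * (m a b * s a b * inner (\<delta> a) (column b Y)) + m a b * (inner (\<delta> a) (column b Y))\<^sup>2" for a b
    proof (cases "blk a = blk b")
      case False
      then have "inner (column a Z) (column b (Y - Z)) = inner (column a X) (column b Y) + inner (\<delta> a) (column b Y)"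
        using stiefel_inner[OF ZS, of a b] by (auto simp: \<delta>_def inner_diff_right inner_diff_left)
      then show ?thesis
        using False by (simp add: xy m_def power2_sum)
    qed (simp add: m_def)
    then show ?thesis
      unfolding cross_def m_def[symmetric] s_def[symmetric]
      by (simp only: sum.distrib sum_distrib_left)
  qed
  define T1 where "T1 = (\<Sum>a\<in>UNIV. \<Sum>b\<in>UNIV. m a b * s a b * inner (column a G) (column b X))"
  define T2 where "T2 = (\<Sum>a\<in>UNIV. \<Sum>b\<in>UNIV. m a b * s a b * inner (column a G) (column b d))"
  define T3 where "T3 = (\<Sum>a\<in>UNIV. \<Sum>b\<in>UNIV. m a b * s a b * inner (column a r) (column b Y))"
  define \<kappa> where "\<kappa> = (\<Sum>a\<in>UNIV. \<Sum>b\<in>UNIV. m a b * (inner (column a G) (column b X))\<^sup>2)"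
  have \<delta>Y: "inner (\<delta> a) (column b Y) = - \<gamma> * inner (column a G) (column b X)
     - \<gamma> * inner (column a G) (column b d) + inner (column a r) (column b Y)" for a b
    by (simp add: r_col inner_add_left d_def inner_diff_right right_diff_distrib)
  have lin: "(\<Sum>a\<in>UNIV. \<Sum>b\<in>UNIV. m a b * s a b * inner (\<delta> a) (column b Y)) = - \<gamma> * T1 - \<gamma> * T2 + T3"
    unfolding T1_def T2_def T3_def sum_distrib_left sum.distrib[symmetric] sum_subtractf[symmetric]
    by (intro sum.cong refl) (simp add: \<delta>Y algebra_simps)
  have T2: "\<bar>T2\<bar> \<le> v * (h * norm d)"
  proof -
    have "T2 = (\<Sum>a\<in>UNIV. \<Sum>b\<in>UNIV. (of_bool (a \<in> C) * m a b * s a b) * inner (column a G) (column b d))"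
      unfolding T2_def by (intro sum.cong refl) (auto simp: G0)
    also have "\<bar>\<dots>\<bar> \<le> v * sqrt (\<Sum>a\<in>UNIV. \<Sum>b\<in>UNIV. (inner (column a G) (column b d))\<^sup>2)"
      unfolding v_def by (rule Cauchy_Schwarz_double_sum)
    also have "\<dots> \<le> v * sqrt ((norm G)\<^sup>2 * (norm d)\<^sup>2)"
      by (intro mult_left_mono real_sqrt_le_mono sum_sq_inner_le v0)
    also have "\<dots> = v * (norm G * norm d)" by (simp add: real_sqrt_mult)
    also have "\<dots> \<le> v * (h * norm d)" by (intro mult_left_mono mult_right_mono Gh v0) simp
    finally show ?thesis .
  qed
  have T3: "T3 \<le> v * norm r"
  proof -
    have "T3 = (\<Sum>a\<in>UNIV. \<Sum>b\<in>UNIV. (of_bool (a \<in> C) * m a b * s a b) * inner (column a r) (column b Y))"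
      unfolding T3_def by (intro sum.cong refl) (auto simp: r0)
    also have "\<dots> \<le> v * sqrt (\<Sum>a\<in>UNIV. \<Sum>b\<in>UNIV. (inner (column a r) (column b Y))\<^sup>2)"
      unfolding v_def by (rule order_trans[OF abs_ge_self Cauchy_Schwarz_double_sum])
    also have "\<dots> \<le> v * sqrt ((norm r)\<^sup>2)"
      by (intro mult_left_mono real_sqrt_le_mono sum_sq_inner_stiefel_le[OF Y] v0)
    finally show ?thesis by simp
  qed
  have T4: "(\<Sum>a\<in>UNIV. \<Sum>b\<in>UNIV. m a b * (inner (\<delta> a) (column b Y))\<^sup>2)
     \<le> 2 * \<gamma>\<^sup>2 * \<kappa> + (4 * (\<gamma> * h * norm d)\<^sup>2 + 4 * (norm r)\<^sup>2)"
  proof -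
    \<comment> \<open>The lightest weight goes to p, whose square survives as
      \<open>\<kappa>\<close> and contributes to the constant 9; the other two squares are absorbed
      by \<open>step_error_bound\<close>.\<close>
    have sq: "(p + q + t)\<^sup>2 \<le> 2 * p\<^sup>2 + 4 * q\<^sup>2 + 4 * t\<^sup>2" for p q t :: real
    proof -
      have "0 \<le> (p - (q + t))\<^sup>2 + 2 * (q - t)\<^sup>2" by simp
      then show ?thesis by (simp add: power2_eq_square algebra_simps)
    qed
    have "m a b * (inner (\<delta> a) (column b Y))\<^sup>2 \<le> 2 * \<gamma>\<^sup>2 * (m a b * (inner (column a G) (column b X))\<^sup>2)
       + 4 * \<gamma>\<^sup>2 * (inner (column a G) (column b d))\<^sup>2 + 4 * (inner (column a r) (column b Y))\<^sup>2" for a b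
      using sq[of "- \<gamma> * inner (column a G) (column b X)" "- \<gamma> * inner (column a G) (column b d)" "inner (column a r) (column b Y)"]
      by (cases "blk a = blk b") (auto simp: m_def \<delta>Y power_mult_distrib)
    then have "(\<Sum>a\<in>UNIV. \<Sum>b\<in>UNIV. m a b * (inner (\<delta> a) (column b Y))\<^sup>2)
      \<le> (\<Sum>a\<in>UNIV. \<Sum>b\<in>UNIV. 2 * \<gamma>\<^sup>2 * (m a b * (inner (column a G) (column b X))\<^sup>2)
       + 4 * \<gamma>\<^sup>2 * (inner (column a G) (column b d))\<^sup>2 + 4 * (inner (column a r) (column b Y))\<^sup>2)"
      by (intro sum_mono)
    also have "\<dots> = 2 * \<gamma>\<^sup>2 * \<kappa> + 4 * \<gamma>\<^sup>2 * (\<Sum>a\<in>UNIV. \<Sum>b\<in>UNIV. (inner (column a G) (column b d))\<^sup>2)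
       + 4 * (\<Sum>a\<in>UNIV. \<Sum>b\<in>UNIV. (inner (column a r) (column b Y))\<^sup>2)"
      by (simp only: sum.distrib sum_distrib_left \<kappa>_def)
    also have "\<dots> \<le> 2 * \<gamma>\<^sup>2 * \<kappa> + 4 * \<gamma>\<^sup>2 * (h\<^sup>2 * (norm d)\<^sup>2) + 4 * (norm r)\<^sup>2"
    proof -
      have "(norm G)\<^sup>2 * (norm d)\<^sup>2 \<le> h\<^sup>2 * (norm d)\<^sup>2"
        using Gh by (intro mult_right_mono power_mono) auto
      then have "(\<Sum>a\<in>UNIV. \<Sum>b\<in>UNIV. (inner (column a G) (column b d))\<^sup>2) \<le> h\<^sup>2 * (norm d)\<^sup>2"
        using sum_sq_inner_le order_trans by blast
      then show ?thesis
        using sum_sq_inner_stiefel_le[OF Y, of r] by (intro add_mono mult_left_mono order_refl) auto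
    qed
    finally show ?thesis by (simp add: power_mult_distrib)
  qed
  have euclid: "(norm (Y - Z))\<^sup>2 \<le> (norm d)\<^sup>2 + 2 * \<gamma> * inner G d + 2 * norm r * norm d + (\<gamma> * h + norm r)\<^sup>2"
  proof -
    have "Y - Z = d - (r - \<gamma> *\<^sub>R G)" by (simp add: d_def r_def)
    then have "(norm (Y - Z))\<^sup>2 = (norm d)\<^sup>2 - 2 * inner (r - \<gamma> *\<^sub>R G) d + (norm (r - \<gamma> *\<^sub>R G))\<^sup>2"
      by (simp add: power2_norm_eq_inner inner_diff inner_commute)
    moreover have "- inner r d \<le> norm r * norm d"
      using norm_cauchy_schwarz[of "- r" d] by simp
    moreover have "(norm (r - \<gamma> *\<^sub>R G))\<^sup>2 \<le> (\<gamma> * h + norm r)\<^sup>2"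
    proof (rule power_mono)
      have "norm (r - \<gamma> *\<^sub>R G) \<le> norm r + \<gamma> * norm G"
        using norm_triangle_ineq4[of r "\<gamma> *\<^sub>R G"] \<gamma> by simp
      also have "\<dots> \<le> \<gamma> * h + norm r" using Gh \<gamma> by (simp add: mult_left_mono)
      finally show "norm (r - \<gamma> *\<^sub>R G) \<le> \<gamma> * h + norm r" .
    qed simp
    ultimately show ?thesis by (simp add: inner_diff_left)
  qed
  have T2': "- 2 * \<gamma> * T2 \<le> \<gamma> * (h\<^sup>2 * (norm d)\<^sup>2 / L + L * v\<^sup>2)"
  proof -
    \<comment> \<open>Young's inequality with weight L: as |g| \<le> L, after averaging the two
      terms become L times |d|^2 and L times V.\<close>
    have "0 \<le> (h * norm d / sqrt L - sqrt L * v)\<^sup>2" by simp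
    then have "2 * (v * (h * norm d)) \<le> h\<^sup>2 * (norm d)\<^sup>2 / L + L * v\<^sup>2"
      using L by (simp add: power2_diff power_divide power_mult_distrib mult_ac)
    then have "- 2 * T2 \<le> h\<^sup>2 * (norm d)\<^sup>2 / L + L * v\<^sup>2" using T2 by linarith
    then have "\<gamma> * (- 2 * T2) \<le> \<gamma> * (h\<^sup>2 * (norm d)\<^sup>2 / L + L * v\<^sup>2)" using \<gamma> by (rule mult_left_mono)
    then show ?thesis by (simp add: mult_ac)
  qed
  have bound: "step_bound L \<gamma> X d g e = 2 * \<gamma> * inner G d - 2 * \<gamma> * (real l - 2) * T1
     + \<gamma> * (real l - 2) * (h\<^sup>2 * (norm d)\<^sup>2 / L + L * v\<^sup>2) + 2 * \<gamma>\<^sup>2 * (real l - 2) * \<kappa> + 7 * \<gamma>\<^sup>2 * h\<^sup>2"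
    unfolding step_bound_eq[OF X e C G_def] T1_def \<kappa>_def v2 h_def m_def s_def ..
  have err: "2 * norm r * norm d + (\<gamma> * h + norm r)\<^sup>2 + (real l - 2) * (2 * v * norm r)
     + (real l - 2) * (4 * (\<gamma> * h * norm d)\<^sup>2 + 4 * (norm r)\<^sup>2) \<le> 7 * \<gamma>\<^sup>2 * h\<^sup>2"
    by (rule step_error_bound[OF \<gamma> h0 hL \<gamma>L norm_ge_zero d_le norm_ge_zero r_le v0 v_le])
  have alg: "k * (c - 2 * \<gamma> * t + \<gamma> * q + u + (2 * \<gamma>\<^sup>2 * w + z))
      = k * c - 2 * \<gamma> * k * t + \<gamma> * k * q + k * u + 2 * \<gamma>\<^sup>2 * k * w + k * z" for k c t q u w z :: real
    by (simp add: algebra_simps)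
  have "cross Z (Y - Z) \<le> cross X d - 2 * \<gamma> * T1 + \<gamma> * (h\<^sup>2 * (norm d)\<^sup>2 / L + L * v\<^sup>2) + 2 * v * norm r
      + (2 * \<gamma>\<^sup>2 * \<kappa> + (4 * (\<gamma> * h * norm d)\<^sup>2 + 4 * (norm r)\<^sup>2))"
    unfolding crossZ lin using T2' T3 T4 by (simp add: algebra_simps)
  then have "(real l - 2) * cross Z (Y - Z) \<le> (real l - 2) * (cross X d - 2 * \<gamma> * T1 + \<gamma> * (h\<^sup>2 * (norm d)\<^sup>2 / L + L * v\<^sup>2)
     + 2 * v * norm r + (2 * \<gamma>\<^sup>2 * \<kappa> + (4 * (\<gamma> * h * norm d)\<^sup>2 + 4 * (norm r)\<^sup>2)))"
    using l by (intro mult_left_mono) auto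
  also have "\<dots> = (real l - 2) * cross X d - 2 * \<gamma> * (real l - 2) * T1 + \<gamma> * (real l - 2) * (h\<^sup>2 * (norm d)\<^sup>2 / L + L * v\<^sup>2)
     + (real l - 2) * (2 * v * norm r) + 2 * \<gamma>\<^sup>2 * (real l - 2) * \<kappa> + (real l - 2) * (4 * (\<gamma> * h * norm d)\<^sup>2 + 4 * (norm r)\<^sup>2)"
    by (rule alg)
  finally show ?thesis
    using euclid err unfolding d_def[symmetric] bound unfolding avg_form_def by linarith
qed

lemma stiefel_diff_inner:
  assumes "X \<in> stiefel" "Y \<in> stiefel"
  shows "inner (column a X) (column b (Y - X)) + inner (column b X) (column a (Y - X))
    = - inner (column a (Y - X)) (column b (Y - X))"
  using stiefel_inner[OF assms(1), of a b] stiefel_inner[OF assms(2), of a b]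
  by (simp add: inner_diff inner_commute)

text \<open>After averaging, the columns contribute \<open>inner g d\<close> minus the product of
  X^T g and X^T d, and the pairs contribute the product of the skew part of X^T g with X^T d. Since
  X^T d is skew up to - d^T d / 2, these two products cancel up to half the product of X^T g and d^T
  d, which is at most L |d|^2 / 2.\<close>

lemma avg_step_bound_le:
  fixes X Y g :: "real^'p^'n"
  assumes X: "X \<in> stiefel" and Y: "Y \<in> stiefel" and \<gamma>: "0 \<le> \<gamma>" and L: "0 < L" and g: "norm g \<le> L"
  shows "(\<Sum>e\<in>pairs. step_bound L \<gamma> X (Y - X) g e) / real (l choose 2)
    \<le> 4 * \<gamma> / real l * inner g (Y - X)
      + 2 * \<gamma> * L / real l * (2 * real l - 3) * avg_form X (Y - X) + 18 * (\<gamma> * L)\<^sup>2 / real l"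
proof -
  define d where "d = Y - X"
  define p where "p a b = inner (column a X) (column b g)" for a b
  define s where "s a b = inner (column a X) (column b d)" for a b
  define K where "K = skew_part X g"
  have l: "real l \<ge> 2" using l_ge_2 by simp
  have sd: "s b a = - s a b - inner (column a d) (column b d)" for a b
    using stiefel_diff_inner[OF X Y, of a b] by (simp add: s_def d_def)
  have K: "K a b = (p a b - p b a) / 2" for a b by (simp add: K_def skew_part_def p_def)
  have pair: "(\<Sum>e\<in>pairs. \<Sum>a\<in>UNIV. \<Sum>b\<in>UNIV. of_bool (blk a \<in> e \<and> blk b \<in> e) * pair_bound \<gamma> X d g a b) / real (l choose 2)
     \<le> 2 / real l * (2 * \<gamma> * (\<Sum>a\<in>UNIV. \<Sum>b\<in>UNIV. K a b * s a b) + 2 * \<gamma>\<^sup>2 * (\<Sum>a\<in>UNIV. \<Sum>b\<in>UNIV. (K a b)\<^sup>2))"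
  proof -
    have "(if blk a = blk b then 2 / real l else 2 / (real l * (real l - 1))) * pair_bound \<gamma> X d g a b
        \<le> 2 / real l * (2 * \<gamma> * (K a b * s a b) + 2 * \<gamma>\<^sup>2 * (K a b)\<^sup>2)" for a b
    proof (cases "blk a = blk b")
      case True
      have "2 / real l * (2 * \<gamma> * (K a b * s a b)) \<le> 2 / real l * (2 * \<gamma> * (K a b * s a b) + 2 * \<gamma>\<^sup>2 * (K a b)\<^sup>2)"
        by (intro mult_left_mono) auto
      then show ?thesis using True by (simp add: pair_bound_def K_def s_def mult_ac)
    next
      case False
      have "2 / (real l * (real l - 1)) * pair_bound \<gamma> X d g a b
         = 2 / (real l * (real l - 1)) * (2 * \<gamma> * (K a b * s a b) * (real l - 1) + (real l - 2) * (2 * \<gamma>\<^sup>2 * (K a b)\<^sup>2))"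
        using False by (simp add: pair_bound_def K_def s_def mult_ac)
      \<comment> \<open>Only the nonnegative quadratic term is enlarged, from l - 2 to l - 1; the
        linear term carries l - 1 exactly.\<close>
      also have "\<dots> \<le> 2 / (real l * (real l - 1)) * (2 * \<gamma> * (K a b * s a b) * (real l - 1) + (real l - 1) * (2 * \<gamma>\<^sup>2 * (K a b)\<^sup>2))"
        using l by (intro mult_left_mono add_left_mono mult_right_mono) auto
      also have "\<dots> = 2 / (real l * (real l - 1)) * (real l - 1) * (2 * \<gamma> * (K a b * s a b) + 2 * \<gamma>\<^sup>2 * (K a b)\<^sup>2)"
        by (simp only: distrib_left mult_ac)
      also have "2 / (real l * (real l - 1)) * (real l - 1) = 2 / real l"
        using l by (simp add: divide_simps)
      finally show ?thesis using False by simp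
    qed
    then show ?thesis
      unfolding avg_sum_cols_both sum_distrib_left sum.distrib[symmetric]
      by (intro sum_mono) (simp add: distrib_left)
  qed
  have col: "(\<Sum>b\<in>UNIV. col_bound L \<gamma> X d g b) = 2 * \<gamma> * (inner g d - (\<Sum>a\<in>UNIV. \<Sum>b\<in>UNIV. p a b * s a b))
      + \<gamma> * (real l - 2) * ((norm g)\<^sup>2 * (norm d)\<^sup>2 / L + L * cross X d) + 7 * \<gamma>\<^sup>2 * (norm g)\<^sup>2"
  proof -
    have "(\<Sum>a\<in>UNIV. \<Sum>b\<in>UNIV. p a b * s a b) = (\<Sum>b\<in>UNIV. \<Sum>a\<in>UNIV. p a b * s a b)"
      by (rule sum.swap)
    then show ?thesis
      unfolding inner_columns[of g d] norm_columns[of g] cross_def col_bound_def sum_distrib_left[of "2 * \<gamma>"] sum_distrib_left[of L]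
        sum_distrib_left[of "7 * \<gamma>\<^sup>2"] sum_distrib_left[of "\<gamma> * (real l - 2)"]
        sum_distrib_right sum_divide_distrib p_def s_def
      by (simp only: sum.distrib[symmetric] sum_subtractf[symmetric] sum_distrib_left[of "2 * \<gamma>"]
          sum_distrib_left[of "\<gamma> * (real l - 2)"] sum_distrib_left[of L])
  qed
  have KS: "(\<Sum>a\<in>UNIV. \<Sum>b\<in>UNIV. K a b * s a b)
     = (\<Sum>a\<in>UNIV. \<Sum>b\<in>UNIV. p a b * s a b) + 1/2 * (\<Sum>a\<in>UNIV. \<Sum>b\<in>UNIV. p a b * inner (column a d) (column b d))"
  proof -
    have "(\<Sum>a\<in>UNIV. \<Sum>b\<in>UNIV. K a b * s a b) = (\<Sum>a\<in>UNIV. \<Sum>b\<in>UNIV. 1/2 * (p a b * s a b)) - (\<Sum>a\<in>UNIV. \<Sum>b\<in>UNIV. 1/2 * (p b a * s a b))"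
      unfolding sum_subtractf[symmetric] by (intro sum.cong refl) (simp add: K field_simps)
    also have "(\<Sum>a\<in>UNIV. \<Sum>b\<in>UNIV. 1/2 * (p b a * s a b)) = (\<Sum>a\<in>UNIV. \<Sum>b\<in>UNIV. 1/2 * (p a b * s b a))"
      by (rule sum.swap)
    also have "\<dots> = - (\<Sum>a\<in>UNIV. \<Sum>b\<in>UNIV. 1/2 * (p a b * s a b)) - (\<Sum>a\<in>UNIV. \<Sum>b\<in>UNIV. 1/2 * (p a b * inner (column a d) (column b d)))"
      unfolding sum_subtractf[symmetric] sum_negf[symmetric]
      by (intro sum.cong refl) (subst sd, simp add: field_simps)
    finally show ?thesis by (simp add: sum_distrib_left)
  qed
  have g2: "(norm g)\<^sup>2 \<le> L\<^sup>2" using g by (intro power_mono) auto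
  have p2: "(\<Sum>a\<in>UNIV. \<Sum>b\<in>UNIV. (p a b)\<^sup>2) \<le> (norm g)\<^sup>2"
  proof -
    have "(\<Sum>a\<in>UNIV. \<Sum>b\<in>UNIV. (p a b)\<^sup>2) = (\<Sum>b\<in>UNIV. \<Sum>a\<in>UNIV. (inner (column b g) (column a X))\<^sup>2)"
      unfolding p_def by (subst sum.swap) (simp add: inner_commute)
    also have "\<dots> \<le> (norm g)\<^sup>2" by (rule sum_sq_inner_stiefel_le[OF X])
    finally show ?thesis .
  qed
  have pd: "(\<Sum>a\<in>UNIV. \<Sum>b\<in>UNIV. p a b * inner (column a d) (column b d)) \<le> L * (norm d)\<^sup>2"
  proof -
    have "(\<Sum>a\<in>UNIV. \<Sum>b\<in>UNIV. p a b * inner (column a d) (column b d))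
      \<le> sqrt (\<Sum>a\<in>UNIV. \<Sum>b\<in>UNIV. (p a b)\<^sup>2) * sqrt (\<Sum>a\<in>UNIV. \<Sum>b\<in>UNIV. (inner (column a d) (column b d))\<^sup>2)"
      by (rule order_trans[OF abs_ge_self Cauchy_Schwarz_double_sum])
    also have "\<dots> \<le> sqrt (L\<^sup>2) * sqrt ((norm d)\<^sup>2 * (norm d)\<^sup>2)"
      using order_trans[OF p2 g2] sum_sq_inner_le[of d d]
      by (intro mult_mono real_sqrt_le_mono real_sqrt_ge_zero sum_nonneg) auto
    also have "\<dots> = L * (norm d)\<^sup>2" using L by (simp add: real_sqrt_mult power2_eq_square)
    finally show ?thesis .
  qed
  have K2: "(\<Sum>a\<in>UNIV. \<Sum>b\<in>UNIV. (K a b)\<^sup>2) \<le> L\<^sup>2"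
  proof -
    have "(K a b)\<^sup>2 \<le> 1/2 * (p a b)\<^sup>2 + 1/2 * (p b a)\<^sup>2" for a b
    proof -
      have "0 \<le> (p a b + p b a)\<^sup>2" by simp
      then show ?thesis by (simp add: K power_divide power2_eq_square algebra_simps)
    qed
    then have "(\<Sum>a\<in>UNIV. \<Sum>b\<in>UNIV. (K a b)\<^sup>2) \<le> (\<Sum>a\<in>UNIV. \<Sum>b\<in>UNIV. 1/2 * (p a b)\<^sup>2 + 1/2 * (p b a)\<^sup>2)"
      by (intro sum_mono)
    also have "\<dots> = 1/2 * (\<Sum>a\<in>UNIV. \<Sum>b\<in>UNIV. (p a b)\<^sup>2) + 1/2 * (\<Sum>a\<in>UNIV. \<Sum>b\<in>UNIV. (p b a)\<^sup>2)"
      by (simp only: sum.distrib sum_distrib_left)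
    also have "(\<Sum>a\<in>UNIV. \<Sum>b\<in>UNIV. (p b a)\<^sup>2) = (\<Sum>a\<in>UNIV. \<Sum>b\<in>UNIV. (p a b)\<^sup>2)"
      by (rule sum.swap)
    finally show ?thesis using p2 g2 by simp
  qed
  have "(\<Sum>e\<in>pairs. step_bound L \<gamma> X d g e) / real (l choose 2)
     = 2 / real l * (\<Sum>b\<in>UNIV. col_bound L \<gamma> X d g b)
      + (\<Sum>e\<in>pairs. \<Sum>a\<in>UNIV. \<Sum>b\<in>UNIV. of_bool (blk a \<in> e \<and> blk b \<in> e) * pair_bound \<gamma> X d g a b) / real (l choose 2)"
    unfolding step_bound_def sum.distrib add_divide_distrib avg_sum_cols ..
  also have "\<dots> \<le> 2 / real l * (\<Sum>b\<in>UNIV. col_bound L \<gamma> X d g b)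
    + 2 / real l * (2 * \<gamma> * (\<Sum>a\<in>UNIV. \<Sum>b\<in>UNIV. K a b * s a b) + 2 * \<gamma>\<^sup>2 * (\<Sum>a\<in>UNIV. \<Sum>b\<in>UNIV. (K a b)\<^sup>2))"
    using pair by simp
  also have "\<dots> = 2 / real l * (2 * \<gamma> * inner g d + \<gamma> * (\<Sum>a\<in>UNIV. \<Sum>b\<in>UNIV. p a b * inner (column a d) (column b d))
      + \<gamma> * (real l - 2) * ((norm g)\<^sup>2 * (norm d)\<^sup>2 / L + L * cross X d) + 7 * \<gamma>\<^sup>2 * (norm g)\<^sup>2
      + 2 * \<gamma>\<^sup>2 * (\<Sum>a\<in>UNIV. \<Sum>b\<in>UNIV. (K a b)\<^sup>2))"
    unfolding col KS by (simp add: algebra_simps)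
  also have "\<dots> \<le> 2 / real l * (2 * \<gamma> * inner g d + \<gamma> * (L * (norm d)\<^sup>2)
      + \<gamma> * (real l - 2) * (L * (norm d)\<^sup>2 + L * cross X d) + 7 * \<gamma>\<^sup>2 * L\<^sup>2 + 2 * \<gamma>\<^sup>2 * L\<^sup>2)"
  proof (rule mult_left_mono)
    have "(norm g)\<^sup>2 * (norm d)\<^sup>2 / L \<le> L\<^sup>2 * (norm d)\<^sup>2 / L"
      using g2 L by (intro divide_right_mono mult_right_mono) auto
    then have "(norm g)\<^sup>2 * (norm d)\<^sup>2 / L \<le> L * (norm d)\<^sup>2"
      using L by (simp add: power2_eq_square)
    then show "2 * \<gamma> * inner g d + \<gamma> * (\<Sum>a\<in>UNIV. \<Sum>b\<in>UNIV. p a b * inner (column a d) (column b d))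
      + \<gamma> * (real l - 2) * ((norm g)\<^sup>2 * (norm d)\<^sup>2 / L + L * cross X d) + 7 * \<gamma>\<^sup>2 * (norm g)\<^sup>2
      + 2 * \<gamma>\<^sup>2 * (\<Sum>a\<in>UNIV. \<Sum>b\<in>UNIV. (K a b)\<^sup>2)
      \<le> 2 * \<gamma> * inner g d + \<gamma> * (L * (norm d)\<^sup>2)
      + \<gamma> * (real l - 2) * (L * (norm d)\<^sup>2 + L * cross X d) + 7 * \<gamma>\<^sup>2 * L\<^sup>2 + 2 * \<gamma>\<^sup>2 * L\<^sup>2"
      using pd g2 K2 \<gamma> l by (intro add_mono mult_left_mono order_refl) auto
  qed (use l in auto)
  also have "\<dots> = 4 * \<gamma> / real l * inner g d + 2 * \<gamma> * L / real l * ((real l - 1) * (norm d)\<^sup>2 + (real l - 2) * cross X d) + 18 * (\<gamma> * L)\<^sup>2 / real l"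
    by (simp add: algebra_simps power_mult_distrib add_divide_distrib diff_divide_distrib)
  \<comment> \<open>The coefficients l - 1 of |d|^2 and 1 of (l - 2) V are both at most 2 l - 3
    because l \<ge> 2; this is the form that the final bound carries.\<close>
  also have "\<dots> \<le> 4 * \<gamma> / real l * inner g d + 2 * \<gamma> * L / real l * ((2 * real l - 3) * avg_form X d) + 18 * (\<gamma> * L)\<^sup>2 / real l"
  proof -
    have "(real l - 1) * (norm d)\<^sup>2 \<le> (2 * real l - 3) * (norm d)\<^sup>2"
      using l by (intro mult_right_mono) auto
    moreover have "1 * ((real l - 2) * cross X d) \<le> (2 * real l - 3) * ((real l - 2) * cross X d)"
      using l cross_nonneg[of X d] by (intro mult_right_mono) auto
    ultimately have "(real l - 1) * (norm d)\<^sup>2 + (real l - 2) * cross X d \<le> (2 * real l - 3) * avg_form X d"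
      by (simp add: avg_form_def distrib_left)
    then show ?thesis
      using \<gamma> L by (intro add_mono mult_left_mono order_refl) auto
  qed
  finally show ?thesis by (simp add: d_def mult.assoc)
qed

text \<open>With this embedding, inequalities between values of the quadratic form \<open>avg_form X\<close> reduce to the
  triangle inequality.\<close>

definition avg_embed :: "real^'p^'n \<Rightarrow> real^'p^'n \<Rightarrow> (real^'p^'n) \<times> (real^'p^'p)" where
  "avg_embed X \<xi> = (\<xi>, \<chi> a b. sqrt (real l - 2) * of_bool (blk a \<noteq> blk b) * inner (column a X) (column b \<xi>))"

lemma linear_avg_embed: "linear (avg_embed X)"
  unfolding avg_embed_def
  by (rule linearI) (simp_all add: vec_eq_iff inner_add_right algebra_simps)

lemma norm_avg_embed: "(norm (avg_embed X \<xi>))\<^sup>2 = avg_form X \<xi>"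
proof -
  have norm_entries: "(norm M)\<^sup>2 = (\<Sum>a\<in>UNIV. \<Sum>b\<in>UNIV. (M $ a $ b)\<^sup>2)" for M :: "real^'p^'p"
    unfolding power2_norm_eq_inner by (simp add: inner_vec_def power2_eq_square)
  have "(norm (\<chi> a b. sqrt (real l - 2) * of_bool (blk a \<noteq> blk b) * inner (column a X) (column b \<xi>)))\<^sup>2
    = (real l - 2) * cross X \<xi>"
    using l_ge_2 unfolding norm_entries cross_def sum_distrib_left
    by (intro sum.cong refl) (simp add: power_mult_distrib)
  then show ?thesis
    using avg_form_nonneg[of X \<xi>] by (simp add: avg_embed_def avg_form_def norm_Pair)
qed

text \<open>Bessel's inequality bounds \<open>avg_form X \<xi>\<close> by (l - 1) |\<xi>|^2. The
  root of l - 1 is enlarged to l - 1: then 1 + 2 (l - 1) is the 2 l - 1 in the admissible range of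
  \<lambda>.\<close>

lemma norm_avg_embed_le:
  assumes "X \<in> stiefel"
  shows "norm (avg_embed X \<xi>) \<le> (real l - 1) * norm \<xi>"
proof (rule power2_le_imp_le)
  have "cross X \<xi> \<le> (\<Sum>a\<in>UNIV. \<Sum>b\<in>UNIV. (inner (column a X) (column b \<xi>))\<^sup>2)"
    unfolding cross_def by (intro sum_mono) simp
  also have "\<dots> = (\<Sum>b\<in>UNIV. \<Sum>a\<in>UNIV. (inner (column b \<xi>) (column a X))\<^sup>2)"
    by (subst sum.swap) (simp add: inner_commute)
  also have "\<dots> \<le> (norm \<xi>)\<^sup>2" by (rule sum_sq_inner_stiefel_le[OF assms])
  finally have "(real l - 2) * cross X \<xi> \<le> (real l - 2) * (norm \<xi>)\<^sup>2"
    using l_ge_2 by (intro mult_left_mono) auto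
  then have "avg_form X \<xi> \<le> (real l - 1) * (norm \<xi>)\<^sup>2" by (simp add: avg_form_def algebra_simps)
  also have "\<dots> \<le> (real l - 1)\<^sup>2 * (norm \<xi>)\<^sup>2"
    using l_ge_2 by (intro mult_right_mono) (auto simp: power2_eq_square)
  finally show "(norm (avg_embed X \<xi>))\<^sup>2 \<le> ((real l - 1) * norm \<xi>)\<^sup>2"
    by (simp add: norm_avg_embed power_mult_distrib)
qed (use l_ge_2 in auto)

end

section \<open>Compactness of the Stiefel manifold\<close>

lemma closed_stiefel: "closed (stiefel :: (real^'p^'n) set)"
proof -
  have "stiefel = {X :: real^'p^'n. \<forall>a b. inner (column a X) (column b X) = (if a = b then 1 else 0)}"
    by (auto simp: stiefel_columns)
  also have "closed \<dots>"
    by (intro closed_Collect_all closed_Collect_eq continuous_intros)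
  finally show ?thesis .
qed

lemma norm_stiefel: "X \<in> stiefel \<Longrightarrow> (norm (X :: real^'p^'n))\<^sup>2 = real CARD('p)"
  by (simp add: norm_columns power2_norm_eq_inner stiefel_inner)

lemma compact_stiefel: "compact (stiefel :: (real^'p^'n) set)"
proof -
  have "norm X \<le> sqrt (real CARD('p))" if "X \<in> stiefel" for X :: "real^'p^'n"
    using norm_stiefel[OF that] by (metis norm_ge_zero order_refl real_sqrt_abs abs_of_nonneg)
  then show ?thesis
    using closed_stiefel by (auto simp: compact_eq_bounded_closed intro: boundedI)
qed

text \<open>Lets a comparison of first order, already divided by t, be evaluated in the limit
  without differentiating f.\<close>

lemma isCont_nonneg_at_0:
  fixes \<phi> :: "real \<Rightarrow> real"
  assumes "isCont \<phi> 0" and "\<And>t. 0 < t \<Longrightarrow> t \<le> 1 \<Longrightarrow> 0 \<le> \<phi> t"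
  shows "0 \<le> \<phi> 0"
proof (rule tendsto_lowerbound)
  show "(\<phi> \<longlongrightarrow> \<phi> 0) (at_right 0)"
    using assms(1) unfolding isCont_def by (rule filterlim_mono) (auto simp: at_le)
  have "eventually (\<lambda>t::real. 0 < t \<and> t \<le> 1) (at_right 0)"
    using eventually_at_right_less[of 0] eventually_at_right_real[of 0 1] by (auto elim: eventually_elim2)
  then show "eventually (\<lambda>t. 0 \<le> \<phi> t) (at_right 0)"
    by (rule eventually_mono) (use assms(2) in auto)
qed simp

section \<open>Clarke subgradients of weakly convex functions\<close>

lemma clarke_subdiff_inner_le:
  fixes f :: "'a::real_inner \<Rightarrow> real"
  assumes g: "g \<in> clarke_subdiff f x"
    and ev: "eventually (\<lambda>(y, t::real). (f (y + t *\<^sub>R v) - f y) / t \<le> B) (nhds x \<times>\<^sub>F at_right 0)"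
  shows "inner g v \<le> B"
proof -
  have "ereal (inner g v) \<le> clarke_dderiv f x v"
    using g by (simp add: clarke_subdiff_def)
  also have "\<dots> \<le> ereal B"
    unfolding clarke_dderiv_def
    by (rule Limsup_bounded) (use ev in \<open>auto elim!: eventually_mono\<close>)
  finally show ?thesis by simp
qed

lemma eventually_nhds_prod_at_right:
  fixes x :: "'a::real_normed_vector"
  assumes r: "0 < r" and P: "\<And>y t. norm (y - x) < r \<Longrightarrow> 0 < t \<Longrightarrow> t < r \<Longrightarrow> P y t"
  shows "eventually (\<lambda>(y, t::real). P y t) (nhds x \<times>\<^sub>F at_right 0)"
  unfolding eventually_prod_filter
proof (intro exI conjI allI impI)
  show "eventually (\<lambda>y. norm (y - x) < r) (nhds x)"
    using r by (auto simp: eventually_nhds_metric dist_norm)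
  show "eventually (\<lambda>t. 0 < t \<and> t < r) (at_right (0::real))"
    using eventually_at_right_real[OF r] by (auto elim: eventually_mono)
qed (use P in auto)

text \<open>The direction v = g turns the Lipschitz bound on the difference quotients into |g|^2
  \<le> L |g|.\<close>

lemma clarke_subdiff_norm_le:
  fixes f :: "'a::real_inner \<Rightarrow> real"
  assumes L: "L-lipschitz_on \<Omega> f" and x: "x \<in> interior \<Omega>" and g: "g \<in> clarke_subdiff f x"
  shows "norm g \<le> L"
proof (cases "g = 0")
  case True
  then show ?thesis using lipschitz_on_nonneg[OF L] by simp
next
  case False
  obtain \<epsilon> where \<epsilon>: "\<epsilon> > 0" "ball x \<epsilon> \<subseteq> \<Omega>" using x by (auto simp: mem_interior)
  \<comment> \<open>One half of \<epsilon> is for the base point y, the other for the displacement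
    by t times g.\<close>
  define r where "r = min (\<epsilon>/2) (\<epsilon> / (2 * norm g))"
  have "inner g g \<le> L * norm g"
  proof (rule clarke_subdiff_inner_le[OF g eventually_nhds_prod_at_right])
    show "0 < r" using \<epsilon> False by (simp add: r_def)
    fix y and t :: real assume y: "norm (y - x) < r" and t: "0 < t" "t < r"
    have 1: "y \<in> \<Omega>"
      using \<epsilon> y by (auto simp: r_def dist_norm norm_minus_commute)
    have "norm (t *\<^sub>R g) < \<epsilon>/2"
      using t False by (simp add: r_def field_simps)
    then have "norm (y + t *\<^sub>R g - x) < \<epsilon>"
      using norm_triangle_ineq[of "y - x" "t *\<^sub>R g"] y by (simp add: r_def algebra_simps)
    then have 2: "y + t *\<^sub>R g \<in> \<Omega>"
      using \<epsilon> by (auto simp: dist_norm norm_minus_commute)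
    have "f (y + t *\<^sub>R g) - f y \<le> L * norm (t *\<^sub>R g)"
      using lipschitz_on_normD[OF L 2 1] by simp
    then show "(f (y + t *\<^sub>R g) - f y) / t \<le> L * norm g"
      using t by (simp add: field_simps)
  qed
  then have "norm g * norm g \<le> L * norm g" by (simp add: power2_norm_eq_inner flip: power2_eq_square)
  then show ?thesis using False by simp
qed

lemma weakly_convex_onD:
  fixes f :: "'a::real_inner \<Rightarrow> real"
  assumes f: "weakly_convex_on \<tau> \<Omega> f" and "x \<in> \<Omega>" "y \<in> \<Omega>" and t: "0 \<le> t" "t \<le> 1"
  shows "f (x + t *\<^sub>R (y - x)) \<le> (1 - t) * f x + t * f y + \<tau> / 2 * (t * (1 - t) * (norm (y - x))\<^sup>2)"
proof -
  have "f ((1 - t) *\<^sub>R x + t *\<^sub>R y) + \<tau> / 2 * (norm ((1 - t) *\<^sub>R x + t *\<^sub>R y))\<^sup>2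
     \<le> (1 - t) * (f x + \<tau> / 2 * (norm x)\<^sup>2) + t * (f y + \<tau> / 2 * (norm y)\<^sup>2)"
    using f assms convex_onD[of \<Omega> "\<lambda>x. f x + \<tau> / 2 * (norm x)\<^sup>2" t x y]
    by (simp add: weakly_convex_on_def)
  moreover have sq: "(norm ((1 - t) *\<^sub>R x + t *\<^sub>R y))\<^sup>2 = (1 - t) * (norm x)\<^sup>2 + t * (norm y)\<^sup>2 - t * (1 - t) * (norm (y - x))\<^sup>2"
    unfolding power2_norm_eq_inner
    by (simp add: inner_add inner_diff inner_commute power2_eq_square algebra_simps)
  ultimately have "f ((1 - t) *\<^sub>R x + t *\<^sub>R y) \<le> (1 - t) * f x + t * f y + \<tau> / 2 * (t * (1 - t) * (norm (y - x))\<^sup>2)"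
    unfolding sq by (simp add: field_simps)
  moreover have "(1 - t) *\<^sub>R x + t *\<^sub>R y = x + t *\<^sub>R (y - x)" by (simp add: algebra_simps)
  ultimately show ?thesis by simp
qed

text \<open>The Clarke derivative moves the base point, so convexity is used on the segment from a
  nearby z to its translate w = z + (y - x), whose direction is exactly y - x. Lipschitz continuity
  then brings f z and f w back to f x and f y.\<close>

lemma clarke_subgradient_inequality:
  fixes f :: "'a::real_inner \<Rightarrow> real"
  assumes L: "L-lipschitz_on \<Omega> f" and f: "weakly_convex_on \<tau> \<Omega> f" and \<tau>: "0 \<le> \<tau>"
    and x: "x \<in> interior \<Omega>" and y: "y \<in> interior \<Omega>" and g: "g \<in> clarke_subdiff f x"
  shows "inner g (y - x) \<le> f y - f x + \<tau> / 2 * (norm (y - x))\<^sup>2"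
proof (rule field_le_epsilon)
  fix \<epsilon> :: real assume \<epsilon>: "\<epsilon> > 0"
  obtain \<rho> where \<rho>: "\<rho> > 0" "ball x \<rho> \<subseteq> \<Omega>" using x by (auto simp: mem_interior)
  obtain \<sigma> where \<sigma>: "\<sigma> > 0" "ball y \<sigma> \<subseteq> \<Omega>" using y by (auto simp: mem_interior)
  have L0: "0 \<le> L" by (rule lipschitz_on_nonneg[OF L])
  \<comment> \<open>The 1 keeps t in the unit interval, \<rho> and \<sigma> keep z and w in
    \<Omega>, and the quotient makes 2 L r \<le> \<epsilon>, also when L = 0.\<close>
  define r where "r = min (min 1 (min \<rho> \<sigma>)) (\<epsilon> / (2 * (L + 1)))"
  show "inner g (y - x) \<le> f y - f x + \<tau> / 2 * (norm (y - x))\<^sup>2 + \<epsilon>"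
  proof (rule clarke_subdiff_inner_le[OF g eventually_nhds_prod_at_right])
    show "0 < r" using \<epsilon> \<rho> \<sigma> L0 by (simp add: r_def)
    fix z and t :: real assume z: "norm (z - x) < r" and t: "0 < t" "t < r"
    define w where "w = z + (y - x)"
    have z\<Omega>: "z \<in> \<Omega>" using z \<rho> by (auto simp: r_def dist_norm norm_minus_commute)
    have wy: "norm (w - y) = norm (z - x)" by (simp add: w_def algebra_simps)
    then have w\<Omega>: "w \<in> \<Omega>" using z \<sigma> by (auto simp: r_def dist_norm norm_minus_commute)
    have x\<Omega>: "x \<in> \<Omega>" and y\<Omega>: "y \<in> \<Omega>" using x y interior_subset by auto
    have t1: "t \<le> 1" using t by (simp add: r_def)
    have "f (z + t *\<^sub>R (w - z)) \<le> (1 - t) * f z + t * f w + \<tau> / 2 * (t * (1 - t) * (norm (w - z))\<^sup>2)"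
      using t t1 by (intro weakly_convex_onD[OF f z\<Omega> w\<Omega>]) auto
    moreover have "\<tau> / 2 * (t * (1 - t) * (norm (w - z))\<^sup>2) \<le> \<tau> / 2 * (t * 1 * (norm (w - z))\<^sup>2)"
      using t \<tau> by (intro mult_left_mono mult_right_mono) auto
    moreover have "w - z = y - x" by (simp add: w_def)
    ultimately have "f (z + t *\<^sub>R (y - x)) - f z \<le> t * (f w - f z + \<tau> / 2 * (norm (y - x))\<^sup>2)"
      by (simp add: algebra_simps)
    then have "(f (z + t *\<^sub>R (y - x)) - f z) / t \<le> f w - f z + \<tau> / 2 * (norm (y - x))\<^sup>2"
      using t by (simp add: field_simps)
    moreover have "f w - f y \<le> L * r"
    proof -
      have "f w - f y \<le> L * norm (w - y)" using lipschitz_on_normD[OF L w\<Omega> y\<Omega>] by simp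
      also have "\<dots> \<le> L * r" using wy z L0 by (intro mult_left_mono) auto
      finally show ?thesis .
    qed
    moreover have "f x - f z \<le> L * r"
    proof -
      have "f x - f z \<le> L * norm (x - z)" using lipschitz_on_normD[OF L x\<Omega> z\<Omega>] by simp
      also have "\<dots> \<le> L * r" using z L0 by (intro mult_left_mono) (auto simp: norm_minus_commute)
      finally show ?thesis .
    qed
    moreover have "2 * (L * r) \<le> \<epsilon>"
    proof -
      have "L * r \<le> L * (\<epsilon> / (2 * (L + 1)))" using L0 by (intro mult_left_mono) (auto simp: r_def)
      also have "\<dots> \<le> \<epsilon> / 2" using L0 \<epsilon> by (simp add: field_simps)
      finally show ?thesis by simp
    qed
    ultimately show "(f (z + t *\<^sub>R (y - x)) - f z) / t \<le> f y - f x + \<tau> / 2 * (norm (y - x))\<^sup>2 + \<epsilon>"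
      by linarith
  qed
qed

section \<open>The proximal map and the Moreau envelope\<close>

locale stiefel_prox = column_blocks \<CC> l
  for \<CC> :: "nat \<Rightarrow> 'p::finite set" and l :: nat +
  fixes f :: "real^'p^'n \<Rightarrow> real" and \<Omega> :: "(real^'p^'n) set" and \<tau> L lam :: real
  assumes \<tau>: "0 \<le> \<tau>" and L: "0 < L" and convex_\<Omega>: "convex \<Omega>" and stiefel_\<Omega>: "stiefel \<subseteq> interior \<Omega>"
    and weakly_convex: "weakly_convex_on \<tau> \<Omega> f" and lipschitz: "L-lipschitz_on \<Omega> f"
    and lam: "0 < lam" "lam < real l / (2 * (\<tau> + (2 * real l - 1) * L))"
begin

lemma stiefel_in_\<Omega>: "X \<in> stiefel \<Longrightarrow> X \<in> \<Omega>"
  using stiefel_\<Omega> interior_subset by blast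

lemma lam_bound: "\<tau> + (2 * real l - 1) * L < real l / (2 * lam)"
proof -
  have "0 < \<tau> + (2 * real l - 1) * L" using \<tau> L l_ge_2 by (intro add_nonneg_pos mult_pos_pos) auto
  then show ?thesis using lam by (simp add: field_simps)
qed

lemma continuous_on_f: "continuous_on stiefel f"
  by (rule continuous_on_subset[OF lipschitz_on_continuous_on[OF lipschitz]]) (use stiefel_in_\<Omega> in auto)

text \<open>The coefficient is \<open>1 / (2 * lam)\<close> times the l / 2 of the inverse operator.
  This explicit form is visibly continuous in both arguments jointly.\<close>

definition \<Phi> :: "real^'p^'n \<Rightarrow> real^'p^'n \<Rightarrow> real" where
  "\<Phi> X Y = f Y + real l / (4 * lam) * avg_form X (Y - X)"

lemma prox_objective_eq: "X \<in> stiefel \<Longrightarrow> prox_objective f \<CC> l lam X Y = \<Phi> X Y"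
  by (simp add: prox_objective_def \<Phi>_def avg_inv_norm_sq)

lemma continuous_on_\<Phi>: "continuous_on (stiefel \<times> stiefel) (\<lambda>z. \<Phi> (fst z) (snd z))"
  unfolding \<Phi>_def avg_form_def cross_def
  by (intro continuous_intros continuous_on_compose2[OF continuous_on_f]) auto

lemma continuous_on_\<Phi>_right: "X \<in> stiefel \<Longrightarrow> continuous_on stiefel (\<Phi> X)"
  using continuous_on_compose2[OF continuous_on_\<Phi>, of stiefel "\<lambda>Y. (X, Y)"]
    continuous_on_Pair[OF continuous_on_const continuous_on_id]
  by auto

lemma continuous_on_\<Phi>_left: "Y \<in> stiefel \<Longrightarrow> continuous_on stiefel (\<lambda>X. \<Phi> X Y)"
  using continuous_on_compose2[OF continuous_on_\<Phi>, of stiefel "\<lambda>X. (X, Y)"]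
    continuous_on_Pair[OF continuous_on_id continuous_on_const]
  by auto

lemma prox_map:
  assumes X: "X \<in> stiefel"
  shows prox_map_in: "prox_map f \<CC> l lam X \<in> stiefel"
    and prox_map_le: "Y \<in> stiefel \<Longrightarrow> \<Phi> X (prox_map f \<CC> l lam X) \<le> \<Phi> X Y"
proof -
  obtain Y0 where Y0: "Y0 \<in> stiefel" "\<And>Y. Y \<in> stiefel \<Longrightarrow> \<Phi> X Y0 \<le> \<Phi> X Y"
    using continuous_attains_inf[OF compact_stiefel _ continuous_on_\<Phi>_right[OF X]] X by auto
  have "is_arg_min (prox_objective f \<CC> l lam X) (\<lambda>Y. Y \<in> stiefel) (prox_map f \<CC> l lam X)"
    unfolding prox_map_def arg_min_on_def arg_min_def
    by (rule someI[of _ Y0]) (use Y0 X in \<open>auto simp: is_arg_min_linorder prox_objective_eq\<close>)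
  then show "prox_map f \<CC> l lam X \<in> stiefel"
    "Y \<in> stiefel \<Longrightarrow> \<Phi> X (prox_map f \<CC> l lam X) \<le> \<Phi> X Y"
    using X by (auto simp: is_arg_min_linorder prox_objective_eq)
qed

lemma moreau_env_eq:
  assumes X: "X \<in> stiefel"
  shows "moreau_env f \<CC> l lam X = \<Phi> X (prox_map f \<CC> l lam X)"
  unfolding moreau_env_def
  by (rule cInf_eq_minimum) (use X prox_map[OF X] in \<open>auto simp: prox_objective_eq\<close>)

lemma moreau_env_le:
  assumes "X \<in> stiefel" "Y \<in> stiefel"
  shows "moreau_env f \<CC> l lam X \<le> \<Phi> X Y"
  using assms by (simp add: moreau_env_eq prox_map_le)

text \<open>The quadratic term is at most f X - f Y, hence at most L |Y - X|, and |Y - X| is at most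
  the embedded norm; one factor of that norm cancels.\<close>

lemma minimizer_close:
  assumes X: "X \<in> stiefel" and Y: "Y \<in> stiefel" and le: "\<Phi> X Y \<le> \<Phi> X X"
  shows "norm (avg_embed X (Y - X)) \<le> 4 * lam * L / real l"
proof (cases "norm (avg_embed X (Y - X)) = 0")
  case True
  then show ?thesis using lam L by simp
next
  case False
  let ?n = "norm (avg_embed X (Y - X))"
  have "avg_form X 0 = 0" by (simp add: avg_form_def cross_def)
  then have "real l / (4 * lam) * ?n\<^sup>2 \<le> f X - f Y"
    using le by (simp add: \<Phi>_def norm_avg_embed)
  also have "\<dots> \<le> L * norm (Y - X)"
    using lipschitz_on_normD[OF lipschitz stiefel_in_\<Omega>[OF X] stiefel_in_\<Omega>[OF Y]] by (simp add: norm_minus_commute)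
  also have "\<dots> \<le> L * ?n"
    using L norm_le_avg_form[of "Y - X" X] unfolding norm_avg_embed[symmetric]
    by (intro mult_left_mono) (auto intro: power2_le_imp_le)
  finally have "(real l / (4 * lam) * ?n) * ?n \<le> L * ?n" by (simp add: power2_eq_square mult.assoc)
  then have "real l / (4 * lam) * ?n \<le> L" using False by (simp only: mult_le_cancel_right) simp
  then show ?thesis using lam l_ge_2 by (simp add: field_simps)
qed

text \<open>The range of \<lambda> makes the radius 4 \<lambda> L / l at most 2 / (2 l - 1), the
  size that \<open>step_error_bound\<close> asks of d and of the cross term.\<close>

lemma prox_small:
  assumes X: "X \<in> stiefel" and Y: "Y \<in> stiefel" and le: "\<Phi> X Y \<le> \<Phi> X X"
  shows "avg_form X (Y - X) \<le> (2 / (2 * real l - 1))\<^sup>2"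
proof -
  have "(2 * real l - 1) * L < real l / (2 * lam)" using lam_bound \<tau> by simp
  then have "4 * lam * L / real l \<le> 2 / (2 * real l - 1)"
    using lam l_ge_2 by (simp add: field_simps)
  then have "norm (avg_embed X (Y - X)) \<le> 2 / (2 * real l - 1)"
    using minimizer_close[OF assms] by simp
  then have "(norm (avg_embed X (Y - X)))\<^sup>2 \<le> (2 / (2 * real l - 1))\<^sup>2"
    by (intro power_mono) auto
  then show ?thesis by (simp add: norm_avg_embed)
qed

text \<open>Compare a minimizer \<open>Y1\<close> with the retraction of \<open>Y1 + t \<xi>\<close>, where \<open>\<xi> = E + 1/2 Y1 E\<^sup>T E\<close> is the tangential
  part of \<open>E = Y2 - Y1\<close>. The strong convexity of the objective along the chord beats the Lipschitz
  cost \<open>(2 l - 1) L |E|\<^sup>2 / 2\<close> of leaving the chord.\<close>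

lemma minimizer_unique:
  assumes X: "X \<in> stiefel" and Y1: "Y1 \<in> stiefel" and Y2: "Y2 \<in> stiefel"
    and min1: "\<And>Y. Y \<in> stiefel \<Longrightarrow> \<Phi> X Y1 \<le> \<Phi> X Y" and min2: "\<And>Y. Y \<in> stiefel \<Longrightarrow> \<Phi> X Y2 \<le> \<Phi> X Y"
  shows "Y1 = Y2"
proof (rule ccontr)
  assume "Y1 \<noteq> Y2"
  define E where "E = Y2 - Y1"
  have E0: "norm E > 0" using \<open>Y1 \<noteq> Y2\<close> by (simp add: E_def)
  define c where "c = real l / (4 * lam)"
  have c0: "0 \<le> c" using lam by (simp add: c_def)
  let ?J = "avg_embed X"
  have l: "real l - 1 \<ge> 0" using l_ge_2 by simp
  \<comment> \<open>E fails to be tangent at \<open>Y1\<close> by the symmetric part - E^T E / 2 of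
    Y1^T E; adding U cancels it.\<close>
  define U :: "real^'p^'n" where "U = of_columns (\<lambda>b. (\<Sum>a\<in>UNIV. (inner (column a E) (column b E) / 2) *\<^sub>R column a Y1))"
  have U: "column b U = (\<Sum>a\<in>UNIV. (inner (column a E) (column b E) / 2) *\<^sub>R column a Y1)" for b
    by (simp add: U_def)
  have normU: "norm U \<le> (norm E)\<^sup>2 / 2"
  proof (rule power2_le_imp_le)
    have "(norm U)\<^sup>2 = (\<Sum>b\<in>UNIV. \<Sum>a\<in>UNIV. (inner (column a E) (column b E) / 2)\<^sup>2)"
      unfolding norm_columns U norm_sum_orthonormal[OF stiefel_inner[OF Y1]] ..
    also have "\<dots> = (\<Sum>a\<in>UNIV. \<Sum>b\<in>UNIV. (inner (column a E) (column b E))\<^sup>2) / 4"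
      by (subst sum.swap) (simp add: power_divide sum_divide_distrib)
    also have "\<dots> \<le> ((norm E)\<^sup>2 / 2)\<^sup>2"
      using sum_sq_inner_le[of E E] by (simp add: power_divide power2_eq_square)
    finally show "(norm U)\<^sup>2 \<le> ((norm E)\<^sup>2 / 2)\<^sup>2" .
  qed simp
  define \<xi> where "\<xi> = E + U"
  have tangent: "inner (column a Y1) (column b \<xi>) + inner (column a \<xi>) (column b Y1) = 0" for a b
  proof -
    have YU: "inner (column a Y1) (column b U) = inner (column a E) (column b E) / 2" for a b
      unfolding U inner_commute[of "column a Y1"] by (rule inner_sum_orthonormal[OF stiefel_inner[OF Y1]])
    have "inner (column a U) (column b Y1) = inner (column a E) (column b E) / 2"
      using YU[of b a] by (simp add: inner_commute)
    then show ?thesis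
      using stiefel_diff_inner[OF Y1 Y2, of a b] YU[of a b] unfolding E_def[symmetric]
      by (simp add: \<xi>_def inner_add inner_commute[of "column b Y1"])
  qed
  \<comment> \<open>\<open>t * H t\<close> bounds the distance of the retracted point Z from the
    chord point V: |E|^2 / 2 comes from U, the other term from the retraction.\<close>
  define H where "H t = (norm E)\<^sup>2 / 2 + t * (norm \<xi>)\<^sup>2" for t
  have H0: "0 \<le> H t" if "0 < t" for t using that by (simp add: H_def)
  \<comment> \<open>What remains of the comparison of \<open>Y1\<close> with Z after division by t:
    nonnegative for t in (0, 1] since \<open>Y1\<close> is minimal, but negative at 0 by the range
    of \<lambda>.\<close>
  define \<phi> where "\<phi> = (\<lambda>t. (L + 2 * c * (4 * lam * L / real l) * (real l - 1)) * H t
     + c * (2 * t * norm (?J E) * (real l - 1) * H t + (real l - 1)\<^sup>2 * t * (H t)\<^sup>2)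
     - (c - \<tau> / 2) * (1 - t) * (norm E)\<^sup>2)"
  have "0 \<le> \<phi> 0"
  proof (rule isCont_nonneg_at_0)
    show "isCont \<phi> 0" unfolding \<phi>_def H_def by (intro continuous_intros)
    fix t :: real assume t: "0 < t" "t \<le> 1"
    \<comment> \<open>The minus sign is there because \<open>cayley_retraction\<close> approximates
      x - B.\<close>
    define B where "B a = - t *\<^sub>R column a \<xi>" for a
    have skew: "inner (column a Y1) (B b) + inner (B a) (column b Y1) = 0" for a b
    proof -
      have "inner (column a Y1) (B b) + inner (B a) (column b Y1)
        = - t * (inner (column a Y1) (column b \<xi>) + inner (column a \<xi>) (column b Y1))"
        by (simp add: B_def algebra_simps)
      then show ?thesis by (simp add: tangent)
    qed
    obtain w where w: "\<And>a b. inner (w a) (w b) = (if a = b then 1 else 0)"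
      "(\<Sum>a\<in>UNIV. (norm (w a - column a Y1 + B a))\<^sup>2) \<le> 1/2 * (\<Sum>a\<in>UNIV. (norm (B a))\<^sup>2)\<^sup>2"
      using cayley_retraction[OF stiefel_inner[OF Y1] _ skew, of UNIV] by auto
    define Z :: "real^'p^'n" where "Z = of_columns w"
    have Z: "column a Z = w a" for a by (simp add: Z_def)
    have ZS: "Z \<in> stiefel" using w(1) by (simp add: stiefel_columns Z)
    have Zr: "norm (Z - Y1 - t *\<^sub>R \<xi>) \<le> t\<^sup>2 * (norm \<xi>)\<^sup>2"
    proof (rule power2_le_imp_le)
      have "(norm (Z - Y1 - t *\<^sub>R \<xi>))\<^sup>2 \<le> 1/2 * (t\<^sup>2 * (norm \<xi>)\<^sup>2)\<^sup>2"
        using w(2) by (simp add: B_def norm_columns Z power_mult_distrib sum_distrib_left)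
      also have "\<dots> \<le> (t\<^sup>2 * (norm \<xi>)\<^sup>2)\<^sup>2" by simp
      finally show "(norm (Z - Y1 - t *\<^sub>R \<xi>))\<^sup>2 \<le> (t\<^sup>2 * (norm \<xi>)\<^sup>2)\<^sup>2" .
    qed simp
    define V where "V = Y1 + t *\<^sub>R E"
    have V\<Omega>: "V \<in> \<Omega>"
    proof -
      have "V = (1 - t) *\<^sub>R Y1 + t *\<^sub>R Y2" by (simp add: V_def E_def algebra_simps)
      then show ?thesis using convexD[OF convex_\<Omega> stiefel_in_\<Omega>[OF Y1] stiefel_in_\<Omega>[OF Y2], of "1 - t" t] t by simp
    qed
    have ZV: "norm (Z - V) \<le> t * H t"
    proof -
      have "Z - V = (Z - Y1 - t *\<^sub>R \<xi>) + t *\<^sub>R U" by (simp add: V_def \<xi>_def algebra_simps)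
      then have "norm (Z - V) \<le> norm (Z - Y1 - t *\<^sub>R \<xi>) + norm (t *\<^sub>R U)" by (simp only: norm_triangle_ineq)
      also have "\<dots> \<le> t\<^sup>2 * (norm \<xi>)\<^sup>2 + t * ((norm E)\<^sup>2 / 2)"
        using Zr normU t by (intro add_mono) (auto intro: mult_left_mono)
      also have "\<dots> = t * H t" by (simp add: H_def power2_eq_square algebra_simps)
      finally show ?thesis .
    qed
    have fZ: "f Z \<le> f V + L * (t * H t)"
    proof -
      have "f Z - f V \<le> L * norm (Z - V)" using lipschitz_on_normD[OF lipschitz stiefel_in_\<Omega>[OF ZS] V\<Omega>] by simp
      also have "\<dots> \<le> L * (t * H t)" using ZV L by (intro mult_left_mono) auto
      finally show ?thesis by simp
    qed
    have fV: "f V \<le> (1 - t) * f Y1 + t * f Y2 + \<tau> / 2 * (t * (1 - t) * (norm E)\<^sup>2)"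
      unfolding V_def E_def using t
      by (intro weakly_convex_onD[OF weakly_convex] stiefel_in_\<Omega> Y1 Y2) auto
    have JV: "(norm (?J (V - X)))\<^sup>2 \<le> (1 - t) * (norm (?J (Y1 - X)))\<^sup>2 + t * (norm (?J (Y2 - X)))\<^sup>2 - t * (1 - t) * (norm E)\<^sup>2"
    proof -
      have "?J (V - X) = ?J (Y1 - X) + t *\<^sub>R ?J E"
        unfolding linear_cmul[OF linear_avg_embed, symmetric] linear_add[OF linear_avg_embed, symmetric]
        by (simp add: V_def algebra_simps)
      moreover have "?J (Y2 - X) = ?J (Y1 - X) + ?J E"
        unfolding linear_add[OF linear_avg_embed, symmetric] by (simp add: E_def)
      ultimately have "(norm (?J (V - X)))\<^sup>2
        = (1 - t) * (norm (?J (Y1 - X)))\<^sup>2 + t * (norm (?J (Y2 - X)))\<^sup>2 - t * (1 - t) * (norm (?J E))\<^sup>2"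
        unfolding power2_norm_eq_inner
        by (simp add: inner_add inner_commute power2_eq_square algebra_simps)
      moreover have "t * (1 - t) * (norm E)\<^sup>2 \<le> t * (1 - t) * (norm (?J E))\<^sup>2"
        using t norm_le_avg_form[of E X] by (intro mult_left_mono) (auto simp: norm_avg_embed)
      ultimately show ?thesis by simp
    qed
    have JZ: "(norm (?J (Z - X)))\<^sup>2 \<le> (norm (?J (V - X)))\<^sup>2
      + 2 * (4 * lam * L / real l + t * norm (?J E)) * ((real l - 1) * (t * H t)) + ((real l - 1) * (t * H t))\<^sup>2"
    proof -
      let ?q = "(real l - 1) * (t * H t)"
      have q: "norm (?J (Z - V)) \<le> ?q"
        using norm_avg_embed_le[OF X, of "Z - V"] ZV l by (meson mult_left_mono order_trans)
      have "?J (Z - X) = ?J (V - X) + ?J (Z - V)"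
        unfolding linear_add[OF linear_avg_embed, symmetric] by simp
      then have "norm (?J (Z - X)) \<le> norm (?J (V - X)) + ?q"
        using norm_triangle_ineq[of "?J (V - X)" "?J (Z - V)"] q by simp
      then have "(norm (?J (Z - X)))\<^sup>2 \<le> (norm (?J (V - X)) + ?q)\<^sup>2" by (intro power_mono) auto
      also have "\<dots> = (norm (?J (V - X)))\<^sup>2 + 2 * norm (?J (V - X)) * ?q + ?q\<^sup>2" by (simp add: power2_sum)
      also have "2 * norm (?J (V - X)) * ?q \<le> 2 * (4 * lam * L / real l + t * norm (?J E)) * ?q"
      proof -
        have "?J (V - X) = ?J (Y1 - X) + t *\<^sub>R ?J E"
          unfolding linear_cmul[OF linear_avg_embed, symmetric] linear_add[OF linear_avg_embed, symmetric]
          by (simp add: V_def algebra_simps)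
        then have "norm (?J (V - X)) \<le> norm (?J (Y1 - X)) + t * norm (?J E)"
          using norm_triangle_ineq[of "?J (Y1 - X)" "t *\<^sub>R ?J E"] t by simp
        \<comment> \<open>Closeness of \<open>Y1\<close> to X makes the first-order cost of the
          quadratic term 2 c * 4 \<lambda> L / l = 2 L, which does not depend on \<lambda>.\<close>
        also have "norm (?J (Y1 - X)) \<le> 4 * lam * L / real l"
          by (rule minimizer_close[OF X Y1 min1[OF X]])
        finally show ?thesis
          using t l H0[OF t(1)] by (intro mult_right_mono) auto
      qed
      finally show ?thesis by simp
    qed
    have "f Y1 + c * (norm (?J (Y1 - X)))\<^sup>2 \<le> f Z + c * (norm (?J (Z - X)))\<^sup>2"
      using min1[OF ZS] by (simp add: \<Phi>_def norm_avg_embed c_def)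
    also have "\<dots> \<le> ((1 - t) * f Y1 + t * f Y2 + \<tau> / 2 * (t * (1 - t) * (norm E)\<^sup>2) + L * (t * H t))
      + c * (((1 - t) * (norm (?J (Y1 - X)))\<^sup>2 + t * (norm (?J (Y2 - X)))\<^sup>2 - t * (1 - t) * (norm E)\<^sup>2)
        + 2 * (4 * lam * L / real l + t * norm (?J E)) * ((real l - 1) * (t * H t)) + ((real l - 1) * (t * H t))\<^sup>2)"
      using fZ fV JV JZ c0 by (intro add_mono mult_left_mono) auto
    also have "\<dots> = (1 - t) * (f Y1 + c * (norm (?J (Y1 - X)))\<^sup>2) + t * (f Y2 + c * (norm (?J (Y2 - X)))\<^sup>2) + t * \<phi> t"
      by (simp add: \<phi>_def power2_eq_square algebra_simps diff_divide_distrib)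
    also have "\<dots> \<le> (1 - t) * (f Y1 + c * (norm (?J (Y1 - X)))\<^sup>2) + t * (f Y1 + c * (norm (?J (Y1 - X)))\<^sup>2) + t * \<phi> t"
    proof -
      have "f Y2 + c * (norm (?J (Y2 - X)))\<^sup>2 \<le> f Y1 + c * (norm (?J (Y1 - X)))\<^sup>2"
        using min2[OF Y1] by (simp add: \<Phi>_def norm_avg_embed c_def)
      then show ?thesis using t by (intro add_right_mono add_left_mono mult_left_mono) auto
    qed
    finally have "0 \<le> t * \<phi> t" by (simp add: algebra_simps)
    then show "0 \<le> \<phi> t" using t by (simp add: zero_le_mult_iff)
  qed
  moreover have "\<phi> 0 < 0"
  proof -
    have "2 * c * (4 * lam * L / real l) = 2 * L" using lam l_ge_2 by (simp add: c_def)
    then have "\<phi> 0 = (\<tau> + (2 * real l - 1) * L - 2 * c) * ((norm E)\<^sup>2 / 2)"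
      by (simp add: \<phi>_def H_def field_simps)
    also have "\<dots> < 0" using lam_bound E0 by (intro mult_neg_pos) (auto simp: c_def)
    finally show ?thesis .
  qed
  ultimately show False by simp
qed

text \<open>A map into a compact set is continuous if its graph is closed. The pairs (X, Y) with Y
  minimal for X are cut out by closed conditions; by uniqueness they form the graph.\<close>

lemma continuous_on_prox_map: "continuous_on stiefel (prox_map f \<CC> l lam)"
proof (rule continuous_from_closed_graph[OF compact_stiefel])
  show "prox_map f \<CC> l lam \<in> stiefel \<rightarrow> stiefel" using prox_map_in by auto
  have "(\<lambda>X. (X, prox_map f \<CC> l lam X)) ` stiefel
    = (\<Inter>Y\<in>stiefel. {z \<in> stiefel \<times> stiefel. \<Phi> (fst z) (snd z) \<le> \<Phi> (fst z) Y}) \<inter> (stiefel \<times> stiefel)"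
  proof (intro set_eqI iffI)
    fix z assume "z \<in> (\<Inter>Y\<in>stiefel. {z \<in> stiefel \<times> stiefel. \<Phi> (fst z) (snd z) \<le> \<Phi> (fst z) Y}) \<inter> (stiefel \<times> stiefel)"
    then have z: "fst z \<in> stiefel" "snd z \<in> stiefel" "\<And>Y. Y \<in> stiefel \<Longrightarrow> \<Phi> (fst z) (snd z) \<le> \<Phi> (fst z) Y"
      by (auto simp: mem_Times_iff)
    have "snd z = prox_map f \<CC> l lam (fst z)"
      by (rule minimizer_unique[OF z(1) z(2) prox_map_in[OF z(1)] z(3) prox_map_le[OF z(1)]])
    then show "z \<in> (\<lambda>X. (X, prox_map f \<CC> l lam X)) ` stiefel"
      using z(1) by (intro image_eqI[of _ _ "fst z"]) (simp_all add: prod_eq_iff)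
  qed (use prox_map in auto)
  also have "closed \<dots>"
  proof (intro closed_Int closed_INT ballI closed_Times closed_stiefel)
    fix Y :: "real^'p^'n" assume Y: "Y \<in> stiefel"
    have "continuous_on (stiefel \<times> stiefel) (\<lambda>z. \<Phi> (fst z) Y :: real)"
      by (rule continuous_on_compose2[OF continuous_on_\<Phi>_left[OF Y]]) (auto intro: continuous_intros)
    then show "closed {z \<in> stiefel \<times> stiefel. \<Phi> (fst z) (snd z) \<le> \<Phi> (fst z) Y}"
      by (intro continuous_on_closed_Collect_le continuous_on_\<Phi> closed_Times closed_stiefel)
  qed
  finally show "closed ((\<lambda>X. (X, prox_map f \<CC> l lam X)) ` stiefel)" .
qed

section \<open>Decrease of the envelope in one step\<close>

definition decrease :: real where
  "decrease = lam / real l * (real l / (2 * lam) - (\<tau> + (2 * real l - 3) * L))"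

lemma decrease_pos: "0 < decrease"
proof -
  have "\<tau> + (2 * real l - 3) * L < \<tau> + (2 * real l - 1) * L" using L by (simp add: algebra_simps)
  then show ?thesis
    using lam_bound lam l_ge_2 unfolding decrease_def by (intro mult_pos_pos) auto
qed

lemma stat_measure_sq:
  assumes "X \<in> stiefel"
  shows "(stat_measure f \<CC> l lam X)\<^sup>2 = real l / (2 * lam\<^sup>2) * avg_form X (prox_map f \<CC> l lam X - X)"
  by (simp add: stat_measure_def power_mult_distrib power_divide avg_inv_norm_sq[OF assms])

lemma moreau_env_update_le:
  assumes X: "X \<in> stiefel" and e: "e \<in> pairs" and C: "C = pair_cols \<CC> e"
    and \<gamma>: "0 \<le> \<gamma>" "(\<gamma> * L)\<^sup>2 * real l \<le> 1" and g: "norm g \<le> L"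
    and Z: "block_update X C (\<gamma> *\<^sub>R tangent_proj X C g) Z"
  shows "moreau_env f \<CC> l lam Z \<le> moreau_env f \<CC> l lam X
    + real l / (4 * lam) * step_bound L \<gamma> X (prox_map f \<CC> l lam X - X) g e"
proof -
  let ?P = "prox_map f \<CC> l lam X"
  have P: "?P \<in> stiefel" by (rule prox_map_in[OF X])
  have tang: "\<gamma> *\<^sub>R tangent_proj X C g \<in> block_tangent X C"
    by (rule subspace_scale[OF subspace_block_tangent tangent_proj_mem[OF X]])
  have "moreau_env f \<CC> l lam Z \<le> \<Phi> Z ?P"
    by (rule moreau_env_le[OF block_update_stiefel[OF X tang Z] P])
  also have "\<dots> \<le> f ?P + real l / (4 * lam) * (avg_form X (?P - X) + step_bound L \<gamma> X (?P - X) g e)"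
    unfolding \<Phi>_def
    using avg_form_update_le[OF X P e C \<gamma>(1) L g \<gamma>(2) Z prox_small[OF X P prox_map_le[OF X X]]] lam
    by (intro add_left_mono mult_left_mono) auto
  also have "\<dots> = moreau_env f \<CC> l lam X + real l / (4 * lam) * step_bound L \<gamma> X (?P - X) g e"
    unfolding moreau_env_eq[OF X] \<Phi>_def by (simp add: distrib_left)
  finally show ?thesis .
qed

text \<open>The subgradient inequality at the proximal point is a hypothesis, so that true
  subgradients and the artificial direction of \<open>virtual_step\<close> are both covered.\<close>

lemma avg_step_bound_le_decrease:
  assumes X: "X \<in> stiefel" and \<gamma>: "0 \<le> \<gamma>" and g: "norm g \<le> L"
    and sub: "inner g (prox_map f \<CC> l lam X - X)
      \<le> f (prox_map f \<CC> l lam X) - f X + \<tau> / 2 * (norm (prox_map f \<CC> l lam X - X))\<^sup>2"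
  shows "real l / (4 * lam) * ((\<Sum>e\<in>pairs. step_bound L \<gamma> X (prox_map f \<CC> l lam X - X) g e) / real (l choose 2))
    \<le> - (decrease * \<gamma> * (stat_measure f \<CC> l lam X)\<^sup>2) + 9 * (\<gamma> * L)\<^sup>2 / (2 * lam)"
proof -
  define P where "P = prox_map f \<CC> l lam X"
  define W where "W = avg_form X (P - X)"
  have PS: "P \<in> stiefel" unfolding P_def by (rule prox_map_in[OF X])
  have l: "real l > 0" using l_ge_2 by simp
  \<comment> \<open>Minimality against X itself: f falls by at least the quadratic term. This is the
    source of l / (2 \<lambda>) in \<open>decrease\<close>.\<close>
  have "\<Phi> X P \<le> \<Phi> X X" unfolding P_def by (rule prox_map_le[OF X X])
  then have "f P - f X \<le> - (real l / (4 * lam) * W)"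
    by (simp add: \<Phi>_def W_def avg_form_def cross_def)
  moreover have "\<tau> / 2 * (norm (P - X))\<^sup>2 \<le> \<tau> / 2 * W"
    using \<tau> norm_le_avg_form[of "P - X" X] unfolding W_def by (intro mult_left_mono) auto
  ultimately have "inner g (P - X) \<le> - (real l / (4 * lam) * W) + \<tau> / 2 * W"
    using sub unfolding P_def[symmetric] by linarith
  then have "4 * \<gamma> / real l * inner g (P - X) \<le> 4 * \<gamma> / real l * (- (real l / (4 * lam) * W) + \<tau> / 2 * W)"
    using \<gamma> l by (intro mult_left_mono) auto
  then have "(\<Sum>e\<in>pairs. step_bound L \<gamma> X (P - X) g e) / real (l choose 2)
    \<le> 4 * \<gamma> / real l * (- (real l / (4 * lam) * W) + \<tau> / 2 * W)
      + 2 * \<gamma> * L / real l * (2 * real l - 3) * W + 18 * (\<gamma> * L)\<^sup>2 / real l"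
    using avg_step_bound_le[OF X PS \<gamma> L g] unfolding W_def by linarith
  then have "real l / (4 * lam) * ((\<Sum>e\<in>pairs. step_bound L \<gamma> X (P - X) g e) / real (l choose 2))
    \<le> real l / (4 * lam) * (4 * \<gamma> / real l * (- (real l / (4 * lam) * W) + \<tau> / 2 * W)
      + 2 * \<gamma> * L / real l * (2 * real l - 3) * W + 18 * (\<gamma> * L)\<^sup>2 / real l)"
    using lam by (intro mult_left_mono) auto
  also have "\<dots> = - (decrease * \<gamma> * (real l / (2 * lam\<^sup>2) * W)) + 9 * (\<gamma> * L)\<^sup>2 / (2 * lam)"
    using lam l by (simp add: decrease_def power2_eq_square divide_simps) (simp add: algebra_simps)
  finally show ?thesis
    unfolding stat_measure_sq[OF X] W_def P_def .
qed

text \<open>The minimum of f on the compact manifold is a lower bound; the real-valued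
  \<open>INF\<close> is meaningful only with one.\<close>

lemma moreau_env_bdd_below: "bdd_below (moreau_env f \<CC> l lam ` stiefel)"
proof (cases "stiefel = ({} :: (real^'p^'n) set)")
  case False
  then obtain Y0 :: "real^'p^'n" where Y0: "\<And>Y. Y \<in> stiefel \<Longrightarrow> f Y0 \<le> f Y"
    using continuous_attains_inf[OF compact_stiefel _ continuous_on_f] by auto
  have "f Y0 \<le> moreau_env f \<CC> l lam X" if X: "X \<in> stiefel" for X
  proof -
    have "0 \<le> real l / (4 * lam) * avg_form X (prox_map f \<CC> l lam X - X)"
      using lam avg_form_nonneg by (intro mult_nonneg_nonneg) auto
    then show ?thesis
      using Y0[OF prox_map_in[OF X]] by (simp add: moreau_env_eq[OF X] \<Phi>_def)
  qed
  then show ?thesis by (rule bdd_belowI2)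
qed simp

lemma moreau_env_ge_Inf: "X \<in> stiefel \<Longrightarrow> (INF Y\<in>stiefel. moreau_env f \<CC> l lam Y) \<le> moreau_env f \<CC> l lam X"
  by (rule cINF_lower[OF moreau_env_bdd_below])

text \<open>The last iterate has no successor, so the decrease at time T comes from an imagined step. It needs
  no subgradient: at the proximal point \<open>X + d\<close>, the direction \<open>- L d / |d|\<close> satisfies the subgradient
  inequality because f is L-Lipschitz.\<close>

lemma virtual_step:
  assumes X: "X \<in> stiefel" and \<gamma>: "0 \<le> \<gamma>" "(\<gamma> * L)\<^sup>2 * real l \<le> 1"
  shows "decrease * \<gamma> * (stat_measure f \<CC> l lam X)\<^sup>2
    \<le> moreau_env f \<CC> l lam X - (INF Y\<in>stiefel. moreau_env f \<CC> l lam Y) + 9 * (\<gamma> * L)\<^sup>2 / (2 * lam)"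
proof -
  define d where "d = prox_map f \<CC> l lam X - X"
  \<comment> \<open>For d = 0 division by zero makes g zero, and
    \<open>inner g d = - L * norm d\<close> still holds.\<close>
  define g where "g = (- L / norm d) *\<^sub>R d"
  have gL: "norm g \<le> L" using L by (simp add: g_def)
  have "inner g d = - L * norm d" by (simp add: g_def power2_eq_square flip: power2_norm_eq_inner)
  also have "\<dots> \<le> f (prox_map f \<CC> l lam X) - f X"
    using lipschitz_on_normD[OF lipschitz stiefel_in_\<Omega>[OF X] stiefel_in_\<Omega>[OF prox_map_in[OF X]]]
    by (simp add: d_def norm_minus_commute)
  also have "\<dots> \<le> f (prox_map f \<CC> l lam X) - f X + \<tau> / 2 * (norm d)\<^sup>2" using \<tau> by simp
  finally have sub: "inner g d \<le> f (prox_map f \<CC> l lam X) - f X + \<tau> / 2 * (norm d)\<^sup>2" .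
  let ?I = "INF Y\<in>stiefel. moreau_env f \<CC> l lam Y" and ?m = "moreau_env f \<CC> l lam X" and ?c = "real l / (4 * lam)"
  \<comment> \<open>Whichever pair is taken, the updated point has envelope at least the infimum;
    summing over all pairs replaces the random draw.\<close>
  have "?I - ?m \<le> ?c * step_bound L \<gamma> X d g e" if e: "e \<in> pairs" for e
  proof -
    obtain Z where Z: "block_update X (pair_cols \<CC> e) (\<gamma> *\<^sub>R tangent_proj X (pair_cols \<CC> e) g) Z"
      using ex_block_update[OF X] by blast
    have "Z \<in> stiefel"
      by (rule block_update_stiefel[OF X _ Z]) (rule subspace_scale[OF subspace_block_tangent tangent_proj_mem[OF X]])
    from moreau_env_ge_Inf[OF this] show ?thesis
      using moreau_env_update_le[OF X e refl \<gamma> gL Z] by (simp add: d_def)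
  qed
  then have "(\<Sum>e\<in>pairs. ?I - ?m) \<le> (\<Sum>e\<in>pairs. ?c * step_bound L \<gamma> X d g e)"
    by (rule sum_mono)
  then have "(?I - ?m) * real (l choose 2) \<le> ?c * (\<Sum>e\<in>pairs. step_bound L \<gamma> X d g e)"
    by (simp add: card_pairs sum_distrib_left mult.commute)
  then have "?I - ?m \<le> ?c * (\<Sum>e\<in>pairs. step_bound L \<gamma> X d g e) / real (l choose 2)"
    by (simp only: pos_le_divide_eq[OF real_choose_2_pos])
  then have "?I - ?m \<le> ?c * ((\<Sum>e\<in>pairs. step_bound L \<gamma> X d g e) / real (l choose 2))" by simp
  also have "\<dots> \<le> - (decrease * \<gamma> * (stat_measure f \<CC> l lam X)\<^sup>2) + 9 * (\<gamma> * L)\<^sup>2 / (2 * lam)"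
    using avg_step_bound_le_decrease[OF X \<gamma>(1) gL] sub unfolding d_def by blast
  finally show ?thesis by simp
qed

lemma continuous_on_moreau_env: "continuous_on stiefel (moreau_env f \<CC> l lam)"
proof -
  have "continuous_on stiefel (\<lambda>X. \<Phi> (fst (X, prox_map f \<CC> l lam X)) (snd (X, prox_map f \<CC> l lam X)))"
    by (rule continuous_on_compose2[OF continuous_on_\<Phi>])
      (auto intro!: continuous_intros continuous_on_prox_map prox_map_in)
  then show ?thesis
    by (rule continuous_on_cong[THEN iffD1, rotated -1]) (simp_all add: moreau_env_eq)
qed

lemma continuous_on_stat_measure_sq: "continuous_on stiefel (\<lambda>X. (stat_measure f \<CC> l lam X)\<^sup>2)"
proof -
  have "continuous_on stiefel (\<lambda>X. real l / (2 * lam\<^sup>2) * avg_form X (prox_map f \<CC> l lam X - X))"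
    unfolding avg_form_def cross_def by (intro continuous_intros continuous_on_prox_map)
  then show ?thesis
    by (rule continuous_on_cong[THEN iffD1, rotated -1]) (simp_all add: stat_measure_sq)
qed

text \<open>Makes the bound for a fixed pair measurable along the iterates, and bounded when its
  arguments stay in a compact set.\<close>

lemma continuous_on_step_bound:
  "continuous_on UNIV (\<lambda>(X, P, g). step_bound L \<gamma> X (P - X) g e)"
  unfolding step_bound_def col_bound_def pair_bound_def skew_part_def case_prod_unfold
  using L by (intro continuous_intros) auto

end

section \<open>Iterates of the algorithm\<close>

locale rssm_prox =
  rssm M F f L \<CC> l \<gamma> T X0 X g e + stiefel_prox \<CC> l f \<Omega> \<tau> L lam
  for M :: "'w measure" and F :: "nat \<Rightarrow> 'w measure"
    and f :: "real^'p^'n \<Rightarrow> real" and L :: real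
    and \<CC> :: "nat \<Rightarrow> 'p set" and l :: nat
    and \<gamma> :: "nat \<Rightarrow> real" and T :: nat and X0 :: "real^'p^'n"
    and X :: "nat \<Rightarrow> 'w \<Rightarrow> real^'p^'n"
    and g :: "nat \<Rightarrow> 'w \<Rightarrow> real^'p^'n"
    and e :: "nat \<Rightarrow> 'w \<Rightarrow> nat set"
    and \<Omega> :: "(real^'p^'n) set" and \<tau> lam :: real
begin

lemma space_F: "space (F k) = space M"
  using space_F by blast

lemma subalgebra_F: "subalgebra M (F k)"
  using sets_F space_F by (auto simp: subalgebra_def)

lemma e_in_pairs:
  assumes "k < T" "\<omega> \<in> space M"
  shows "e k \<omega> \<in> pairs"
  using measurable_space[OF e_measurable[OF assms(1)], of \<omega>] assms(2)
  by (simp add: space_F pairs_def)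

lemma update:
  assumes "k < T" "\<omega> \<in> space M"
  shows "block_update (X k \<omega>) (pair_cols \<CC> (e k \<omega>))
    (\<gamma> k *\<^sub>R tangent_proj (X k \<omega>) (pair_cols \<CC> (e k \<omega>)) (g k \<omega>)) (X (Suc k) \<omega>)"
  unfolding block_update_def tangent_proj_def
  using step_ij[OF assms refl refl] step_rest[OF assms refl] by blast

lemma X_stiefel: "k \<le> T \<Longrightarrow> \<omega> \<in> space M \<Longrightarrow> X k \<omega> \<in> stiefel"
proof (induction k)
  case 0
  then show ?case using X_init X0_stiefel by simp
next
  case (Suc k)
  then have X: "X k \<omega> \<in> stiefel" by simp
  have "k < T" using Suc by simp
  from update[OF this Suc.prems(2)] show ?case
    by (rule block_update_stiefel[OF X, rotated])
      (rule subspace_scale[OF subspace_block_tangent tangent_proj_mem[OF X]])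
qed

lemma g_le: "k < T \<Longrightarrow> \<omega> \<in> space M \<Longrightarrow> norm (g k \<omega>) \<le> L"
  using clarke_subdiff_norm_le[OF lipschitz _ subgrad, of k \<omega>] stiefel_\<Omega> X_stiefel[of k \<omega>] by auto

text \<open>h is continuous only on the closed set \<open>stiefel\<close>; extended by 0 it is
  Borel, and the iterates never leave the set.\<close>

lemma measurable_continuous_X:
  fixes h :: "real^'p^'n \<Rightarrow> 'b::{second_countable_topology, real_normed_vector}"
  assumes k: "k \<le> T" and h: "continuous_on stiefel h"
  shows "(\<lambda>\<omega>. h (X k \<omega>)) \<in> borel_measurable (F k)"
proof -
  have "(\<lambda>x. if x \<in> stiefel then h x else 0) \<in> borel_measurable borel"
    by (rule borel_measurable_continuous_on_if[OF _ h]) (auto simp: closed_stiefel)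
  from measurable_compose[OF X_measurable[OF k] this]
  show ?thesis
    by (rule measurable_cong[THEN iffD1, rotated]) (use k X_stiefel in \<open>simp add: space_F\<close>)
qed

lemma integrable_continuous_X:
  fixes h :: "real^'p^'n \<Rightarrow> real"
  assumes k: "k \<le> T" and h: "continuous_on stiefel h"
  shows "integrable M (\<lambda>\<omega>. h (X k \<omega>))"
proof -
  have "bounded (h ` stiefel)"
    by (rule compact_imp_bounded[OF compact_continuous_image[OF h compact_stiefel]])
  then obtain B where B: "\<And>x. x \<in> stiefel \<Longrightarrow> norm (h x) \<le> B" by (auto simp: bounded_iff)
  show ?thesis
  proof (rule integrable_const_bound[of _ B])
    show "AE \<omega> in M. norm (h (X k \<omega>)) \<le> B"
      using B X_stiefel[OF k] by (intro AE_I2) auto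
    show "(\<lambda>\<omega>. h (X k \<omega>)) \<in> borel_measurable M"
      by (rule measurable_from_subalg[OF subalgebra_F measurable_continuous_X[OF k h]])
  qed
qed

lemma prob_e:
  assumes k: "k < T" and e': "e' \<in> pairs"
  shows "prob {\<omega> \<in> space M. e k \<omega> = e'} = 1 / real (l choose 2)"
proof -
  have meas: "e k \<in> measurable M (count_space pairs)"
    unfolding pairs_def by (rule measurable_from_subalg[OF subalgebra_F e_measurable[OF k]])
  have "prob {\<omega> \<in> space M. e k \<omega> = e'} = measure (distr M (count_space pairs) (e k)) {e'}"
    using e' by (subst measure_distr[OF meas]) (auto intro!: arg_cong[where f = prob])
  also have "\<dots> = 1 / real (l choose 2)"
    unfolding e_uniform[OF k, folded pairs_def]
    using e' by (simp add: measure_uniform_count_measure card_pairs)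
  finally show ?thesis .
qed

text \<open>Plays the role of a conditional expectation. The value at the drawn pair is a finite sum
  of \<open>U e'\<close> times an indicator of the draw, and each product factors because
  \<open>U e'\<close> is measurable in \<open>F k\<close>, of which the draw is independent.\<close>

lemma expectation_at_pair:
  fixes U :: "nat set \<Rightarrow> 'w \<Rightarrow> real"
  assumes k: "k < T" and U: "\<And>e'. e' \<in> pairs \<Longrightarrow> U e' \<in> borel_measurable (F k)"
    and int: "\<And>e'. e' \<in> pairs \<Longrightarrow> integrable M (U e')"
  shows "integrable M (\<lambda>\<omega>. U (e k \<omega>) \<omega>)"
    and "expectation (\<lambda>\<omega>. U (e k \<omega>) \<omega>) = expectation (\<lambda>\<omega>. (\<Sum>e'\<in>pairs. U e' \<omega>) / real (l choose 2))"
proof -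
  let ?A = "vimage_algebra (space M) (e k) (count_space pairs)"
  define \<iota> where "\<iota> e' \<omega> = (of_bool (e k \<omega> = e') :: real)" for e' \<omega>
  have meas: "e k \<in> measurable M (count_space pairs)"
    unfolding pairs_def by (rule measurable_from_subalg[OF subalgebra_F e_measurable[OF k]])
  have \<iota>A: "\<iota> e' \<in> borel_measurable ?A" for e'
    unfolding \<iota>_def
    by (rule measurable_compose[OF measurable_vimage_algebra1]) (use e_in_pairs[OF k] in auto)
  have \<iota>M: "\<iota> e' \<in> borel_measurable M" for e'
    unfolding \<iota>_def by (rule measurable_compose[OF meas]) auto
  have UM: "U e' \<in> borel_measurable M" if "e' \<in> pairs" for e'
    by (rule measurable_from_subalg[OF subalgebra_F U[OF that]])
  have indep: "indep_var borel (U e') borel (\<iota> e')" if e': "e' \<in> pairs" for e'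
    unfolding indep_var_eq
  proof (intro conjI UM[OF e'] \<iota>M)
    have 1: "sigma_sets (space M) {U e' -` A \<inter> space M |A. A \<in> sets borel} \<subseteq> sets (F k)"
      using measurable_sets[OF U[OF e']] unfolding space_F[symmetric, of k]
      by (intro sets.sigma_sets_subset) auto
    have 2: "sigma_sets (space M) {\<iota> e' -` A \<inter> space M |A. A \<in> sets borel} \<subseteq> sets ?A"
      using measurable_sets[OF \<iota>A[of e']] sets.sigma_sets_subset[of "{\<iota> e' -` A \<inter> space M |A. A \<in> sets borel}" ?A] by auto
    show "indep_set (sigma_sets (space M) {U e' -` A \<inter> space M |A. A \<in> sets borel})
       (sigma_sets (space M) {\<iota> e' -` A \<inter> space M |A. A \<in> sets borel})"
      using e_indep[OF k, folded pairs_def] unfolding indep_set_def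
      by (rule indep_sets_mono_sets) (use 1 2 in \<open>auto split: bool.split\<close>)
  qed
  have int\<iota>: "integrable M (\<iota> e')" for e'
    by (rule integrable_const_bound[of _ 1]) (auto simp: \<iota>_def[abs_def] intro: \<iota>M[unfolded \<iota>_def])
  have E\<iota>: "expectation (\<iota> e') = 1 / real (l choose 2)" if e': "e' \<in> pairs" for e'
  proof -
    have "expectation (\<iota> e') = expectation (indicator {\<omega> \<in> space M. e k \<omega> = e'})"
      by (rule Bochner_Integration.integral_cong) (auto simp: \<iota>_def indicator_def)
    also have "\<dots> = prob ({\<omega> \<in> space M. e k \<omega> = e'} \<inter> space M)" by simp
    also have "{\<omega> \<in> space M. e k \<omega> = e'} \<inter> space M = {\<omega> \<in> space M. e k \<omega> = e'}" by auto
    finally show ?thesis using prob_e[OF k e'] by simp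
  qed
  have split: "U (e k \<omega>) \<omega> = (\<Sum>e'\<in>pairs. U e' \<omega> * \<iota> e' \<omega>)" if "\<omega> \<in> space M" for \<omega>
  proof -
    have "(\<Sum>e'\<in>pairs. U e' \<omega> * \<iota> e' \<omega>) = (\<Sum>e'\<in>pairs. if e' = e k \<omega> then U e' \<omega> else 0)"
      by (intro sum.cong refl) (auto simp: \<iota>_def)
    then show ?thesis using e_in_pairs[OF k that] by simp
  qed
  have intU: "integrable M (\<lambda>\<omega>. U e' \<omega> * \<iota> e' \<omega>)" if "e' \<in> pairs" for e'
    by (rule indep_var_integrable[OF indep[OF that] int[OF that] int\<iota>])
  show "integrable M (\<lambda>\<omega>. U (e k \<omega>) \<omega>)"
    by (rule Bochner_Integration.integrable_cong[OF refl split, THEN iffD2])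
      (auto intro!: Bochner_Integration.integrable_sum intU)
  have "expectation (\<lambda>\<omega>. U (e k \<omega>) \<omega>) = expectation (\<lambda>\<omega>. \<Sum>e'\<in>pairs. U e' \<omega> * \<iota> e' \<omega>)"
    by (rule Bochner_Integration.integral_cong[OF refl split])
  also have "\<dots> = (\<Sum>e'\<in>pairs. expectation (\<lambda>\<omega>. U e' \<omega> * \<iota> e' \<omega>))"
    by (rule Bochner_Integration.integral_sum) (rule intU)
  also have "\<dots> = (\<Sum>e'\<in>pairs. expectation (U e') / real (l choose 2))"
    by (intro sum.cong refl) (simp add: indep_var_lebesgue_integral[OF indep int int\<iota>] E\<iota>)
  also have "\<dots> = expectation (\<lambda>\<omega>. (\<Sum>e'\<in>pairs. U e' \<omega>) / real (l choose 2))"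
    by (simp add: int sum_divide_distrib Bochner_Integration.integral_sum)
  finally show "expectation (\<lambda>\<omega>. U (e k \<omega>) \<omega>) = expectation (\<lambda>\<omega>. (\<Sum>e'\<in>pairs. U e' \<omega>) / real (l choose 2))" .
qed

abbreviation env :: "nat \<Rightarrow> 'w \<Rightarrow> real" where
  "env k \<omega> \<equiv> moreau_env f \<CC> l lam (X k \<omega>)"

abbreviation stat_sq :: "nat \<Rightarrow> 'w \<Rightarrow> real" where
  "stat_sq k \<omega> \<equiv> (stat_measure f \<CC> l lam (X k \<omega>))\<^sup>2"

lemma integrable_env: "k \<le> T \<Longrightarrow> integrable M (env k)"
  by (rule integrable_continuous_X[OF _ continuous_on_moreau_env])

lemma integrable_stat_sq: "k \<le> T \<Longrightarrow> integrable M (stat_sq k)"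
  by (rule integrable_continuous_X[OF _ continuous_on_stat_measure_sq])

lemma expected_step:
  assumes k: "k < T" and \<gamma>: "(\<gamma> k * L)\<^sup>2 * real l \<le> 1"
  shows "decrease * \<gamma> k * expectation (stat_sq k)
    \<le> expectation (env k) - expectation (env (Suc k)) + 9 * (\<gamma> k * L)\<^sup>2 / (2 * lam)"
proof -
  define P where "P \<omega> = prox_map f \<CC> l lam (X k \<omega>)" for \<omega>
  define U where "U e' \<omega> = step_bound L (\<gamma> k) (X k \<omega>) (P \<omega> - X k \<omega>) (g k \<omega>) e'" for e' \<omega>
  have kT: "k \<le> T" and SkT: "Suc k \<le> T" using k by auto
  have \<gamma>0: "0 \<le> \<gamma> k" using stepsize[OF k] by simp
  have P: "P \<omega> \<in> stiefel" if "\<omega> \<in> space M" for \<omega>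
    unfolding P_def by (rule prox_map_in[OF X_stiefel[OF kT that]])
  have XPg: "(\<lambda>\<omega>. (X k \<omega>, P \<omega>, g k \<omega>)) \<in> borel_measurable (F k)"
    unfolding P_def
    by (intro borel_measurable_Pair X_measurable[OF kT] g_measurable[OF k] measurable_continuous_X[OF kT continuous_on_prox_map])
  have U_meas: "U e' \<in> borel_measurable (F k)" for e'
    using measurable_compose[OF XPg borel_measurable_continuous_onI[OF continuous_on_step_bound]]
    by (simp add: U_def[abs_def])
  have U_int: "integrable M (U e')" for e'
  proof -
    \<comment> \<open>Iterate, proximal point and subgradient stay in this compact set, which gives
      a uniform bound and hence integrability.\<close>
    have "compact ((\<lambda>(X :: real^'p^'n, P, g). step_bound L (\<gamma> k) X (P - X) g e') ` (stiefel \<times> stiefel \<times> cball 0 L))"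
      by (intro compact_continuous_image compact_Times compact_stiefel compact_cball
          continuous_on_subset[OF continuous_on_step_bound]) auto
    then obtain B where B: "\<And>(X :: real^'p^'n) P g. X \<in> stiefel \<Longrightarrow> P \<in> stiefel \<Longrightarrow> norm g \<le> L \<Longrightarrow>
        norm (step_bound L (\<gamma> k) X (P - X) g e') \<le> B"
      by (fastforce dest!: compact_imp_bounded simp: bounded_iff)
    show ?thesis
    proof (rule integrable_const_bound[of _ B])
      show "AE \<omega> in M. norm (U e' \<omega>) \<le> B"
        unfolding U_def by (intro AE_I2 B X_stiefel[OF kT] P g_le[OF k])
      show "U e' \<in> borel_measurable M"
        by (rule measurable_from_subalg[OF subalgebra_F U_meas])
    qed
  qed
  note U_avg = expectation_at_pair[OF k, of U, OF U_meas U_int]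
  let ?avg = "\<lambda>\<omega>. (\<Sum>e'\<in>pairs. U e' \<omega>) / real (l choose 2)"
  have step: "env (Suc k) \<omega> \<le> env k \<omega> + real l / (4 * lam) * U (e k \<omega>) \<omega>" if \<omega>: "\<omega> \<in> space M" for \<omega>
    unfolding U_def P_def
    by (rule moreau_env_update_le[OF X_stiefel[OF kT \<omega>] e_in_pairs[OF k \<omega>] refl \<gamma>0 \<gamma> g_le[OF k \<omega>] update[OF k \<omega>]])
  have avg: "real l / (4 * lam) * ?avg \<omega> \<le> - (decrease * \<gamma> k * stat_sq k \<omega>) + 9 * (\<gamma> k * L)\<^sup>2 / (2 * lam)"
    if \<omega>: "\<omega> \<in> space M" for \<omega>
    unfolding U_def P_def
  proof (rule avg_step_bound_le_decrease[OF X_stiefel[OF kT \<omega>] \<gamma>0 g_le[OF k \<omega>]])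
    show "inner (g k \<omega>) (prox_map f \<CC> l lam (X k \<omega>) - X k \<omega>)
      \<le> f (prox_map f \<CC> l lam (X k \<omega>)) - f (X k \<omega>) + \<tau> / 2 * (norm (prox_map f \<CC> l lam (X k \<omega>) - X k \<omega>))\<^sup>2"
      using stiefel_\<Omega> X_stiefel[OF kT \<omega>] P[OF \<omega>, unfolded P_def]
      by (intro clarke_subgradient_inequality[OF lipschitz weakly_convex \<tau> _ _ subgrad[OF k \<omega>]]) auto
  qed
  have int_avg: "integrable M ?avg" using U_int by (intro integrable_divide Bochner_Integration.integrable_sum) auto
  have "expectation (env (Suc k)) \<le> expectation (\<lambda>\<omega>. env k \<omega> + real l / (4 * lam) * U (e k \<omega>) \<omega>)"
    using step by (intro integral_mono integrable_env SkT Bochner_Integration.integrable_add kT integrable_mult_right U_avg(1)) auto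
  also have "\<dots> = expectation (env k) + real l / (4 * lam) * expectation (\<lambda>\<omega>. U (e k \<omega>) \<omega>)"
    using integrable_env[OF kT] U_avg(1) by simp
  also have "real l / (4 * lam) * expectation (\<lambda>\<omega>. U (e k \<omega>) \<omega>) = expectation (\<lambda>\<omega>. real l / (4 * lam) * ?avg \<omega>)"
    unfolding U_avg(2) by simp
  also have "\<dots> \<le> expectation (\<lambda>\<omega>. - (decrease * \<gamma> k * stat_sq k \<omega>) + 9 * (\<gamma> k * L)\<^sup>2 / (2 * lam))"
    using avg int_avg integrable_stat_sq[OF kT]
    by (intro integral_mono integrable_mult_right Bochner_Integration.integrable_add integrable_minus) auto
  also have "\<dots> = - (decrease * \<gamma> k * expectation (stat_sq k)) + 9 * (\<gamma> k * L)\<^sup>2 / (2 * lam)"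
    using integrable_stat_sq[OF kT] by (simp add: prob_space)
  finally show ?thesis by simp
qed

lemma expected_virtual_step:
  assumes \<gamma>: "0 \<le> \<gamma> T" "(\<gamma> T * L)\<^sup>2 * real l \<le> 1"
  shows "decrease * \<gamma> T * expectation (stat_sq T)
    \<le> expectation (env T) - (INF Y\<in>stiefel. moreau_env f \<CC> l lam Y) + 9 * (\<gamma> T * L)\<^sup>2 / (2 * lam)"
proof -
  let ?I = "INF Y\<in>stiefel. moreau_env f \<CC> l lam Y"
  have "expectation (\<lambda>\<omega>. decrease * \<gamma> T * stat_sq T \<omega>) \<le> expectation (\<lambda>\<omega>. env T \<omega> + (9 * (\<gamma> T * L)\<^sup>2 / (2 * lam) - ?I))"
    using virtual_step[OF X_stiefel[OF order_refl] \<gamma>]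
    by (intro integral_mono integrable_mult_right Bochner_Integration.integrable_add integrable_env integrable_stat_sq)
      (auto simp: algebra_simps)
  then show ?thesis
    using integrable_env[of T] integrable_stat_sq[of T] by (simp add: prob_space)
qed

text \<open>Index T is included: the summands below T come from the algorithm, the one at T from the
  imagined step, which also replaces \<open>expectation (env T)\<close> by the infimum.\<close>

lemma telescoped:
  assumes "\<And>k. k \<le> T \<Longrightarrow> 0 \<le> \<gamma> k" and "\<And>k. k \<le> T \<Longrightarrow> (\<gamma> k * L)\<^sup>2 * real l \<le> 1"
  shows "decrease * (\<Sum>k\<le>T. \<gamma> k * expectation (stat_sq k))
    \<le> moreau_env f \<CC> l lam X0 - (INF Y\<in>stiefel. moreau_env f \<CC> l lam Y) + 9 / (2 * lam) * (\<Sum>k\<le>T. (\<gamma> k * L)\<^sup>2)"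
proof -
  have "expectation (env 0) = expectation (\<lambda>\<omega>. moreau_env f \<CC> l lam X0)"
    by (rule Bochner_Integration.integral_cong) (auto simp: X_init)
  then have env0: "expectation (env 0) = moreau_env f \<CC> l lam X0" by (simp add: prob_space)
  have *: "decrease * (\<Sum>k<n. \<gamma> k * expectation (stat_sq k))
    \<le> moreau_env f \<CC> l lam X0 - expectation (env n) + 9 / (2 * lam) * (\<Sum>k<n. (\<gamma> k * L)\<^sup>2)" if "n \<le> T" for n
    using that
  proof (induction n)
    case 0
    then show ?case by (simp add: env0)
  next
    case (Suc n)
    then show ?case
      using expected_step[of n] assms(2)[of n] by (simp add: distrib_left mult.assoc)
  qed
  show ?thesis
    using *[OF order_refl] expected_virtual_step[OF assms(1)[OF order_refl] assms(2)[OF order_refl]]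
    by (simp add: lessThan_Suc_atMost[symmetric] distrib_left mult.assoc)
qed

text \<open>With s any positive lower bound for the sum of the step sizes and B any upper bound for
  the error, one statement serves both schedules.\<close>

lemma min_expectation_le:
  assumes "\<And>k. k \<le> T \<Longrightarrow> 0 \<le> \<gamma> k" and "\<And>k. k \<le> T \<Longrightarrow> (\<gamma> k * L)\<^sup>2 * real l \<le> 1"
    and s: "0 < s" "s \<le> (\<Sum>k\<le>T. \<gamma> k)" and B: "9 / (2 * lam) * (\<Sum>k\<le>T. (\<gamma> k * L)\<^sup>2) \<le> B"
  shows "(MIN k\<in>{0..T}. expectation (stat_sq k))
    \<le> (moreau_env f \<CC> l lam X0 - (INF Y\<in>stiefel. moreau_env f \<CC> l lam Y) + B) / (decrease * s)"
proof -
  define m where "m = (MIN k\<in>{0..T}. expectation (stat_sq k))"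
  have m_le: "m \<le> expectation (stat_sq k)" if "k \<le> T" for k
    unfolding m_def using that by (intro Min_le) auto
  \<comment> \<open>The sign matters for passing from the sum of the step sizes down to s.\<close>
  have m0: "0 \<le> m"
    unfolding m_def by (subst Min_ge_iff) auto
  have "decrease * (s * m) \<le> decrease * ((\<Sum>k\<le>T. \<gamma> k) * m)"
    using s m0 decrease_pos by (intro mult_left_mono mult_right_mono) auto
  also have "\<dots> \<le> decrease * (\<Sum>k\<le>T. \<gamma> k * expectation (stat_sq k))"
    unfolding sum_distrib_right using assms(1) m_le decrease_pos by (intro mult_left_mono sum_mono) auto
  also have "\<dots> \<le> moreau_env f \<CC> l lam X0 - (INF Y\<in>stiefel. moreau_env f \<CC> l lam Y) + B"
    using telescoped[OF assms(1,2)] B by simp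
  finally show ?thesis
    using decrease_pos s unfolding m_def[symmetric] by (simp add: pos_le_divide_eq mult_ac)
qed

end

section \<open>The two step-size schedules\<close>

lemma harmonic_sum_le: "(\<Sum>k\<le>n. 1 / (real k + 1)) \<le> 1 + ln (real n + 1)"
proof (induction n)
  case (Suc n)
  have "ln ((real n + 1) / (real n + 2)) \<le> (real n + 1) / (real n + 2) - 1"
    by (rule ln_le_minus_one) auto
  also have "\<dots> = - 1 / (real n + 2)" by (simp add: field_simps)
  finally have "1 / (real n + 2) \<le> ln (real n + 2) - ln (real n + 1)"
    by (simp add: ln_div)
  then show ?case using Suc.IH by (simp add: add.commute)
qed simp

theorem theorem4p9:
  fixes f :: "real^'p^'n \<Rightarrow> real"
    and \<Omega> :: "(real^'p^'n) set"
    and X0 :: "real^'p^'n"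
    and \<CC> :: "nat \<Rightarrow> 'p set"
    and M :: "'w measure" and F :: "nat \<Rightarrow> 'w measure"
    and X g :: "nat \<Rightarrow> 'w \<Rightarrow> real^'p^'n"
    and e :: "nat \<Rightarrow> 'w \<Rightarrow> nat set"
    and \<tau> L lam :: real
    and \<gamma> :: "nat \<Rightarrow> real"
    and l T :: nat
  assumes "CARD('p) \<le> CARD('n)"
    and "\<tau> \<ge> 0" and "L > 0"
    and "bounded \<Omega>" and "convex \<Omega>" and "stiefel \<subseteq> interior \<Omega>"
    and "weakly_convex_on \<tau> \<Omega> f" and "L-lipschitz_on \<Omega> f"
    and "column_partition \<CC> l"
    and "0 < lam" and "lam < real l / (2 * (\<tau> + (2 * real l - 1) * L))"
    and "T \<ge> 1"
    and "rssm M F f L \<CC> l \<gamma> T X0 X g e"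
  shows
    "(\<forall>k\<le>T. integrable M (\<lambda>\<omega>. (stat_measure f \<CC> l lam (X k \<omega>))\<^sup>2)) \<and>
     (\<forall>\<Delta>. 0 < \<Delta> \<and> \<Delta> \<le> 1 / L \<and> (\<forall>k\<le>T. \<gamma> k = \<Delta> / sqrt (real l * (real T + 1))) \<longrightarrow>
        (MIN k\<in>{0..T}. prob_space.expectation M (\<lambda>\<omega>. (stat_measure f \<CC> l lam (X k \<omega>))\<^sup>2))
        \<le> (moreau_env f \<CC> l lam X0 - (INF Y\<in>stiefel. moreau_env f \<CC> l lam Y)
             + 9 * L^2 * \<Delta>^2 / (2 * lam * real l)
             + 2 * L^3 * \<Delta>^3 / (lam * sqrt (real l * (real T + 1)))
             + L^4 * \<Delta>^4 / (2 * lam * real l * (real T + 1)))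
          / (lam / real l * (real l / (2 * lam) - (\<tau> + (2 * real l - 3) * L))
               * (\<Delta> / sqrt (real l)) * sqrt (real T + 1))) \<and>
     (\<forall>\<Delta>\<^sub>m\<^sub>i\<^sub>n \<Delta>. 0 < \<Delta>\<^sub>m\<^sub>i\<^sub>n \<and> (\<forall>k\<le>T. \<Delta>\<^sub>m\<^sub>i\<^sub>n \<le> \<Delta> k \<and> \<Delta> k \<le> 1 / L) \<and>
        (\<forall>k\<le>T. \<gamma> k = \<Delta> k / sqrt (real l * (real k + 1))) \<longrightarrow>
        (MIN k\<in>{0..T}. prob_space.expectation M (\<lambda>\<omega>. (stat_measure f \<CC> l lam (X k \<omega>))\<^sup>2))
        \<le> (moreau_env f \<CC> l lam X0 - (INF Y\<in>stiefel. moreau_env f \<CC> l lam Y)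
             + (9 * (1 + ln (real T)) + 6 * sqrt (real l) + 2) / (2 * lam * real l))
          / (lam / real l * (real l / (2 * lam) - (\<tau> + (2 * real l - 3) * L))
               * (\<Delta>\<^sub>m\<^sub>i\<^sub>n / sqrt (real l)) * sqrt (real T + 1)))"
proof -
  interpret rssm_prox M F f L \<CC> l \<gamma> T X0 X g e \<Omega> \<tau> lam
    using assms by (intro rssm_prox.intro stiefel_prox.intro column_blocks.intro stiefel_prox_axioms.intro)
  have l2: "2 \<le> real l" using l_ge_2 by simp
  let ?D = "moreau_env f \<CC> l lam X0 - (INF Y\<in>stiefel. moreau_env f \<CC> l lam Y)"
  \<comment> \<open>Here x is T + 1 or k + 1. The root of l in the schedules is what yields
    (\<gamma> L)^2 l \<le> 1, already at x = 1.\<close>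
  have small: "((d / sqrt (real l * x)) * L)\<^sup>2 * real l \<le> 1" "0 \<le> d / sqrt (real l * x)"
      "((d / sqrt (real l * x)) * L)\<^sup>2 \<le> 1 / real l * (1 / x)"
    if d: "0 < d" "d \<le> 1 / L" and x: "1 \<le> x" for d x
  proof -
    have "d * L \<le> 1" using d \<open>L > 0\<close> by (simp add: field_simps)
    then have dL: "(d * L)\<^sup>2 \<le> 1" using d \<open>L > 0\<close> by (intro power_le_one) auto
    have eq: "((d / sqrt (real l * x)) * L)\<^sup>2 = (d * L)\<^sup>2 * (1 / real l * (1 / x))"
      using x l2 by (simp add: power_divide power_mult_distrib)
    have "(d * L)\<^sup>2 * (1 / real l * (1 / x)) \<le> 1 * (1 / real l * (1 / x))"
      using dL x l2 by (intro mult_right_mono) auto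
    then show le: "((d / sqrt (real l * x)) * L)\<^sup>2 \<le> 1 / real l * (1 / x)" unfolding eq by simp
    have "((d / sqrt (real l * x)) * L)\<^sup>2 * real l \<le> 1 / real l * (1 / x) * real l"
      using le l2 by (intro mult_right_mono) auto
    also have "\<dots> \<le> 1" using x l2 by simp
    finally show "((d / sqrt (real l * x)) * L)\<^sup>2 * real l \<le> 1" .
    show "0 \<le> d / sqrt (real l * x)" using d x l2 by simp
  qed
  show ?thesis
  proof (intro conjI allI impI)
    fix k assume "k \<le> T"
    then show "integrable M (\<lambda>\<omega>. (stat_measure f \<CC> l lam (X k \<omega>))\<^sup>2)"
      by (rule integrable_stat_sq)
  next
    fix \<Delta>
    assume "0 < \<Delta> \<and> \<Delta> \<le> 1 / L \<and> (\<forall>k\<le>T. \<gamma> k = \<Delta> / sqrt (real l * (real T + 1)))"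
    then have \<Delta>: "0 < \<Delta>" "\<Delta> \<le> 1 / L" and \<gamma>: "\<And>k. k \<le> T \<Longrightarrow> \<gamma> k = \<Delta> / sqrt (real l * (real T + 1))"
      by auto
    have sum\<gamma>: "(\<Sum>k\<le>T. \<gamma> k) = \<Delta> / sqrt (real l) * sqrt (real T + 1)"
    proof -
      have "(\<Sum>k\<le>T. \<gamma> k) = (real T + 1) * (\<Delta> / sqrt (real l * (real T + 1)))"
        using \<gamma> by simp
      also have "\<dots> = \<Delta> / sqrt (real l) * ((real T + 1) / sqrt (real T + 1))"
        by (simp add: real_sqrt_mult)
      also have "(real T + 1) / sqrt (real T + 1) = sqrt (real T + 1)"
        by (rule real_div_sqrt) simp
      finally show ?thesis .
    qed
    have "(\<Sum>k\<le>T. (\<gamma> k * L)\<^sup>2) = (real T + 1) * (\<Delta> / sqrt (real l * (real T + 1)) * L)\<^sup>2"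
      using \<gamma> by simp
    also have "\<dots> = L^2 * \<Delta>^2 / real l"
      using l2 by (simp add: power_mult_distrib power_divide)
    finally have "9 / (2 * lam) * (\<Sum>k\<le>T. (\<gamma> k * L)\<^sup>2) = 9 * L^2 * \<Delta>^2 / (2 * lam * real l)"
      by simp
    \<comment> \<open>The error sum equals the quadratic term of the stated bound; the cubic and
      quartic terms are nonnegative and enlarge it.\<close>
    moreover have "0 \<le> 2 * L^3 * \<Delta>^3 / (lam * sqrt (real l * (real T + 1)))"
      "0 \<le> L^4 * \<Delta>^4 / (2 * lam * real l * (real T + 1))"
      using \<open>0 < lam\<close> \<open>L > 0\<close> \<Delta> by simp_all
    ultimately have err: "9 / (2 * lam) * (\<Sum>k\<le>T. (\<gamma> k * L)\<^sup>2)
      \<le> 9 * L^2 * \<Delta>^2 / (2 * lam * real l) + 2 * L^3 * \<Delta>^3 / (lam * sqrt (real l * (real T + 1)))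
             + L^4 * \<Delta>^4 / (2 * lam * real l * (real T + 1))"
      by linarith
    have "(MIN k\<in>{0..T}. expectation (stat_sq k)) \<le>
       (?D + (9 * L^2 * \<Delta>^2 / (2 * lam * real l) + 2 * L^3 * \<Delta>^3 / (lam * sqrt (real l * (real T + 1)))
             + L^4 * \<Delta>^4 / (2 * lam * real l * (real T + 1)))) / (decrease * (\<Delta> / sqrt (real l) * sqrt (real T + 1)))"
    proof (rule min_expectation_le[OF _ _ _ _ err])
      show "0 < \<Delta> / sqrt (real l) * sqrt (real T + 1)" using \<Delta> l2 by simp
      show "\<Delta> / sqrt (real l) * sqrt (real T + 1) \<le> (\<Sum>k\<le>T. \<gamma> k)" unfolding sum\<gamma> ..
    qed (use small[OF \<Delta>, of "real T + 1"] in \<open>simp_all add: \<gamma>\<close>)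
    then show "(MIN k\<in>{0..T}. expectation (stat_sq k))
        \<le> (?D + 9 * L^2 * \<Delta>^2 / (2 * lam * real l)
             + 2 * L^3 * \<Delta>^3 / (lam * sqrt (real l * (real T + 1)))
             + L^4 * \<Delta>^4 / (2 * lam * real l * (real T + 1)))
          / (lam / real l * (real l / (2 * lam) - (\<tau> + (2 * real l - 3) * L))
               * (\<Delta> / sqrt (real l)) * sqrt (real T + 1))"
      by (simp only: decrease_def add.assoc mult.assoc)
  next
    fix \<Delta>\<^sub>m\<^sub>i\<^sub>n :: real and \<Delta> :: "nat \<Rightarrow> real"
    assume "0 < \<Delta>\<^sub>m\<^sub>i\<^sub>n \<and> (\<forall>k\<le>T. \<Delta>\<^sub>m\<^sub>i\<^sub>n \<le> \<Delta> k \<and> \<Delta> k \<le> 1 / L) \<and>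
        (\<forall>k\<le>T. \<gamma> k = \<Delta> k / sqrt (real l * (real k + 1)))"
    then have \<Delta>m: "0 < \<Delta>\<^sub>m\<^sub>i\<^sub>n" and \<Delta>: "\<And>k. k \<le> T \<Longrightarrow> \<Delta>\<^sub>m\<^sub>i\<^sub>n \<le> \<Delta> k" "\<And>k. k \<le> T \<Longrightarrow> \<Delta> k \<le> 1 / L"
      and \<gamma>: "\<And>k. k \<le> T \<Longrightarrow> \<gamma> k = \<Delta> k / sqrt (real l * (real k + 1))"
      by auto
    have \<Delta>0: "0 < \<Delta> k" if "k \<le> T" for k using \<Delta>(1)[OF that] \<Delta>m by simp
    have s: "\<Delta>\<^sub>m\<^sub>i\<^sub>n / sqrt (real l) * sqrt (real T + 1) \<le> (\<Sum>k\<le>T. \<gamma> k)"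
    proof -
      have "\<Delta>\<^sub>m\<^sub>i\<^sub>n / sqrt (real l) * sqrt (real T + 1) = \<Delta>\<^sub>m\<^sub>i\<^sub>n / sqrt (real l) * ((real T + 1) / sqrt (real T + 1))"
        by (subst real_div_sqrt) simp_all
      \<comment> \<open>T + 1 copies of the smallest admissible step size, namely
        \<open>\<Delta>\<^sub>m\<^sub>i\<^sub>n\<close> with k = T, still sum to the order of sqrt
        (T + 1).\<close>
      also have "\<dots> = (\<Sum>k\<le>T. \<Delta>\<^sub>m\<^sub>i\<^sub>n / sqrt (real l * (real T + 1)))"
        by (simp add: real_sqrt_mult)
      also have "\<dots> \<le> (\<Sum>k\<le>T. \<gamma> k)"
      proof (rule sum_mono)
        fix k assume "k \<in> {..T}"
        then have k: "k \<le> T" by simp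
        show "\<Delta>\<^sub>m\<^sub>i\<^sub>n / sqrt (real l * (real T + 1)) \<le> \<gamma> k"
          unfolding \<gamma>[OF k] using \<Delta>(1)[OF k] \<Delta>m k l2
          by (intro frac_le real_sqrt_le_mono mult_left_mono) auto
      qed
      finally show ?thesis .
    qed
    have err: "9 / (2 * lam) * (\<Sum>k\<le>T. (\<gamma> k * L)\<^sup>2) \<le> (9 * (1 + ln (real T)) + 6 * sqrt (real l) + 2) / (2 * lam * real l)"
    proof -
      have "(\<Sum>k\<le>T. (\<gamma> k * L)\<^sup>2) \<le> (\<Sum>k\<le>T. 1 / real l * (1 / (real k + 1)))"
        using small(3)[OF \<Delta>0 \<Delta>(2)] by (intro sum_mono) (simp add: \<gamma>)
      also have "\<dots> \<le> 1 / real l * (1 + ln (real T + 1))"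
        unfolding sum_distrib_left[symmetric] by (intro mult_left_mono harmonic_sum_le) simp
      finally have "9 / (2 * lam) * (\<Sum>k\<le>T. (\<gamma> k * L)\<^sup>2) \<le> 9 / (2 * lam) * (1 / real l * (1 + ln (real T + 1)))"
        using \<open>0 < lam\<close> by (intro mult_left_mono) auto
      also have "\<dots> = 9 * (1 + ln (real T + 1)) / (2 * lam * real l)" by simp
      also have "\<dots> \<le> (9 * (1 + ln (real T)) + 6 * sqrt (real l) + 2) / (2 * lam * real l)"
      proof (rule divide_right_mono)
        \<comment> \<open>T \<ge> 1 enters here. The shift from ln (T + 1) to ln T costs 9, which 6
          sqrt l + 2 covers as soon as sqrt l \<ge> 7 / 6.\<close>
        have "ln (real T + 1) \<le> ln (2 * real T)" using \<open>T \<ge> 1\<close> by (subst ln_le_cancel_iff) auto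
        also have "\<dots> = ln 2 + ln (real T)" using \<open>T \<ge> 1\<close> by (subst ln_mult) auto
        also have "ln 2 \<le> (1::real)" using ln_le_minus_one[of "2::real"] by simp
        finally have "ln (real T + 1) \<le> 1 + ln (real T)" by simp
        moreover have "7 / 6 \<le> sqrt (real l)" using l2 by (intro real_le_rsqrt) (simp add: power2_eq_square)
        ultimately show "9 * (1 + ln (real T + 1)) \<le> 9 * (1 + ln (real T)) + 6 * sqrt (real l) + 2"
          by simp
      qed (use \<open>0 < lam\<close> in simp)
      finally show ?thesis .
    qed
    have "(MIN k\<in>{0..T}. expectation (stat_sq k)) \<le>
       (?D + (9 * (1 + ln (real T)) + 6 * sqrt (real l) + 2) / (2 * lam * real l))
        / (decrease * (\<Delta>\<^sub>m\<^sub>i\<^sub>n / sqrt (real l) * sqrt (real T + 1)))"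
    proof (rule min_expectation_le[OF _ _ _ s err])
      show "0 < \<Delta>\<^sub>m\<^sub>i\<^sub>n / sqrt (real l) * sqrt (real T + 1)" using \<Delta>m l2 by simp
    qed (use small[OF \<Delta>0 \<Delta>(2)] in \<open>simp_all add: \<gamma>\<close>)
    then show "(MIN k\<in>{0..T}. expectation (stat_sq k))
        \<le> (?D + (9 * (1 + ln (real T)) + 6 * sqrt (real l) + 2) / (2 * lam * real l))
          / (lam / real l * (real l / (2 * lam) - (\<tau> + (2 * real l - 3) * L))
               * (\<Delta>\<^sub>m\<^sub>i\<^sub>n / sqrt (real l)) * sqrt (real T + 1))"
      by (simp only: decrease_def mult.assoc)
  qed
qed

end
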